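(* Let $F=(f_1,\dots,f_p)$ be a tuple of polynomials on $\mathbb{C}^n$ and let $f=\prod_{i=1}^p f_i$, assumed nonzero. Let $\nabla:\mathbb{C}^p\to\mathbb{C}^p$ be the map $\nabla(\alpha_1,\dots,\alpha_p)=(\alpha_1+1,\dots,\alpha_p+1)$ and let $\Delta=\{s_1=\dots=s_p\}\subset\mathbb{C}^p$. Then $$(Z(B_F)\cap\Delta)\setminus\bigcup_{i>0}\nabla^i(Z(B_F))\subset Z(b_f),$$ where $Z(b_f)\subset\mathbb{C}$ is identified with a subset of $\Delta$ via $c\mapsto(c,\dots,c)$.
   Context: Let $D_n$ be the $n$-th Weyl algebra over $\mathbb{C}$ (polynomial differential operators on $\mathbb{C}^n$). The free rank-one module $\mathbb{C}[x_1,\dots,x_n,s_1,\dots,s_p,f^{-1}]\,f_1^{s_1}\cdots f_p^{s_p}$ over $\mathbb{C}[x_1,\dots,x_n,s_1,\dots,s_p,f^{-1}]$ is a left $D_n[s_1,\dots,s_p]$-module (with the $s_j$ central) via $\partial_i(g\, f_1^{s_1}\cdots f_p^{s_p})=\left(\partial_i g+g\sum_{j}s_j\frac{\partial_i f_j}{f_j}\right)f_1^{s_1}\cdots f_p^{s_p}$, and $f_1^{s_1+1}\cdots f_p^{s_p+1}$ means $f\cdot f_1^{s_1}\cdots f_p^{s_p}$. The Bernstein-Sato ideal $B_F\subset\mathbb{C}[s_1,\dots,s_p]$ is the ideal of all $b\in\mathbb{C}[s_1,\dots,s_p]$ for which there is $P\in D_n[s_1,\dots,s_p]$ with $b\,f_1^{s_1}\cdots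 f_p^{s_p}=P\,f_1^{s_1+1}\cdots f_p^{s_p+1}$. The Bernstein-Sato polynomial $b_f\in\mathbb{C}[s]$ is the monic generator of the Bernstein-Sato ideal of the one-element tuple $(f)$, i.e. of the ideal of $b(s)\in\mathbb{C}[s]$ with $b(s)f^s\in D_n[s]f^{s+1}$. $Z(\cdot)$ denotes the zero locus, and $\nabla^i$ the $i$-fold iterate of $\nabla$. *)

theory Defs
  imports
    "HOL-Library.Poly_Mapping"
    "HOL-Computational_Algebra.Polynomial_Factorial"
    "HOL-Analysis.Finite_Cartesian_Product"
begin

section \<open>Multivariate polynomials and partial derivatives\<close>

type_synonym ('v, 'a) mpoly = "('v \<Rightarrow>\<^sub>0 nat) \<Rightarrow>\<^sub>0 'a"

definition mconst :: "'a::zero \<Rightarrow> ('v, 'a) mpoly" where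
  "mconst c = Poly_Mapping.single 0 c"

definition mvar :: "'v \<Rightarrow> ('v, 'a::zero_neq_one) mpoly" where
  "mvar v = Poly_Mapping.single (Poly_Mapping.single v 1) 1"

definition meval :: "('v::finite, complex) mpoly \<Rightarrow> complex ^ 'v \<Rightarrow> complex" where
  "meval b \<alpha> = (\<Sum>m \<in> Poly_Mapping.keys b.
     Poly_Mapping.lookup b m * (\<Prod>v\<in>UNIV. (\<alpha> $ v) ^ Poly_Mapping.lookup m v))"

text \<open>If the exponent of \<open>v\<close> in \<open>m\<close> is \<open>0\<close>, the (truncating) subtraction below is
  harmless, because the coefficient then vanishes.\<close>

definition pdiff :: "'v \<Rightarrow> ('v, 'a) mpoly \<Rightarrow> ('v, 'a::comm_ring_1) mpoly" where
  "pdiff v p = (\<Sum>m \<in> Poly_Mapping.keys p.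
     Poly_Mapping.single (m - Poly_Mapping.single v 1)
       (of_nat (Poly_Mapping.lookup m v) * Poly_Mapping.lookup p m))"

lemma pdiff_superset:
  assumes "finite A" "Poly_Mapping.keys p \<subseteq> A"
  shows "pdiff v p = (\<Sum>m \<in> A. Poly_Mapping.single (m - Poly_Mapping.single v 1)
       (of_nat (Poly_Mapping.lookup m v) * Poly_Mapping.lookup p m))"
  unfolding pdiff_def using assms
  by (intro sum.mono_neutral_left) (auto simp: in_keys_iff)

lemma pdiff_add: "pdiff v (p + q) = pdiff v p + pdiff v q"
proof -
  let ?A = "Poly_Mapping.keys p \<union> Poly_Mapping.keys q"
  have "Poly_Mapping.keys (p + q) \<subseteq> ?A"
    by (rule Poly_Mapping.keys_add)
  then show ?thesis
    by (simp add: pdiff_superset[of ?A] lookup_add distrib_left single_add sum.distrib)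
qed

lemma pdiff_sum: "pdiff v (sum f A) = (\<Sum>a\<in>A. pdiff v (f a))"
proof -
  have "pdiff v 0 = 0"
    by (simp add: pdiff_def)
  then show ?thesis
    by (induction A rule: infinite_finite_induct) (simp_all add: pdiff_add)
qed

lemma pdiff_single:
  "pdiff v (Poly_Mapping.single m c) =
     Poly_Mapping.single (m - Poly_Mapping.single v 1) (of_nat (Poly_Mapping.lookup m v) * c)"
  by (subst pdiff_superset[of "{m}"]) (auto simp: keys_single)

lemma mpoly_as_sum:
  "p = (\<Sum>m \<in> Poly_Mapping.keys p. Poly_Mapping.single m (Poly_Mapping.lookup p m))"
  by (rule poly_mapping_eqI)
    (auto simp: lookup_sum lookup_single when_def sum.delta in_keys_iff)

lemma pdiff_mult_single:
  "pdiff v (Poly_Mapping.single m a * Poly_Mapping.single k b) =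
     pdiff v (Poly_Mapping.single m a) * Poly_Mapping.single k b +
     Poly_Mapping.single m a * pdiff v (Poly_Mapping.single k b)"
proof -
  let ?e = "Poly_Mapping.single v 1 :: 'a \<Rightarrow>\<^sub>0 nat"
  have shift: "(m - ?e) + k = (m + k) - ?e" if "Poly_Mapping.lookup m v \<noteq> 0" for m k
    using that by (intro poly_mapping_eqI)
      (auto simp: lookup_add lookup_minus lookup_single when_def)
  have l: "Poly_Mapping.single ((m - ?e) + k) (of_nat (Poly_Mapping.lookup m v) * a * b) =
      Poly_Mapping.single ((m + k) - ?e) (of_nat (Poly_Mapping.lookup m v) * a * b)"
  proof (cases "Poly_Mapping.lookup m v = 0")
    case False
    show ?thesis
      by (simp only: shift[OF False])
  qed simp
  have r: "Poly_Mapping.single (m + (k - ?e)) (a * (of_nat (Poly_Mapping.lookup k v) * b)) =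
      Poly_Mapping.single ((m + k) - ?e) (a * (of_nat (Poly_Mapping.lookup k v) * b))"
  proof (cases "Poly_Mapping.lookup k v = 0")
    case False
    show ?thesis
      by (simp only: add.commute[of m] shift[OF False])
  qed simp
  show ?thesis
    unfolding pdiff_single mult_single l r
    by (simp only: lookup_add of_nat_add single_add[symmetric]) (simp only: distrib_right mult.assoc mult.left_commute[of a])
qed

lemma pdiff_mult: "pdiff v (p * q) = pdiff v p * q + p * pdiff v q"
proof -
  have sums: "pdiff v (sum f A * sum g B) = pdiff v (sum f A) * sum g B + sum f A * pdiff v (sum g B)"
    if "\<And>m k. pdiff v (f m * g k) = pdiff v (f m) * g k + f m * pdiff v (g k)"
    for f g :: "('a \<Rightarrow>\<^sub>0 nat) \<Rightarrow> ('a, 'b) mpoly" and A B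
    by (simp only: sum_product pdiff_sum that sum.distrib)
  show ?thesis
    using sums[OF pdiff_mult_single, of "\<lambda>m. m" "Poly_Mapping.lookup p" "Poly_Mapping.keys p"
        "\<lambda>k. k" "Poly_Mapping.lookup q" "Poly_Mapping.keys q"]
    by (simp only: mpoly_as_sum[symmetric])
qed

section \<open>Rational functions in the variables \<open>x\<close>\<close>

text \<open>The index type \<open>'n\<close> carries a linear order because this is what makes the polynomial
  ring an instance of class \<open>idom\<close>, as required for its fraction field.\<close>

type_synonym 'n xpoly = "('n, complex) mpoly"

type_synonym 'n ratfun = "'n xpoly fract"

definition rdiff :: "'n::linorder \<Rightarrow> 'n ratfun \<Rightarrow> 'n ratfun" where
  "rdiff v q = (let (a, b) = (SOME (a, b). b \<noteq> 0 \<and> q = Fract a b)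
     in Fract (pdiff v a * b - a * pdiff v b) (b * b))"

lemma rdiff_Fract:
  fixes v :: "'n::linorder" and a b :: "'n xpoly"
  assumes "b \<noteq> 0"
  shows "rdiff v (Fract a b) = Fract (pdiff v a * b - a * pdiff v b) (b * b)"
proof -
  define P where "P = (\<lambda>(c, d). d \<noteq> 0 \<and> Fract a b = Fract c d)"
  obtain c d where cd: "Eps P = (c, d)"
    by (cases "Eps P") auto
  have "P (a, b)"
    using assms by (simp add: P_def)
  then have "P (Eps P)"
    by (rule someI[of P])
  then have d: "d \<noteq> 0" and "Fract a b = Fract c d"
    unfolding cd by (simp_all add: P_def)
  then have eq: "a * d = c * b"
    using assms by (simp add: eq_fract)
  have "pdiff v a * d + a * pdiff v d = pdiff v c * b + c * pdiff v b"
    using arg_cong[OF eq, of "pdiff v"] by (simp add: pdiff_mult)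
  then have "(pdiff v c * b) * (b * d) = (pdiff v a * d + a * pdiff v d - c * pdiff v b) * (b * d)"
    by simp
  then have "(pdiff v c * d - c * pdiff v d) * (b * b) =
      (pdiff v a * b) * (d * d) + (a * d) * (b * pdiff v d)
        - (c * b) * (pdiff v b * d) - (c * b) * (b * pdiff v d)"
    by (simp add: algebra_simps)
  also have "\<dots> = (pdiff v a * b - a * pdiff v b) * (d * d)"
    unfolding eq[symmetric] by (simp add: algebra_simps)
  finally have "(pdiff v c * d - c * pdiff v d) * (b * b) =
      (pdiff v a * b - a * pdiff v b) * (d * d)" .
  then show ?thesis
    unfolding rdiff_def P_def[symmetric] cd using assms d by (simp add: eq_fract)
qed

section \<open>The module generated by \<open>f\<^sub>1\<^bsup>s\<^sub>1\<^esup> \<cdots> f\<^sub>p\<^bsup>s\<^sub>p\<^esup>\<close>\<close>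

text \<open>An element \<open>g f\<^sub>1\<^bsup>s\<^sub>1\<^esup> \<cdots> f\<^sub>p\<^bsup>s\<^sub>p\<^esup>\<close> of the free rank-one module is represented by \<open>g\<close>.
  For \<open>f \<noteq> 0\<close>, the ring \<open>\<complex>[x, s, f\<^bsup>-1\<^esup>] = \<complex>[x, f\<^bsup>-1\<^esup>][s]\<close> is a subring of \<open>\<complex>(x)[s]\<close>, and
  multiplication by \<open>\<complex>[x, s]\<close> and the operators \<open>fs_diff F i\<close> below map it to itself.
  The operators are defined on all of \<open>\<complex>(x)[s]\<close>; they are only applied to the element
  \<open>f\<close> of \<open>\<complex>[x, s, f\<^bsup>-1\<^esup>]\<close>.\<close>

type_synonym ('n, 'p) fs_module = "('p, 'n ratfun) mpoly"

definition fs_diff ::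
    "('p::finite \<Rightarrow> 'n xpoly) \<Rightarrow> 'n::linorder \<Rightarrow> ('n, 'p) fs_module \<Rightarrow> ('n, 'p) fs_module" where
  "fs_diff F i g = Poly_Mapping.map (rdiff i) g +
     g * (\<Sum>j\<in>UNIV. mvar j * mconst (to_fract (pdiff i (F j)) / to_fract (F j)))"

text \<open>An element of \<open>D\<^sub>n[s\<^sub>1, \<dots>, s\<^sub>p]\<close> is a finite sum of terms \<open>a\<^sub>\<beta> \<partial>\<^bsup>\<beta>\<^esup>\<close> with unique coefficients
  \<open>a\<^sub>\<beta> \<in> \<complex>[x][s]\<close>; it is represented by the finitely supported map \<open>\<beta> \<mapsto> a\<^sub>\<beta>\<close>.
  Since the operators \<open>fs_diff F i\<close> commute, the order of the factors of \<open>\<partial>\<^bsup>\<beta>\<^esup>\<close> is immaterial.\<close>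

type_synonym ('n, 'p) weyl = "('n \<Rightarrow>\<^sub>0 nat) \<Rightarrow>\<^sub>0 ('p, 'n xpoly) mpoly"

definition fs_diff_power ::
    "('p::finite \<Rightarrow> 'n xpoly) \<Rightarrow> ('n::{finite,linorder} \<Rightarrow>\<^sub>0 nat) \<Rightarrow>
     ('n, 'p) fs_module \<Rightarrow> ('n, 'p) fs_module" where
  "fs_diff_power F \<beta> =
     fold (\<lambda>i. fs_diff F i ^^ Poly_Mapping.lookup \<beta> i) (sorted_list_of_set UNIV)"

definition weyl_act ::
    "('p::finite \<Rightarrow> 'n xpoly) \<Rightarrow> ('n::{finite,linorder}, 'p) weyl \<Rightarrow>
     ('n, 'p) fs_module \<Rightarrow> ('n, 'p) fs_module" where
  "weyl_act F P g = (\<Sum>\<beta> \<in> Poly_Mapping.keys P.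
     Poly_Mapping.map to_fract (Poly_Mapping.lookup P \<beta>) * fs_diff_power F \<beta> g)"

section \<open>Bernstein--Sato ideals and polynomials\<close>

definition bs_ideal ::
    "('p::finite \<Rightarrow> ('n::{finite,linorder}) xpoly) \<Rightarrow> ('p, complex) mpoly set" where
  "bs_ideal F = {b. \<exists>P :: ('n, 'p) weyl.
     Poly_Mapping.map (\<lambda>c. to_fract (mconst c)) b =
       weyl_act F P (mconst (to_fract (\<Prod>j\<in>UNIV. F j)))}"

definition zero_locus :: "('p::finite, complex) mpoly set \<Rightarrow> (complex ^ 'p) set" where
  "zero_locus I = {\<alpha>. \<forall>b\<in>I. meval b \<alpha> = 0}"

text \<open>A one-element tuple is a family indexed by the type \<open>unit\<close>; its ring
  \<open>\<complex>[s]\<close> is identified with the type of univariate polynomials.\<close>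

definition mpoly_of_poly :: "'a::comm_ring_1 poly \<Rightarrow> (unit, 'a) mpoly" where
  "mpoly_of_poly q =
     (\<Sum>k\<le>Polynomial.degree q. Poly_Mapping.single (Poly_Mapping.single () k) (coeff q k))"

definition bs_poly :: "('n::{finite,linorder}) xpoly \<Rightarrow> complex poly" where
  "bs_poly f = (THE b. lead_coeff b = 1 \<and>
     {q. mpoly_of_poly q \<in> bs_ideal (\<lambda>_::unit. f)} = {q. b dvd q})"

definition nabla :: "complex ^ 'p \<Rightarrow> complex ^ 'p::finite" where
  "nabla \<alpha> = (\<chi> j. \<alpha> $ j + 1)"

definition diagonal :: "(complex ^ 'p::finite) set" where
  "diagonal = {\<alpha>. \<forall>i j. \<alpha> $ i = \<alpha> $ j}"

end

theory Submission
  imports Defs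
    "HOL-Computational_Algebra.Fundamental_Theorem_Algebra"
    "HOL-Analysis.Continuum_Not_Denumerable"
begin

text \<open>Let \<open>\<alpha>\<close> be a diagonal point outside the translates of \<open>Z(B\<^sub>F)\<close>, and suppose that \<open>b\<^sub>f\<close> does
  not vanish there. Specialising the functional equations gives \<open>F\<^bsup>\<alpha>\<^esup> \<in> D F\<^bsup>\<alpha>+1\<^esup>\<close>, and the
  hypothesis on the translates says that \<open>F\<^bsup>s\<^esup>\<close> generates \<open>N = \<complex>[x, s, f\<^bsup>-1\<^esup>] F\<^bsup>s\<^esup>\<close> near \<open>\<alpha>\<close>. If no
  element of \<open>B\<^sub>F\<close> were nonzero at \<open>\<alpha>\<close>, then \<open>N / D[s] F\<^bsup>s+1\<^esup>\<close> would be nonzero near \<open>\<alpha>\<close>; a simple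
  quotient of it has countable dimension, so that \<open>s\<close> acts on it by scalars \<open>\<beta>\<close> (Dixmier). Here
  \<open>\<beta>\<close> avoids any prescribed countable family of hypersurfaces not containing \<open>\<alpha>\<close>, and
  \<open>D F\<^bsup>\<beta>+1\<^esup>\<close> is a proper submodule of \<open>\<complex>[x, f\<^bsup>-1\<^esup>] F\<^bsup>\<beta>\<^esup>\<close>.

  This is refuted by counting dimensions in the Bernstein filtration. For generic \<open>s\<close> the dimension
  of \<open>D\<^bsub>\<le>k\<^esub> F\<^bsup>s\<^esup>\<close> is the number of standard monomials of degree \<open>\<le> k\<close> of a Groebner basis over
  \<open>\<complex>(s)\<close>. Since \<open>\<complex>[x, f\<^bsup>-1\<^esup>] F\<^bsup>\<alpha>\<^esup>\<close> depends only on the class of \<open>\<alpha>\<close> modulo \<open>\<int>\<^sup>p\<close>, which is Zariski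
  dense, \<open>\<alpha>\<close> may be translated to a generic point. Hence \<open>D\<^bsub>\<le>k\<^esub> F\<^bsup>\<beta>+1\<^esup>\<close> has, up to a bounded shift of
  \<open>k\<close>, the dimension of \<open>D\<^bsub>\<le>k\<^esub> F\<^bsup>\<beta>\<^esup>\<close>, which leaves only \<open>O(k\<^bsup>n-1\<^esup>)\<close> for the quotient by
  \<open>D F\<^bsup>\<beta>+1\<^esup>\<close> and contradicts Bernstein's inequality.\<close>

section \<open>Evaluation of polynomials\<close>

text \<open>Specialisation at \<alpha> gives a single identity Q (f F^\<alpha>) = F^\<alpha> and
  says nothing about other exponents. It is deformed: after the translation of \<alpha>, the
  operator Q with coefficients independent of s gives for every s an element y(s) F^s of the
  submodule in question, with y = 1 at the special point. Standard monomials applied to y(s) stay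
  independent near that point, but only for one degree bound k at a time, and the neighbourhood may
  shrink with k. Hence \<beta> must avoid countably many hypersurfaces at once, which a closed point
  of a Zariski open set would not guarantee and Dixmier's argument does.

  Spanning by standard monomials needs nonzero leading coefficients; independence at a point needs
  F^s to generate all sections nearby. The former may fail at \<alpha>, and the translation must go
  far enough in the negative direction to gain it without losing the latter.

  The case i = 1 of the hypothesis supplies an element of B_F not vanishing at \<alpha> - (1,...,1).
  That point is diagonal, so the ideal defining b_f is nonzero.\<close>

definition peval :: "('v::finite \<Rightarrow> 'b::comm_ring_1) \<Rightarrow> ('v, 'b) mpoly \<Rightarrow> 'b" where
  "peval a p = (\<Sum>m\<in>Poly_Mapping.keys p.
     Poly_Mapping.lookup p m * (\<Prod>v\<in>UNIV. a v ^ Poly_Mapping.lookup m v))"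

lemma peval_superset:
  assumes "finite A" "Poly_Mapping.keys p \<subseteq> A"
  shows "peval a p = (\<Sum>m\<in>A. Poly_Mapping.lookup p m * (\<Prod>v\<in>UNIV. a v ^ Poly_Mapping.lookup m v))"
  unfolding peval_def using assms
  by (intro sum.mono_neutral_left) (auto simp: in_keys_iff)

lemma peval_0 [simp]: "peval a 0 = 0"
  by (simp add: peval_def)

lemma peval_add: "peval a (p + q) = peval a p + peval a q"
proof -
  let ?A = "Poly_Mapping.keys p \<union> Poly_Mapping.keys q"
  have "Poly_Mapping.keys (p + q) \<subseteq> ?A"
    by (rule Poly_Mapping.keys_add)
  then show ?thesis
    by (simp add: peval_superset[of ?A] lookup_add distrib_right sum.distrib)
qed

lemma peval_sum: "peval a (sum f A) = (\<Sum>x\<in>A. peval a (f x))"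
  by (induction A rule: infinite_finite_induct) (simp_all add: peval_add)

lemma peval_single:
  "peval a (Poly_Mapping.single m c) = c * (\<Prod>v\<in>UNIV. a v ^ Poly_Mapping.lookup m v)"
  by (subst peval_superset[of "{m}"]) auto

lemma peval_mult: "peval a (p * q) = peval a p * peval a q"
proof -
  have s: "peval a (Poly_Mapping.single m c * Poly_Mapping.single k d) =
      peval a (Poly_Mapping.single m c) * peval a (Poly_Mapping.single k d)" for m k c d
    by (simp add: mult_single peval_single lookup_add power_add prod.distrib algebra_simps)
  show ?thesis
    by (subst (1 2) mpoly_as_sum) (simp only: sum_product peval_sum s,
        simp only: sum_product[symmetric] peval_sum[symmetric] mpoly_as_sum[symmetric])
qed

lemma peval_uminus: "peval a (- p) = - peval a p"
  using peval_add[of a p "- p"] by (simp add: add_eq_0_iff)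

lemma peval_diff: "peval a (p - q) = peval a p - peval a q"
  using peval_add[of a p "- q"] by (simp add: peval_uminus)

lemma peval_1 [simp]: "peval a 1 = 1"
  using peval_single[of a 0 1] by simp

lemma peval_mconst [simp]: "peval a (mconst c) = c"
  by (simp add: mconst_def peval_single)

lemma peval_mvar [simp]: "peval a (mvar v) = a v"
proof -
  have "peval a (mvar v) = (\<Prod>w\<in>UNIV. if w = v then a w else 1)"
    unfolding mvar_def peval_single mult_1_left
    by (intro prod.cong) (auto simp: lookup_single when_def)
  then show ?thesis
    by simp
qed

lemma meval_eq_peval: "meval b \<alpha> = peval (\<lambda>v. \<alpha> $ v) b"
  by (simp add: meval_def peval_def)

lemma meval_simps [simp]:
  "meval 0 \<alpha> = 0" "meval 1 \<alpha> = 1" "meval (mconst c) \<alpha> = c" "meval (mvar v) \<alpha> = \<alpha> $ v"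
  "meval (p + q) \<alpha> = meval p \<alpha> + meval q \<alpha>" "meval (p * q) \<alpha> = meval p \<alpha> * meval q \<alpha>"
  "meval (p - q) \<alpha> = meval p \<alpha> - meval q \<alpha>" "meval (- p) \<alpha> = - meval p \<alpha>"
  by (simp_all add: meval_eq_peval peval_add peval_mult peval_diff peval_uminus)

lemma meval_sum: "meval (sum f A) \<alpha> = (\<Sum>x\<in>A. meval (f x) \<alpha>)"
  by (simp add: meval_eq_peval peval_sum)

lemma meval_prod: "meval (prod f A) \<alpha> = (\<Prod>x\<in>A. meval (f x) \<alpha>)"
  by (induction A rule: infinite_finite_induct) simp_all

lemma meval_power: "meval (b ^ k) \<alpha> = meval b \<alpha> ^ k"
  by (induction k) simp_all

lemma mpoly_induct [case_names const var add mult]: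
  fixes p :: "('v, 'b::comm_ring_1) mpoly"
  assumes const: "\<And>c. P (mconst c)" and var: "\<And>v. P (mvar v)"
    and add: "\<And>p q. P p \<Longrightarrow> P q \<Longrightarrow> P (p + q)" and mult: "\<And>p q. P p \<Longrightarrow> P q \<Longrightarrow> P (p * q)"
  shows "P p"
proof -
  have P0: "P 0" and P1: "P 1"
    using const[of 0] const[of 1] by (simp_all add: mconst_def)
  have mono: "P (Poly_Mapping.single m 1)" for m
  proof (induction m rule: update_induct)
    case const
    then show ?case using P1 by simp
  next
    case (update m v k)
    have pow: "P (Poly_Mapping.single (Poly_Mapping.single v j) 1)" for j
    proof (induction j)
      case (Suc j)
      have "Poly_Mapping.single (Poly_Mapping.single v (Suc j)) (1::'b) =
          Poly_Mapping.single (Poly_Mapping.single v j) 1 * mvar v"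
        by (simp add: mvar_def mult_single single_add[symmetric])
      then show ?case using mult[OF Suc var] by simp
    qed (simp add: P1)
    have "Poly_Mapping.update v k m = m + Poly_Mapping.single v k"
      using update.hyps by (intro poly_mapping_eqI)
        (auto simp: lookup_update lookup_add lookup_single when_def in_keys_iff)
    then have "Poly_Mapping.single (Poly_Mapping.update v k m) (1::'b) =
        Poly_Mapping.single m 1 * Poly_Mapping.single (Poly_Mapping.single v k) 1"
      by (simp add: mult_single)
    then show ?case using mult[OF update.IH pow] by simp
  qed
  have single: "P (Poly_Mapping.single m c)" for m c
  proof -
    have "Poly_Mapping.single m c = mconst c * Poly_Mapping.single m 1"
      by (simp add: mconst_def mult_single)
    then show ?thesis using mult[OF const mono] by simp
  qed
  have "P (\<Sum>m\<in>A. Poly_Mapping.single m (Poly_Mapping.lookup p m))" for A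
    by (induction A rule: infinite_finite_induct) (auto intro: P0 add single)
  then show ?thesis
    by (subst mpoly_as_sum)
qed

text \<open>Kronecker's substitution \<open>x\<^sub>v \<mapsto> z\<^bsup>N\<^bsup>i(v)\<^esup>\<^esup>\<close> maps distinct monomials of small degree to
  distinct powers of \<open>z\<close>.\<close>

lemma digits_inj:
  fixes a b :: "nat \<Rightarrow> nat"
  assumes "\<And>i. i < d \<Longrightarrow> a i < N" "\<And>i. i < d \<Longrightarrow> b i < N"
    and "(\<Sum>i<d. a i * N ^ i) = (\<Sum>i<d. b i * N ^ i)"
  shows "\<forall>i<d. a i = b i"
  using assms
proof (induction d arbitrary: a b)
  case (Suc d)
  have e: "(\<Sum>i<Suc d. h i * N ^ i) = h 0 + N * (\<Sum>i<d. h (Suc i) * N ^ i)" for h :: "nat \<Rightarrow> nat"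
    by (simp add: sum.lessThan_Suc_shift sum_distrib_left algebra_simps del: sum.lessThan_Suc)
  have a0: "a 0 < N" "b 0 < N"
    using Suc.prems by auto
  have eq: "a 0 + N * (\<Sum>i<d. a (Suc i) * N ^ i) = b 0 + N * (\<Sum>i<d. b (Suc i) * N ^ i)"
    using Suc.prems(3) unfolding e .
  have "a 0 = b 0"
    using arg_cong[OF eq, of "\<lambda>x. x mod N"] a0 by simp
  moreover from this eq a0 have "(\<Sum>i<d. a (Suc i) * N ^ i) = (\<Sum>i<d. b (Suc i) * N ^ i)"
    by simp
  then have "\<forall>i<d. a (Suc i) = b (Suc i)"
    using Suc.prems by (intro Suc.IH) auto
  ultimately show ?case
    by (auto simp: less_Suc_eq_0_disj)
qed simp

text \<open>The substitution turns each member of \<open>S\<close> into a nonzero univariate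
  polynomial, and the product of these has finitely many roots. This is the Zariski density of
  natural points, used to compare functions of s and to translate \<alpha>.\<close>

lemma exists_nonzero_nat_point:
  fixes S :: "('v::finite, 'b::idom) mpoly set"
  assumes "finite S" "\<And>p. p \<in> S \<Longrightarrow> p \<noteq> 0" and inj: "inj (of_nat :: nat \<Rightarrow> 'b)"
  shows "\<exists>w :: 'v \<Rightarrow> nat. \<forall>p\<in>S. peval (\<lambda>v. of_nat (w v)) p \<noteq> 0"
proof -
  obtain idx :: "'v \<Rightarrow> nat" where idx: "bij_betw idx UNIV {..<CARD('v)}"
    using ex_bij_betw_finite_nat[OF finite_class.finite_UNIV] by (auto simp: lessThan_atLeast0)
  define E where "E = (\<Union>p\<in>S. \<Union>m\<in>Poly_Mapping.keys p. range (Poly_Mapping.lookup m))"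
  have "finite E"
    unfolding E_def using assms by auto
  \<comment> \<open>\<open>N\<close> exceeds every exponent in \<open>S\<close>, so exponent vectors
    are digit sequences in base \<open>N\<close>.\<close>
  then obtain N where N: "\<And>x. x \<in> E \<Longrightarrow> x < N"
    unfolding finite_nat_set_iff_bounded by auto
  have lt: "Poly_Mapping.lookup m u < N" if "m \<in> Poly_Mapping.keys p" "p \<in> S" for m u p
    using that by (intro N) (auto simp: E_def)
  define e where "e m = (\<Sum>v\<in>UNIV. Poly_Mapping.lookup m v * N ^ idx v)" for m :: "'v \<Rightarrow>\<^sub>0 nat"
  have e: "e m = (\<Sum>i<CARD('v). Poly_Mapping.lookup m (inv_into UNIV idx i) * N ^ i)" for m
    unfolding e_def
    by (rule sum.reindex_bij_witness[of _ "inv_into UNIV idx" idx])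
      (use idx in \<open>auto simp: bij_betw_inv_into_left bij_betw_inv_into_right bij_betw_def\<close>)
  have e_inj: "inj_on e (Poly_Mapping.keys p)" if "p \<in> S" for p
  proof (rule inj_onI, rule poly_mapping_eqI)
    fix m k v assume mk: "m \<in> Poly_Mapping.keys p" "k \<in> Poly_Mapping.keys p" "e m = e k"
    have "\<forall>i<CARD('v). Poly_Mapping.lookup m (inv_into UNIV idx i) = Poly_Mapping.lookup k (inv_into UNIV idx i)"
      by (rule digits_inj[of _ _ N]) (use mk that in \<open>simp_all add: lt e\<close>)
    moreover have "idx v < CARD('v)" "inv_into UNIV idx (idx v) = v"
      using idx by (auto simp: bij_betw_def)
    ultimately show "Poly_Mapping.lookup m v = Poly_Mapping.lookup k v"
      by metis
  qed
  define q where "q p = (\<Sum>m\<in>Poly_Mapping.keys p. monom (Poly_Mapping.lookup p m) (e m))" for p :: "('v, 'b) mpoly"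
  have q: "q p \<noteq> 0" if "p \<in> S" for p
  proof -
    have "Poly_Mapping.keys p \<noteq> {}"
      using assms(2)[OF that] by simp
    then obtain m where m: "m \<in> Poly_Mapping.keys p"
      by blast
    have "coeff (q p) (e m) = (\<Sum>k\<in>Poly_Mapping.keys p. if k = m then Poly_Mapping.lookup p k else 0)"
      unfolding q_def coeff_sum coeff_monom
      using e_inj[OF that] m by (intro sum.cong) (auto simp: inj_on_def)
    also have "\<dots> \<noteq> 0"
      using m by (simp add: in_keys_iff)
    finally show ?thesis
      by auto
  qed
  have "(\<Prod>p\<in>S. q p) \<noteq> 0"
    using q assms(1) by simp
  then have "finite {x. poly (\<Prod>p\<in>S. q p) x = 0}"
    by (rule poly_roots_finite)
  moreover have "infinite (range (of_nat :: nat \<Rightarrow> 'b))"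
    by (rule range_inj_infinite) (rule inj)
  ultimately obtain z :: nat where z: "poly (\<Prod>p\<in>S. q p) (of_nat z) \<noteq> 0"
    by (metis (mono_tags, lifting) finite_subset mem_Collect_eq rangeE subsetI)
  have "poly (q p) (of_nat z) = peval (\<lambda>v. of_nat (z ^ (N ^ idx v))) p" for p
    unfolding q_def peval_def poly_sum poly_monom e_def
    by (intro sum.cong refl) (simp add: power_sum power_mult[symmetric] mult.commute)
  then show ?thesis
    using z assms(1) by (intro exI[of _ "\<lambda>v. z ^ (N ^ idx v)"]) (auto simp: poly_prod)
qed

section \<open>Derivations of the field of rational functions\<close>

lemma pdiff_0 [simp]: "pdiff v 0 = 0"
  by (simp add: pdiff_def)

lemma pdiff_mconst [simp]: "pdiff v (mconst c) = 0"
  unfolding mconst_def by (subst pdiff_single) simp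

lemma pdiff_1 [simp]: "pdiff v 1 = 0"
  using pdiff_mconst[of v 1] by (simp add: mconst_def)

lemma pdiff_mvar: "pdiff v (mvar w) = (if v = w then 1 else 0)"
  unfolding mvar_def by (subst pdiff_single) (auto simp: lookup_single when_def)

lemma pdiff_commute: "pdiff v (pdiff w p) = pdiff w (pdiff v p)"
proof (induction p rule: mpoly_induct)
  case (var u)
  then show ?case by (simp add: pdiff_mvar)
qed (simp_all add: pdiff_add pdiff_mult algebra_simps)

definition cst :: "complex \<Rightarrow> 'n::linorder ratfun" where
  "cst z = to_fract (mconst z)"

lemma mconst_add: "mconst (a + b) = mconst a + mconst b"
  by (simp add: mconst_def single_add)

lemma mconst_mult: "mconst (a * b) = mconst a * mconst b"
  by (simp add: mconst_def mult_single)

lemma mconst_01 [simp]: "mconst 0 = 0" "mconst 1 = 1"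
  by (simp_all add: mconst_def)

lemma cst_01 [simp]: "cst 0 = 0" "cst 1 = 1"
  by (simp_all add: cst_def)

lemma cst_add: "cst (a + b) = cst a + cst b"
  by (simp add: cst_def mconst_add)

lemma cst_mult: "cst (a * b) = cst a * cst b"
  by (simp add: cst_def mconst_mult)

lemma cst_eq_0_iff [simp]: "cst a = (0 :: 'n::linorder ratfun) \<longleftrightarrow> a = 0"
proof -
  have "mconst a = (0 :: 'n xpoly) \<longleftrightarrow> a = 0"
    by (metis mconst_def lookup_single_eq lookup_zero single_zero)
  then show ?thesis
    by (simp add: cst_def)
qed

lemma cst_uminus: "cst (- a) = - cst a"
  using cst_add[of a "- a"] by (simp add: add_eq_0_iff)

lemma cst_diff: "cst (a - b) = cst a - cst b"
  using cst_add[of a "- b"] by (simp add: cst_uminus)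

lemma cst_of_nat: "cst (of_nat k) = of_nat k"
  by (induction k) (simp_all add: cst_add)

lemma cst_sum: "cst (sum h A) = (\<Sum>x\<in>A. cst (h x))"
  by (induction A rule: infinite_finite_induct) (simp_all add: cst_add)

lemma cst_prod: "cst (prod h A) = (\<Prod>x\<in>A. cst (h x))"
  by (induction A rule: infinite_finite_induct) (simp_all add: cst_mult)

lemma cst_power: "cst (a ^ k) = cst a ^ k"
  by (induction k) (simp_all add: cst_mult)

lemma rdiff_to_fract: "rdiff v (to_fract p) = to_fract (pdiff v p)"
  by (simp add: to_fract_def rdiff_Fract)

lemma rdiff_cst [simp]: "rdiff v (cst z) = 0"
  by (simp add: cst_def rdiff_to_fract)

lemma rdiff_0 [simp]: "rdiff v 0 = 0"
  using rdiff_cst[of v 0] by simp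

lemma rdiff_add: "rdiff v (g + h) = rdiff v g + rdiff v h"
proof -
  obtain a b c d where *: "g = Fract a b" "b \<noteq> 0" "h = Fract c d" "d \<noteq> 0"
    by (metis Fract_cases)
  show ?thesis
    using * by (simp add: rdiff_Fract eq_fract pdiff_add pdiff_mult algebra_simps)
qed

lemma rdiff_mult: "rdiff v (g * h) = rdiff v g * h + g * rdiff v h"
proof -
  obtain a b c d where *: "g = Fract a b" "b \<noteq> 0" "h = Fract c d" "d \<noteq> 0"
    by (metis Fract_cases)
  show ?thesis
    using * by (simp add: rdiff_Fract eq_fract pdiff_add pdiff_mult algebra_simps)
qed

lemma rdiff_sum: "rdiff v (sum h A) = (\<Sum>x\<in>A. rdiff v (h x))"
  by (induction A rule: infinite_finite_induct) (simp_all add: rdiff_add)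

lemma rdiff_1 [simp]: "rdiff v 1 = 0"
  using rdiff_cst[of v 1] by simp

lemma rdiff_divide:
  assumes "h \<noteq> 0"
  shows "rdiff v (g / h) = (rdiff v g * h - g * rdiff v h) / (h * h)"
proof -
  have "rdiff v (g / h * h) = rdiff v (g / h) * h + g / h * rdiff v h"
    by (rule rdiff_mult)
  then have "rdiff v (g / h) * h = rdiff v g - g / h * rdiff v h"
    using assms by simp
  then have "rdiff v (g / h) * h * h = rdiff v g * h - g * rdiff v h"
    using assms by (simp add: left_diff_distrib)
  then show ?thesis
    using assms by (metis mult.assoc mult_eq_0_iff nonzero_mult_div_cancel_right)
qed

lemma rdiff_commute: "rdiff v (rdiff w g) = rdiff w (rdiff v g)"
proof -
  obtain a b where *: "g = to_fract a / to_fract b" "b \<noteq> 0"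
    by (metis Fract_cases Fract_conv_to_fract)
  have "g * to_fract b = to_fract a" and b: "to_fract b \<noteq> 0"
    using * by simp_all
  then have "rdiff v (rdiff w (g * to_fract b)) = rdiff w (rdiff v (g * to_fract b))"
    by (simp add: rdiff_to_fract pdiff_commute)
  then have "rdiff v (rdiff w g) * to_fract b = rdiff w (rdiff v g) * to_fract b"
    by (simp add: rdiff_mult rdiff_add rdiff_to_fract pdiff_commute[of v w] algebra_simps)
  with b show ?thesis
    by simp
qed

lemma rdiff_of_nat [simp]: "rdiff v (of_nat k) = 0"
  using rdiff_cst[of v "of_nat k"] by (simp add: cst_of_nat)

lemma rdiff_power: "rdiff v (g ^ k) = of_nat k * g ^ (k - 1) * rdiff v g"
proof (induction k)
  case (Suc k)
  then show ?case
    by (cases k) (simp_all add: rdiff_mult algebra_simps)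
qed simp

section \<open>Exponent vectors\<close>

definition inc :: "'v \<Rightarrow> ('v \<Rightarrow> nat) \<Rightarrow> 'v \<Rightarrow> nat" where
  "inc v m = m(v := Suc (m v))"

text \<open>Truncates at 0. In the commutation rules the term with \<open>dec v m\<close> carries
  the factor \<open>m v\<close>, so the truncated value has no effect there.\<close>

definition dec :: "'v \<Rightarrow> ('v \<Rightarrow> nat) \<Rightarrow> 'v \<Rightarrow> nat" where
  "dec v m = m(v := m v - 1)"

definition deg :: "('v::finite \<Rightarrow> nat) \<Rightarrow> nat" where
  "deg m = (\<Sum>v\<in>UNIV. m v)"

lemma sum_fun_upd:
  fixes m :: "'v::finite \<Rightarrow> nat"
  shows "(\<Sum>u\<in>UNIV. (m(v := k)) u) + m v = (\<Sum>u\<in>UNIV. m u) + k"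
  by (simp add: sum.remove[of UNIV v])

lemma deg_inc [simp]: "deg (inc v m) = Suc (deg m)"
  using sum_fun_upd[of m v "Suc (m v)"] by (simp add: deg_def inc_def)

lemma deg_dec: "m v \<noteq> 0 \<Longrightarrow> Suc (deg (dec v m)) = deg m"
  using sum_fun_upd[of m v "m v - 1"] by (simp add: deg_def dec_def)

lemma deg_dec_le: "deg (dec v m) \<le> deg m"
  using sum_fun_upd[of m v "m v - 1"] by (simp add: deg_def dec_def)

lemma inc_dec: "m v \<noteq> 0 \<Longrightarrow> inc v (dec v m) = m"
  by (auto simp: inc_def dec_def)

lemma dec_inc [simp]: "dec v (inc v m) = m"
  by (auto simp: inc_def dec_def)

lemma inc_dec_commute: "u \<noteq> v \<Longrightarrow> inc u (dec v m) = dec v (inc u m)"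
  by (auto simp: inc_def dec_def fun_eq_iff)

lemma inc_same [simp]: "inc v m v = Suc (m v)"
  by (simp add: inc_def)

lemma inc_other: "u \<noteq> v \<Longrightarrow> inc u m v = m v"
  by (simp add: inc_def)

lemma deg_0 [simp]: "deg (\<lambda>_. 0) = 0"
  by (simp add: deg_def)

lemma deg_eq_0_iff: "deg m = 0 \<longleftrightarrow> m = (\<lambda>_. 0)"
  by (auto simp: deg_def)

lemma le_deg: "m v \<le> deg m"
  unfolding deg_def by (rule member_le_sum) auto

lemma exponent_induct [case_names zero inc]:
  fixes m :: "'v::finite \<Rightarrow> nat"
  assumes "P (\<lambda>_. 0)" "\<And>v m. P m \<Longrightarrow> P (inc v m)"
  shows "P m"
proof (induction "deg m" arbitrary: m)
  case 0
  then have "m = (\<lambda>_. 0)"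
    by (simp add: deg_eq_0_iff[symmetric])
  then show ?case using assms(1) by simp
next
  case (Suc d)
  then have "m \<noteq> (\<lambda>_. 0)"
    by (simp add: deg_eq_0_iff[symmetric])
  then obtain v where v: "m v \<noteq> 0"
    by (auto simp: fun_eq_iff)
  then have "P (dec v m)"
    using Suc.hyps deg_dec[of m v] by auto
  then show ?case
    using assms(2)[of "dec v m" v] v by (simp add: inc_dec)
qed

lemma exponent_le_induct [consumes 1, case_names refl inc]:
  fixes m0 m :: "'v::finite \<Rightarrow> nat"
  assumes "m0 \<le> m" "P m0" "\<And>v m. m0 \<le> m \<Longrightarrow> P m \<Longrightarrow> P (inc v m)"
  shows "P m"
  using assms(1)
proof (induction "deg m" arbitrary: m rule: less_induct)
  case less
  show ?case
  proof (cases "m = m0")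
    case True
    then show ?thesis using assms(2) by simp
  next
    case False
    then obtain v where "m v \<noteq> m0 v"
      by (auto simp: fun_eq_iff)
    moreover have "m0 v \<le> m v"
      using less.prems by (simp add: le_fun_def)
    ultimately have v: "m0 v < m v"
      by simp
    then have "m0 \<le> dec v m"
      using less.prems by (auto simp: dec_def le_fun_def)
    moreover have "deg (dec v m) < deg m"
      using v deg_dec[of m v] by auto
    ultimately show ?thesis
      using assms(3)[of "dec v m" v] less.hyps v by (simp add: inc_dec)
  qed
qed

lemma finite_deg_le: "finite {m :: 'v::finite \<Rightarrow> nat. deg m \<le> k}"
proof (rule finite_subset)
  show "{m :: 'v \<Rightarrow> nat. deg m \<le> k} \<subseteq> {m. \<forall>v. (v \<in> UNIV \<longrightarrow> m v \<in> {..k}) \<and> (v \<notin> UNIV \<longrightarrow> m v = 0)}"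
    using le_deg order_trans by fastforce
qed (rule finite_set_of_finite_funs; simp)

text \<open>The cube of vectors with all entries at most \<open>j\<close> lies inside the simplex;
  this gives the right order of growth without binomial coefficients.\<close>

lemma card_deg_le:
  "(Suc j) ^ CARD('v) \<le> card {m :: 'v::finite \<Rightarrow> nat. deg m \<le> CARD('v) * j}"
proof -
  have "card (PiE (UNIV :: 'v set) (\<lambda>_. {..j})) = Suc j ^ CARD('v)"
    by (simp add: card_PiE)
  moreover have "PiE (UNIV :: 'v set) (\<lambda>_. {..j}) \<subseteq> {m. deg m \<le> CARD('v) * j}"
  proof
    fix m :: "'v \<Rightarrow> nat" assume "m \<in> PiE UNIV (\<lambda>_. {..j})"
    then have "deg m \<le> (\<Sum>v\<in>(UNIV::'v set). j)"
      unfolding deg_def by (intro sum_mono) (auto simp: PiE_def)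
    then show "m \<in> {m. deg m \<le> CARD('v) * j}"
      by simp
  qed
  ultimately show ?thesis
    by (metis card_mono finite_deg_le)
qed

section \<open>Dickson's lemma\<close>

lemma monotone_subsequence:
  fixes s :: "nat \<Rightarrow> 'v::finite \<Rightarrow> nat"
  shows "\<exists>r :: nat \<Rightarrow> nat. strict_mono r \<and> (\<forall>v\<in>A. mono (\<lambda>k. s (r k) v))"
proof (induction A rule: infinite_finite_induct)
  case (insert v A)
  then obtain r :: "nat \<Rightarrow> nat" where r: "strict_mono r" "\<And>u. u \<in> A \<Longrightarrow> mono (\<lambda>k. s (r k) u)"
    by blast
  obtain q where q: "strict_mono q" "monoseq (\<lambda>k. s (r (q k)) v)"
    using seq_monosub[of "\<lambda>k. s (r k) v"] by auto
  have "\<exists>p :: nat \<Rightarrow> nat. strict_mono p \<and> mono (\<lambda>k. s (r (q (p k))) v)"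
  proof (cases "\<forall>j k. j \<le> k \<longrightarrow> s (r (q j)) v \<le> s (r (q k)) v")
    case True
    then show ?thesis
      by (intro exI[of _ id]) (auto simp: mono_def strict_mono_def)
  next
    case False
    then have d: "s (r (q k)) v \<le> s (r (q j)) v" if "j \<le> k" for j k
      using q(2) that unfolding monoseq_def by blast
    \<comment> \<open>A nonincreasing sequence of naturals attains its minimum \<open>l\<close> and
      is constant from there on, so its tail is nondecreasing.\<close>
    define l where "l = (LEAST x. \<exists>k. s (r (q k)) v = x)"
    obtain k0 where k0: "s (r (q k0)) v = l"
      using LeastI[of "\<lambda>x. \<exists>k. s (r (q k)) v = x"] unfolding l_def by blast
    have "s (r (q (k + k0))) v = l" for k
      using d[of k0 "k + k0"] k0 Least_le[of "\<lambda>x. \<exists>k. s (r (q k)) v = x" "s (r (q (k + k0))) v"]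
      unfolding l_def[symmetric] by (metis le_add2 le_antisym)
    then show ?thesis
      by (intro exI[of _ "\<lambda>k. k + k0"]) (auto simp: mono_def strict_mono_def)
  qed
  then obtain p :: "nat \<Rightarrow> nat" where p: "strict_mono p" "mono (\<lambda>k. s (r (q (p k))) v)"
    by blast
  have "mono (\<lambda>k. s (r (q (p k))) u)" if "u \<in> A" for u
    using r(2)[OF that] q(1) p(1) unfolding mono_def
    by (meson strict_mono_less_eq)
  then show ?case
    using p r(1) q(1) by (intro exI[of _ "\<lambda>k. r (q (p k))"]) (auto simp: strict_mono_def)
qed (auto intro!: exI[of _ id] simp: strict_mono_def)

text \<open>If no finite subset sufficed, one could choose a sequence in \<open>L\<close> none of
  whose members lies above an earlier one; a subsequence monotone in all coordinates contradicts
  this.\<close>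

lemma dickson:
  fixes L :: "('v::finite \<Rightarrow> nat) set"
  shows "\<exists>S. finite S \<and> S \<subseteq> L \<and> (\<forall>m\<in>L. \<exists>m0\<in>S. m0 \<le> m)"
proof (rule ccontr)
  assume *: "\<not> ?thesis"
  define next_elt where "next_elt S = (SOME m. m \<in> L \<and> (\<forall>m0\<in>S. \<not> m0 \<le> m))" for S
  have next_elt: "next_elt S \<in> L \<and> (\<forall>m0\<in>S. \<not> m0 \<le> next_elt S)" if "finite S" "S \<subseteq> L" for S
  proof -
    have "\<not> (finite S \<and> S \<subseteq> L \<and> (\<forall>m\<in>L. \<exists>m0\<in>S. m0 \<le> m))"
      using * by simp
    then have "\<exists>m. m \<in> L \<and> (\<forall>m0\<in>S. \<not> m0 \<le> m)"
      using that by auto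
    then show ?thesis
      unfolding next_elt_def by (rule someI_ex)
  qed
  define A where "A = rec_nat {} (\<lambda>_ S. insert (next_elt S) S)"
  have A: "finite (A k) \<and> A k \<subseteq> L" for k
    by (induction k) (use next_elt in \<open>auto simp: A_def\<close>)
  have AS: "A (Suc k) = insert (next_elt (A k)) (A k)" for k
    by (simp add: A_def)
  have sub: "A j \<subseteq> A k" if "j \<le> k" for j k
    using that by (rule lift_Suc_mono_le[of A, rotated]) (auto simp: AS)
  have mem: "next_elt (A j) \<in> A k" if "j < k" for j k
    using sub[of "Suc j" k] that by (auto simp: AS)
  have bad: "\<not> next_elt (A j) \<le> next_elt (A k)" if "j < k" for j k
    using next_elt[of "A k"] A[of k] mem[OF that] by blast
  obtain r :: "nat \<Rightarrow> nat" where r: "strict_mono r" "\<And>v. mono (\<lambda>k. next_elt (A (r k)) v)"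
    using monotone_subsequence[of UNIV "\<lambda>k. next_elt (A k)"] by auto
  have "next_elt (A (r 0)) \<le> next_elt (A (r 1))"
    using r(2) by (auto simp: le_fun_def mono_def)
  moreover have "r 0 < r 1"
    using r(1) by (simp add: strict_mono_def)
  ultimately show False
    using bad by blast
qed

text \<open>A monomial order refining the degree: since the logarithms of distinct primes are linearly
  independent over the rationals, exponent vectors of equal degree can be compared by a product
  of prime powers.\<close>

definition exponent_prime :: "'v::finite \<Rightarrow> nat" where
  "exponent_prime = (SOME h. inj h \<and> (\<forall>v. prime (h v)))"

lemma exponent_prime: "inj (exponent_prime :: 'v::finite \<Rightarrow> nat)" "prime (exponent_prime (v :: 'v))"
proof -
  obtain A :: "nat set" where A: "finite A" "card A = CARD('v)" "A \<subseteq> {p. prime p}"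
    using infinite_arbitrarily_large[OF primes_infinite, of "CARD('v)"] by blast
  then obtain h :: "'v \<Rightarrow> nat" where "bij_betw h UNIV A"
    by (metis finite_class.finite_UNIV finite_same_card_bij)
  then have "inj h \<and> (\<forall>v. prime (h v))"
    using A by (auto simp: bij_betw_def)
  then have "inj (exponent_prime :: 'v \<Rightarrow> nat) \<and> (\<forall>v :: 'v. prime (exponent_prime v))"
    unfolding exponent_prime_def by (rule someI[of "\<lambda>h :: 'v \<Rightarrow> nat. inj h \<and> (\<forall>v. prime (h v))"])
  then show "inj (exponent_prime :: 'v \<Rightarrow> nat)" "prime (exponent_prime (v :: 'v))"
    by auto
qed

definition prime_code :: "('v::finite \<Rightarrow> nat) \<Rightarrow> nat" where
  "prime_code m = (\<Prod>v\<in>UNIV. exponent_prime v ^ m v)"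

lemma prime_code_inc: "prime_code (inc v m) = exponent_prime v * prime_code m"
proof -
  have "prime_code (inc v m) = exponent_prime v ^ Suc (m v) * (\<Prod>u\<in>UNIV - {v}. exponent_prime u ^ m u)"
    unfolding prime_code_def by (simp add: prod.remove[of UNIV v] inc_def)
  moreover have "prime_code m = exponent_prime v ^ m v * (\<Prod>u\<in>UNIV - {v}. exponent_prime u ^ m u)"
    unfolding prime_code_def by (simp add: prod.remove[of UNIV v])
  ultimately show ?thesis
    by simp
qed

lemma prime_code_inj: "prime_code m = prime_code m' \<Longrightarrow> m = m'"
proof (rule ext)
  fix v assume eq: "prime_code m = prime_code m'"
  have "multiplicity (exponent_prime v) (prime_code h) = h v" for h :: "'a \<Rightarrow> nat"
  proof -
    have "prime_code h = (\<Prod>p\<in>range (exponent_prime :: 'a \<Rightarrow> nat). p ^ h (inv exponent_prime p))"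
      unfolding prime_code_def
      by (subst prod.reindex) (simp_all add: exponent_prime(1) inv_f_f[OF exponent_prime(1)])
    then have "multiplicity (exponent_prime v) (prime_code h) =
        (if exponent_prime v \<in> range (exponent_prime :: 'a \<Rightarrow> nat) then h (inv exponent_prime (exponent_prime v)) else 0)"
      by (simp only:) (rule multiplicity_prod_prime_powers; auto intro: exponent_prime(2))
    then show ?thesis
      by (simp add: inv_f_f[OF exponent_prime(1)])
  qed
  then show "m v = m' v"
    using eq by metis
qed

definition mlt :: "('v::finite \<Rightarrow> nat) \<Rightarrow> ('v \<Rightarrow> nat) \<Rightarrow> bool" where
  "mlt m' m \<longleftrightarrow> deg m' < deg m \<or> deg m' = deg m \<and> prime_code m' < prime_code m"

lemma mlt_deg: "deg m' < deg m \<Longrightarrow> mlt m' m"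
  by (simp add: mlt_def)

lemma mlt_deg_le: "mlt m' m \<Longrightarrow> deg m' \<le> deg m"
  by (auto simp: mlt_def)

lemma mlt_trans: "mlt a b \<Longrightarrow> mlt b c \<Longrightarrow> mlt a c"
  by (auto simp: mlt_def)

lemma mlt_total: "mlt a b \<or> a = b \<or> mlt b a"
  using prime_code_inj[of a b] unfolding mlt_def by (metis linorder_neqE_nat)

text \<open>Raising the exponent of \<open>v\<close> adds one to both degrees and multiplies both
  codes by the same prime.\<close>

lemma mlt_inc: "mlt a b \<Longrightarrow> mlt (inc v a) (inc v b)"
  using prime_gt_0_nat[OF exponent_prime(2)[of v]] by (auto simp: mlt_def prime_code_inc)

lemma wfP_mlt: "wfp (mlt :: ('v::finite \<Rightarrow> nat) \<Rightarrow> _)"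
proof -
  have "wf (inv_image (less_than <*lex*> less_than) (\<lambda>m :: 'v \<Rightarrow> nat. (deg m, prime_code m)))"
    by auto
  moreover have "{(x, y). mlt x y} = inv_image (less_than <*lex*> less_than) (\<lambda>m :: 'v \<Rightarrow> nat. (deg m, prime_code m))"
    by (auto simp: mlt_def)
  ultimately show ?thesis
    by (simp add: wfp_def)
qed

lemma finite_mlt_maximal:
  assumes "finite A" "A \<noteq> {}"
  shows "\<exists>m\<in>A. \<forall>m'\<in>A. m' \<noteq> m \<longrightarrow> mlt m' m"
  using assms
proof (induction A rule: finite_ne_induct)
  case (insert x A)
  then obtain m where m: "m \<in> A" "\<And>m'. m' \<in> A \<Longrightarrow> m' \<noteq> m \<Longrightarrow> mlt m' m"
    by blast
  consider "mlt x m \<or> x = m" | "mlt m x"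
    using mlt_total by blast
  then show ?case
  proof cases
    case 1
    then show ?thesis
      using m by (intro bexI[of _ m]) auto
  next
    case 2
    then have "mlt m' x" if "m' \<in> A" for m'
      using m(2)[OF that] mlt_trans by (cases "m' = m") auto
    then show ?thesis
      by (intro bexI[of _ x]) auto
  qed
qed simp

section \<open>Monomial operators\<close>

definition dlog :: "('p::finite \<Rightarrow> 'n::linorder xpoly) \<Rightarrow> complex ^ 'p \<Rightarrow> 'n \<Rightarrow> 'n ratfun" where
  "dlog F s i = (\<Sum>j\<in>UNIV. cst (s $ j) * (to_fract (pdiff i (F j)) / to_fract (F j)))"

text \<open>The derivation in direction \<open>i\<close> on g F^s, expressed through the coefficient
  g; \<open>dlog F s i\<close> is the logarithmic derivative of F^s. Here \<open>s\<close> is a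
  point, not a variable.\<close>

definition conn :: "('p::finite \<Rightarrow> 'n::linorder xpoly) \<Rightarrow> complex ^ 'p \<Rightarrow> 'n \<Rightarrow> 'n ratfun \<Rightarrow> 'n ratfun" where
  "conn F s i g = rdiff i g + g * dlog F s i"

lemma conn_add: "conn F s i (g + h) = conn F s i g + conn F s i h"
  by (simp add: conn_def rdiff_add algebra_simps)

lemma conn_mult: "conn F s i (g * h) = rdiff i g * h + g * conn F s i h"
  by (simp add: conn_def rdiff_mult algebra_simps)

lemma conn_cst: "conn F s i (cst z * g) = cst z * conn F s i g"
  by (simp add: conn_mult)

lemma conn_0 [simp]: "conn F s i 0 = 0"
  by (simp add: conn_def)

text \<open>The logarithmic form of F^s is closed. This is the integrability condition that makes
  the operators \<open>conn F s i\<close> commute.\<close>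

lemma rdiff_dlog: "rdiff i (dlog F s k) = rdiff k (dlog F s i)"
proof -
  have "rdiff i (to_fract (pdiff k g) / to_fract g) = rdiff k (to_fract (pdiff i g) / to_fract g)"
    for g :: "'a xpoly"
    by (cases "g = 0") (simp_all add: rdiff_divide rdiff_to_fract pdiff_commute[of i k] mult.commute)
  then show ?thesis
    unfolding dlog_def rdiff_sum rdiff_mult by simp
qed

lemma conn_commute: "conn F s i (conn F s k g) = conn F s k (conn F s i g)"
  by (simp add: conn_def rdiff_add rdiff_mult rdiff_commute[of i k] rdiff_dlog[of i F s k] algebra_simps)

lemma fold_funpow_commute:
  assumes "\<And>i k g. T i (T k g) = T k (T i g)"
  shows "T i (fold (\<lambda>k. T k ^^ b k) xs g) = fold (\<lambda>k. T k ^^ b k) xs (T i g)"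
proof (induction xs arbitrary: g)
  case (Cons k xs)
  have "T i ((T k ^^ j) g) = (T k ^^ j) (T i g)" for j g
    by (induction j) (simp_all add: assms[of i k])
  then show ?case
    by (simp add: Cons.IH)
qed simp

lemma fold_funpow_inc:
  assumes T: "\<And>i k g. T i (T k g) = T k (T i g)" and "distinct xs" "i \<in> set xs"
  shows "fold (\<lambda>k. T k ^^ inc i b k) xs g = T i (fold (\<lambda>k. T k ^^ b k) xs g)"
  using assms(2,3)
proof (induction xs arbitrary: g)
  case (Cons k xs)
  show ?case
  proof (cases "k = i")
    case True
    have "fold (\<lambda>k. T k ^^ inc i b k) xs g = fold (\<lambda>k. T k ^^ b k) xs g" for g
      using True Cons.prems by (intro fold_cong) (auto simp: inc_def)
    then show ?thesis
      using True by (simp add: inc_def fold_funpow_commute[of T, OF T])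
  next
    case False
    then show ?thesis
      using Cons by (simp add: inc_def)
  qed
qed simp

definition conn_pow ::
    "('p::finite \<Rightarrow> 'n::{finite,linorder} xpoly) \<Rightarrow> complex ^ 'p \<Rightarrow> ('n \<Rightarrow> nat) \<Rightarrow> 'n ratfun \<Rightarrow> 'n ratfun" where
  "conn_pow F s b = fold (\<lambda>i. conn F s i ^^ b i) (sorted_list_of_set UNIV)"

lemma conn_pow_0 [simp]: "conn_pow F s (\<lambda>_. 0) g = g"
proof -
  have "fold (\<lambda>i. conn F s i ^^ 0) xs g = g" for xs
    by (induction xs) simp_all
  then show ?thesis
    by (simp add: conn_pow_def)
qed

lemma conn_pow_inc: "conn_pow F s (inc i b) g = conn F s i (conn_pow F s b g)"
  unfolding conn_pow_def by (rule fold_funpow_inc) (simp_all add: conn_commute)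

lemma conn_conn_pow: "conn_pow F s b (conn F s i g) = conn F s i (conn_pow F s b g)"
  unfolding conn_pow_def by (rule fold_funpow_commute[symmetric]) (rule conn_commute)

lemma conn_pow_add: "conn_pow F s b (g + h) = conn_pow F s b g + conn_pow F s b h"
  by (induction b rule: exponent_induct) (simp_all add: conn_pow_inc conn_add)

lemma conn_pow_cst: "conn_pow F s b (cst z * g) = cst z * conn_pow F s b g"
  by (induction b rule: exponent_induct) (simp_all add: conn_pow_inc conn_cst)

definition xvar :: "'n::linorder \<Rightarrow> 'n ratfun" where
  "xvar i = to_fract (mvar i)"

lemma rdiff_xvar: "rdiff i (xvar k) = (if i = k then 1 else 0)"
  by (simp add: xvar_def rdiff_to_fract pdiff_mvar)

lemma conn_pow_xvar:
  "conn_pow F s b (xvar i * g) = xvar i * conn_pow F s b g + of_nat (b i) * conn_pow F s (dec i b) g"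
proof (induction b rule: exponent_induct)
  case (inc k b)
  have "conn F s k (of_nat (b i) * h) = of_nat (b i) * conn F s k h" for h
    by (simp add: conn_mult)
  then have *: "conn_pow F s (inc k b) (xvar i * g) = xvar i * conn_pow F s (inc k b) g
      + (if k = i then conn_pow F s b g else 0) + of_nat (b i) * conn_pow F s (inc k (dec i b)) g"
    by (simp add: conn_pow_inc inc conn_add conn_mult rdiff_xvar)
  show ?case
  proof (cases "k = i")
    case True
    have e: "of_nat (b i) * conn_pow F s (inc i (dec i b)) g = of_nat (b i) * conn_pow F s b g"
      by (cases "b i = 0") (simp_all add: inc_dec)
    show ?thesis
      using * unfolding True e by (simp add: distrib_right)
  next
    case False
    with * show ?thesis
      by (simp add: inc_dec_commute inc_other)
  qed
qed simp

section \<open>Normally ordered monomials of the Weyl algebra\<close>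

definition xpow :: "('n::{finite,linorder} \<Rightarrow> nat) \<Rightarrow> 'n ratfun" where
  "xpow a = (\<Prod>i\<in>UNIV. xvar i ^ a i)"

lemma xpow_0 [simp]: "xpow (\<lambda>_. 0) = 1"
  by (simp add: xpow_def)

lemma xpow_inc: "xpow (inc i a) = xvar i * xpow a"
proof -
  have "xpow (inc i a) = xvar i ^ Suc (a i) * (\<Prod>k\<in>UNIV - {i}. xvar k ^ a k)"
    unfolding xpow_def by (simp add: prod.remove[of UNIV i] inc_def)
  moreover have "xpow a = xvar i ^ a i * (\<Prod>k\<in>UNIV - {i}. xvar k ^ a k)"
    unfolding xpow_def by (simp add: prod.remove[of UNIV i])
  ultimately show ?thesis
    by simp
qed

lemma rdiff_xpow: "rdiff i (xpow a) = of_nat (a i) * xpow (dec i a)"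
proof (induction a rule: exponent_induct)
  case (inc k a)
  have *: "rdiff i (xpow (inc k a)) = (if k = i then xpow a else 0) + of_nat (a i) * xpow (inc k (dec i a))"
    by (simp add: xpow_inc rdiff_mult rdiff_xvar inc)
  show ?case
  proof (cases "k = i")
    case True
    have e: "of_nat (a i) * xpow (inc i (dec i a)) = of_nat (a i) * xpow a"
      by (cases "a i = 0") (simp_all add: inc_dec)
    show ?thesis
      using * unfolding True e by (simp add: distrib_right)
  next
    case False
    with * show ?thesis
      by (simp add: inc_dec_commute inc_other)
  qed
qed simp

text \<open>Coordinates stand to the left of derivations: the \<open>Inl\<close> entries are the
  exponents of the coordinates, the \<open>Inr\<close> entries those of the derivations.\<close>

definition mon ::
    "('p::finite \<Rightarrow> 'n::{finite,linorder} xpoly) \<Rightarrow> complex ^ 'p \<Rightarrow> ('n + 'n \<Rightarrow> nat) \<Rightarrow> 'n ratfun \<Rightarrow> 'n ratfun" where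
  "mon F s m g = xpow (\<lambda>i. m (Inl i)) * conn_pow F s (\<lambda>i. m (Inr i)) g"

lemma mon_0 [simp]: "mon F s (\<lambda>_. 0) g = g"
  by (simp add: mon_def)

lemma mon_add: "mon F s m (g + h) = mon F s m g + mon F s m h"
  by (simp add: mon_def conn_pow_add distrib_left)

lemma mon_cst: "mon F s m (cst z * g) = cst z * mon F s m g"
  by (simp add: mon_def conn_pow_cst)

lemma inc_Inl: "(\<lambda>i. inc (Inl k) m (Inl i)) = inc k (\<lambda>i. m (Inl i))" "(\<lambda>i. inc (Inl k) m (Inr i)) = (\<lambda>i. m (Inr i))"
  by (auto simp: inc_def)

lemma inc_Inr: "(\<lambda>i. inc (Inr k) m (Inr i)) = inc k (\<lambda>i. m (Inr i))" "(\<lambda>i. inc (Inr k) m (Inl i)) = (\<lambda>i. m (Inl i))"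
  by (auto simp: inc_def)

lemma dec_Inl: "(\<lambda>i. dec (Inl k) m (Inl i)) = dec k (\<lambda>i. m (Inl i))" "(\<lambda>i. dec (Inl k) m (Inr i)) = (\<lambda>i. m (Inr i))"
  by (auto simp: dec_def)

lemma dec_Inr: "(\<lambda>i. dec (Inr k) m (Inr i)) = dec k (\<lambda>i. m (Inr i))" "(\<lambda>i. dec (Inr k) m (Inl i)) = (\<lambda>i. m (Inl i))"
  by (auto simp: dec_def)

lemma xvar_mon: "xvar i * mon F s m g = mon F s (inc (Inl i) m) g"
  by (simp add: mon_def inc_Inl xpow_inc)

lemma mon_conn: "mon F s m (conn F s i g) = mon F s (inc (Inr i) m) g"
  by (simp add: mon_def inc_Inr conn_pow_inc conn_conn_pow)

text \<open>The Weyl relation. Multiplying by a coordinate on the left or by a derivation on the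
  right keeps the normal order; the two other products cost a commutator, of degree two less than
  the main term.\<close>

lemma conn_mon: "conn F s i (mon F s m g) =
    mon F s (inc (Inr i) m) g + of_nat (m (Inl i)) * mon F s (dec (Inl i) m) g"
  by (simp add: mon_def inc_Inr dec_Inl conn_pow_inc conn_mult rdiff_xpow)

lemma mon_xvar: "mon F s m (xvar i * g) =
    mon F s (inc (Inl i) m) g + of_nat (m (Inr i)) * mon F s (dec (Inr i) m) g"
  by (simp only: mon_def inc_Inl dec_Inr xpow_inc conn_pow_xvar) (simp add: algebra_simps)

section \<open>Polynomial families of rational functions\<close>

text \<open>An element of \<open>\<complex>(x)[s]\<close> is regarded as the function of \<open>s\<close> that it defines. In this form
  the translation \<open>s \<mapsto> s + v\<close> is a substitution.\<close>

type_synonym ('p, 'n) pfun = "complex ^ 'p \<Rightarrow> 'n ratfun"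

abbreviation smul ::
    "('p, complex) mpoly \<Rightarrow> ('p::finite, 'n::linorder) pfun \<Rightarrow> ('p, 'n) pfun" where
  "smul b G \<equiv> (\<lambda>s. cst (meval b s) * G s)"

definition csub :: "('p::finite, 'n::linorder) pfun set \<Rightarrow> bool" where
  "csub Y \<longleftrightarrow> (\<lambda>_. 0) \<in> Y \<and> (\<forall>G\<in>Y. \<forall>H\<in>Y. (\<lambda>s. G s + H s) \<in> Y) \<and>
     (\<forall>b. \<forall>G\<in>Y. smul b G \<in> Y)"

lemma csub_0: "csub Y \<Longrightarrow> (\<lambda>_. 0) \<in> Y"
  and csub_add: "csub Y \<Longrightarrow> G \<in> Y \<Longrightarrow> H \<in> Y \<Longrightarrow> (\<lambda>s. G s + H s) \<in> Y"
  and csub_scale: "csub Y \<Longrightarrow> G \<in> Y \<Longrightarrow> smul b G \<in> Y"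
  by (auto simp: csub_def)

lemma csub_cst: "csub Y \<Longrightarrow> G \<in> Y \<Longrightarrow> (\<lambda>s. cst z * G s) \<in> Y"
  using csub_scale[of Y G "mconst z"] by simp

lemma csub_diff: "csub Y \<Longrightarrow> G \<in> Y \<Longrightarrow> H \<in> Y \<Longrightarrow> (\<lambda>s. G s - H s) \<in> Y"
  using csub_add[of Y G "\<lambda>s. cst (- 1) * H s"] csub_cst[of Y H "- 1"] by (simp add: cst_uminus)

lemma csub_sum: "csub Y \<Longrightarrow> (\<And>i. i \<in> A \<Longrightarrow> G i \<in> Y) \<Longrightarrow> (\<lambda>s. \<Sum>i\<in>A. G i s) \<in> Y"
  by (induction A rule: infinite_finite_induct) (auto intro: csub_0 csub_add)

definition cspan :: "('i \<Rightarrow> ('p::finite, 'n::linorder) pfun) \<Rightarrow> 'i set \<Rightarrow> ('p, 'n) pfun set" where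
  "cspan w S = {(\<lambda>s. \<Sum>i\<in>A. cst (meval (b i) s) * w i s) | A b. finite A \<and> A \<subseteq> S}"

lemma cspanI: "finite A \<Longrightarrow> A \<subseteq> S \<Longrightarrow> (\<lambda>s. \<Sum>i\<in>A. cst (meval (b i) s) * w i s) \<in> cspan w S"
  unfolding cspan_def by blast

lemma cspanE:
  assumes "G \<in> cspan w S"
  obtains A b where "finite A" "A \<subseteq> S" "G = (\<lambda>s. \<Sum>i\<in>A. cst (meval (b i) s) * w i s)"
  using assms unfolding cspan_def by blast

lemma cspan_base: "i \<in> S \<Longrightarrow> w i \<in> cspan w S"
  using cspanI[of "{i}" S "\<lambda>_. 1" w] by simp

lemma csub_cspan: "csub (cspan w S)"
  unfolding csub_def
proof (intro conjI ballI allI)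
  show "(\<lambda>_. 0) \<in> cspan w S"
    using cspanI[of "{}" S] by simp
next
  fix G H assume GH: "G \<in> cspan w S" "H \<in> cspan w S"
  obtain A b where G: "finite A" "A \<subseteq> S" "G = (\<lambda>s. \<Sum>i\<in>A. cst (meval (b i) s) * w i s)"
    using GH(1) by (rule cspanE)
  obtain B c where H: "finite B" "B \<subseteq> S" "H = (\<lambda>s. \<Sum>i\<in>B. cst (meval (c i) s) * w i s)"
    using GH(2) by (rule cspanE)
  note * = G H
  have eq: "G s + H s = (\<Sum>i\<in>A \<union> B. cst (meval ((if i \<in> A then b i else 0) + (if i \<in> B then c i else 0)) s) * w i s)" for s
  proof -
    have "G s = (\<Sum>i\<in>A \<union> B. cst (meval (if i \<in> A then b i else 0) s) * w i s)"
      unfolding * using * by (intro sum.mono_neutral_cong_left) auto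
    moreover have "H s = (\<Sum>i\<in>A \<union> B. cst (meval (if i \<in> B then c i else 0) s) * w i s)"
      unfolding * using * by (intro sum.mono_neutral_cong_left) auto
    ultimately show ?thesis
      by (simp only: meval_simps cst_add distrib_right sum.distrib)
  qed
  show "(\<lambda>s. G s + H s) \<in> cspan w S"
    unfolding eq by (rule cspanI) (use * in auto)
next
  fix b G assume "G \<in> cspan w S"
  then obtain A c where *: "finite A" "A \<subseteq> S" "G = (\<lambda>s. \<Sum>i\<in>A. cst (meval (c i) s) * w i s)"
    by (rule cspanE)
  have eq: "smul b G = (\<lambda>s. \<Sum>i\<in>A. cst (meval (b * c i) s) * w i s)"
    unfolding * by (simp add: sum_distrib_left cst_mult mult.assoc)
  show "smul b G \<in> cspan w S"
    unfolding eq by (rule cspanI) (use * in auto)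
qed

lemma cspan_least:
  assumes "csub Y" "\<And>i. i \<in> S \<Longrightarrow> w i \<in> Y"
  shows "cspan w S \<subseteq> Y"
proof
  fix G assume "G \<in> cspan w S"
  then obtain A b where *: "finite A" "A \<subseteq> S" "G = (\<lambda>s. \<Sum>i\<in>A. cst (meval (b i) s) * w i s)"
    by (rule cspanE)
  show "G \<in> Y"
    unfolding * using assms * by (intro csub_sum csub_scale) auto
qed

lemma cspan_mono: "S \<subseteq> T \<Longrightarrow> cspan w S \<subseteq> cspan w T"
  by (rule cspan_least) (auto intro: csub_cspan cspan_base)

section \<open>Submodules over D[s]\<close>

definition dsub :: "('p::finite \<Rightarrow> 'n::{finite,linorder} xpoly) \<Rightarrow> ('p, 'n) pfun set \<Rightarrow> bool" where
  "dsub F Y \<longleftrightarrow> csub Y \<and> (\<forall>i. \<forall>G\<in>Y. (\<lambda>s. xvar i * G s) \<in> Y) \<and> (\<forall>i. \<forall>G\<in>Y. (\<lambda>s. conn F s i (G s)) \<in> Y)"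

lemma dsub_csub: "dsub F Y \<Longrightarrow> csub Y"
  and dsub_xvar: "dsub F Y \<Longrightarrow> G \<in> Y \<Longrightarrow> (\<lambda>s. xvar i * G s) \<in> Y"
  and dsub_conn: "dsub F Y \<Longrightarrow> G \<in> Y \<Longrightarrow> (\<lambda>s. conn F s i (G s)) \<in> Y"
  by (auto simp: dsub_def)

lemma dsub_mon: "dsub F Y \<Longrightarrow> G \<in> Y \<Longrightarrow> (\<lambda>s. mon F s m (G s)) \<in> Y"
proof (induction m arbitrary: G rule: exponent_induct)
  case (inc v m)
  show ?case
  proof (cases v)
    case (Inl i)
    then show ?thesis
      using dsub_xvar[OF inc.prems(1) inc.IH[OF inc.prems], of i] by (simp add: xvar_mon)
  next
    case (Inr i)
    then show ?thesis
      using inc.IH[OF inc.prems(1) dsub_conn[OF inc.prems, of i]] by (simp add: mon_conn)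
  qed
qed simp

lemma dsub_to_fract: "dsub F Y \<Longrightarrow> G \<in> Y \<Longrightarrow> (\<lambda>s. to_fract g * G s) \<in> Y"
proof (induction g arbitrary: G rule: mpoly_induct)
  case (const c)
  then show ?case using csub_cst[of Y G c] by (simp add: dsub_csub cst_def)
next
  case (var v)
  then show ?case using dsub_xvar[of F Y G v] by (simp add: xvar_def)
next
  case (add p q)
  then show ?case
    using csub_add[OF dsub_csub[OF add.prems(1)] add.IH(1)[OF add.prems] add.IH(2)[OF add.prems]]
    by (simp add: distrib_right)
next
  case (mult p q)
  then show ?case
    using mult.IH(1)[OF mult.prems(1) mult.IH(2)[OF mult.prems]] by (simp add: mult.assoc)
qed

definition dspan :: "('p::finite \<Rightarrow> 'n::{finite,linorder} xpoly) \<Rightarrow> ('p, 'n) pfun \<Rightarrow> ('p, 'n) pfun set" where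
  "dspan F G = cspan (\<lambda>m s. mon F s m (G s)) UNIV"

lemma dspan_base: "G \<in> dspan F G"
  using cspan_base[of "\<lambda>_. 0" UNIV "\<lambda>m s. mon F s m (G s)"] by (simp add: dspan_def)

lemma dspan_least: "dsub F Y \<Longrightarrow> G \<in> Y \<Longrightarrow> dspan F G \<subseteq> Y"
  unfolding dspan_def by (intro cspan_least dsub_csub dsub_mon)

lemma conn_sum: "conn F s i (sum h A) = (\<Sum>x\<in>A. conn F s i (h x))"
  by (induction A rule: infinite_finite_induct) (simp_all add: conn_add)

lemma cspan_conn:
  assumes Y: "csub Y" and w: "\<And>m. m \<in> S \<Longrightarrow> (\<lambda>s. conn F s i (w m s)) \<in> Y" and G: "G \<in> cspan w S"
  shows "(\<lambda>s. conn F s i (G s)) \<in> Y"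
proof -
  from G obtain A b where *: "finite A" "A \<subseteq> S" "G = (\<lambda>s. \<Sum>i\<in>A. cst (meval (b i) s) * w i s)"
    by (rule cspanE)
  show ?thesis
    unfolding * conn_sum conn_cst using assms * by (intro csub_sum csub_scale) auto
qed

lemma cspan_mult:
  assumes Y: "csub Y" and w: "\<And>m. m \<in> S \<Longrightarrow> (\<lambda>s. g * w m s) \<in> Y" and G: "G \<in> cspan w S"
  shows "(\<lambda>s. g * G s) \<in> Y"
proof -
  from G obtain A b where *: "finite A" "A \<subseteq> S" "G = (\<lambda>s. \<Sum>i\<in>A. cst (meval (b i) s) * w i s)"
    by (rule cspanE)
  show ?thesis
    unfolding * sum_distrib_left mult.left_commute[of g] using assms * by (intro csub_sum csub_scale) auto
qed

lemma dsub_dspan: "dsub F (dspan F G)"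
  unfolding dsub_def
proof (intro conjI allI ballI)
  show c: "csub (dspan F G)"
    unfolding dspan_def by (rule csub_cspan)
  have m: "(\<lambda>s. mon F s m (G s)) \<in> dspan F G" for m
    unfolding dspan_def using cspan_base[of m UNIV "\<lambda>m s. mon F s m (G s)"] by simp
  fix i H assume H: "H \<in> dspan F G"
  show "(\<lambda>s. xvar i * H s) \<in> dspan F G"
    by (rule cspan_mult[OF c _ H[unfolded dspan_def]]) (simp add: xvar_mon m)
  have "(\<lambda>s. conn F s i (mon F s m (G s))) \<in> dspan F G" for m
    using csub_add[OF c m csub_cst[OF c m]] by (simp add: conn_mon cst_of_nat[symmetric])
  then show "(\<lambda>s. conn F s i (H s)) \<in> dspan F G"
    by (intro cspan_conn[OF c _ H[unfolded dspan_def]])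
qed

section \<open>Bernstein--Sato ideals in terms of polynomial families\<close>

lemma peval_map:
  fixes p :: "('v::finite, 'a::comm_ring_1) mpoly" and h :: "'a \<Rightarrow> 'b::comm_ring_1"
  assumes h: "h 0 = 0" "\<And>x y. h (x + y) = h x + h y" "\<And>x y. h (x * y) = h x * h y" "h 1 = 1"
  shows "peval (\<lambda>v. h (a v)) (Poly_Mapping.map h p) = h (peval a p)"
proof -
  have hs: "h (sum g A) = (\<Sum>x\<in>A. h (g x))" for g and A :: "('v \<Rightarrow>\<^sub>0 nat) set"
    by (induction A rule: infinite_finite_induct) (simp_all add: h)
  have hp: "h (prod g A) = (\<Prod>x\<in>A. h (g x))" for g and A :: "'v set"
    by (induction A rule: infinite_finite_induct) (simp_all add: h)
  have hpow: "h (x ^ k) = h x ^ k" for x k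
    by (induction k) (simp_all add: h)
  have "peval (\<lambda>v. h (a v)) (Poly_Mapping.map h p) = (\<Sum>m\<in>Poly_Mapping.keys p.
      h (Poly_Mapping.lookup p m) * (\<Prod>v\<in>UNIV. h (a v) ^ Poly_Mapping.lookup m v))"
    by (subst peval_superset[of "Poly_Mapping.keys p"])
      (auto simp: map.rep_eq when_def in_keys_iff h(1) split: if_splits intro!: sum.cong)
  also have "\<dots> = h (peval a p)"
    unfolding peval_def hs h(3) hp hpow by simp
  finally show ?thesis .
qed

abbreviation ev :: "complex ^ 'p \<Rightarrow> ('n::linorder, 'p::finite) fs_module \<Rightarrow> 'n ratfun" where
  "ev s \<equiv> peval (\<lambda>v. cst (s $ v))"

lemma ev_cst: "ev s (Poly_Mapping.map (\<lambda>c. to_fract (mconst c)) b) = cst (meval b s)"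
  unfolding meval_eq_peval cst_def[symmetric]
  by (rule peval_map) (simp_all add: cst_add cst_mult)

lemma ev_to_fract:
  "ev s (Poly_Mapping.map to_fract c) = to_fract (peval (\<lambda>v. mconst (s $ v)) c)"
  unfolding cst_def by (rule peval_map) simp_all

lemma ev_fs_diff: "ev s (fs_diff F i g) = conn F s i (ev s g)"
proof -
  have c: "(\<Prod>v\<in>UNIV. cst (s $ v) ^ Poly_Mapping.lookup m v) =
      cst (\<Prod>v\<in>UNIV. (s $ v) ^ Poly_Mapping.lookup m v)" for m
    by (simp add: cst_prod cst_power)
  have "ev s (Poly_Mapping.map (rdiff i) g) = (\<Sum>m\<in>Poly_Mapping.keys g.
      rdiff i (Poly_Mapping.lookup g m) * (\<Prod>v\<in>UNIV. cst (s $ v) ^ Poly_Mapping.lookup m v))"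
    by (subst peval_superset[of "Poly_Mapping.keys g"])
      (auto simp: map.rep_eq when_def in_keys_iff split: if_splits intro!: sum.cong)
  also have "\<dots> = rdiff i (ev s g)"
    unfolding peval_def rdiff_sum c by (simp add: rdiff_mult)
  finally show ?thesis
    unfolding fs_diff_def conn_def dlog_def peval_add peval_mult peval_sum by simp
qed

lemma ev_fs_diff_power:
  "ev s (fs_diff_power F \<beta> g) = conn_pow F s (Poly_Mapping.lookup \<beta>) (ev s g)"
proof -
  have 1: "ev s ((fs_diff F i ^^ k) g) = (conn F s i ^^ k) (ev s g)" for i k g
    by (induction k) (simp_all add: ev_fs_diff)
  have "ev s (fold (\<lambda>i. fs_diff F i ^^ b i) xs g) = fold (\<lambda>i. conn F s i ^^ b i) xs (ev s g)" for b xs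
    by (induction xs arbitrary: g) (simp_all add: 1)
  then show ?thesis
    by (simp add: fs_diff_power_def conn_pow_def)
qed

lemma ev_weyl_act:
  assumes "finite A" "Poly_Mapping.keys P \<subseteq> A"
  shows "ev s (weyl_act F P g) = (\<Sum>\<beta>\<in>A. to_fract (peval (\<lambda>v. mconst (s $ v)) (Poly_Mapping.lookup P \<beta>))
    * conn_pow F s (Poly_Mapping.lookup \<beta>) (ev s g))"
proof -
  have "ev s (weyl_act F P g) = (\<Sum>\<beta>\<in>Poly_Mapping.keys P.
      to_fract (peval (\<lambda>v. mconst (s $ v)) (Poly_Mapping.lookup P \<beta>))
      * conn_pow F s (Poly_Mapping.lookup \<beta>) (ev s g))"
    unfolding weyl_act_def peval_sum peval_mult ev_to_fract ev_fs_diff_power ..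
  also have "\<dots> = (\<Sum>\<beta>\<in>A. to_fract (peval (\<lambda>v. mconst (s $ v)) (Poly_Mapping.lookup P \<beta>))
    * conn_pow F s (Poly_Mapping.lookup \<beta>) (ev s g))"
    using assms by (intro sum.mono_neutral_left) (auto simp: in_keys_iff)
  finally show ?thesis .
qed

lemma ev_weyl_act_add:
  "ev s (weyl_act F (P + Q) g) = ev s (weyl_act F P g) + ev s (weyl_act F Q g)"
proof -
  let ?A = "Poly_Mapping.keys P \<union> Poly_Mapping.keys Q"
  have "Poly_Mapping.keys (P + Q) \<subseteq> ?A"
    by (rule Poly_Mapping.keys_add)
  then show ?thesis
    by (simp add: ev_weyl_act[of ?A] lookup_add peval_add distrib_right sum.distrib)
qed

lemma inj_of_nat_ratfun: "inj (of_nat :: nat \<Rightarrow> 'n::linorder ratfun)"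
proof (rule injI)
  fix j k assume "(of_nat j :: 'n ratfun) = of_nat k"
  then have "cst (of_nat j - of_nat k) = (0 :: 'n ratfun)"
    by (simp add: cst_diff cst_of_nat)
  then show "j = k"
    by simp
qed

text \<open>A nonzero polynomial in s over the field of rational functions is nonzero at some point
  with natural coordinates, and these are among the constants tested.\<close>

lemma ev_eqI:
  assumes "\<And>s. ev s g = ev s h"
  shows "g = h"
proof (rule ccontr)
  assume "g \<noteq> h"
  then have "\<exists>w. \<forall>p\<in>{g - h}. peval (\<lambda>v. of_nat (w v)) p \<noteq> 0"
    by (intro exists_nonzero_nat_point inj_of_nat_ratfun) auto
  then obtain w where "peval (\<lambda>v. of_nat (w v)) (g - h) \<noteq> 0"
    by blast
  moreover have "peval (\<lambda>v. of_nat (w v)) (g - h) = 0"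
    using assms[of "\<chi> v. of_nat (w v)"] by (simp add: cst_of_nat peval_diff)
  ultimately show False
    by simp
qed

text \<open>Passes from the formal module to functions of \<open>s\<close>. Evaluation turns the
  action of an operator into a combination of the functions \<open>mon F s m\<close>, and by
  \<open>ev_eqI\<close> an identity of all values is an identity in the module.\<close>

lemma mem_bs_ideal_iff:
  fixes F :: "'p::finite \<Rightarrow> 'n::{finite,linorder} xpoly"
  shows "b \<in> bs_ideal F \<longleftrightarrow>
    (\<lambda>s. cst (meval b s)) \<in> dspan F (\<lambda>_. to_fract (\<Prod>j\<in>UNIV. F j))"
    (is "_ \<longleftrightarrow> _ \<in> dspan F (\<lambda>_. ?f)")
proof
  assume "b \<in> bs_ideal F"
  then obtain P :: "('n, 'p) weyl"
    where P: "Poly_Mapping.map (\<lambda>c. to_fract (mconst c)) b = weyl_act F P (mconst ?f)"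
    unfolding bs_ideal_def by blast
  have eq: "cst (meval b s) = (\<Sum>\<beta>\<in>Poly_Mapping.keys P.
      to_fract (peval (\<lambda>v. mconst (s $ v)) (Poly_Mapping.lookup P \<beta>))
      * conn_pow F s (Poly_Mapping.lookup \<beta>) ?f)" for s
    using arg_cong[OF P, of "ev s"] unfolding ev_cst ev_weyl_act[OF finite_keys order_refl] by simp
  have d: "dsub F (dspan F (\<lambda>_. ?f))"
    by (rule dsub_dspan)
  have pow: "(\<lambda>s. conn_pow F s a ?f) \<in> dspan F (\<lambda>_. ?f)" for a
    using dsub_mon[OF d dspan_base, of "case_sum (\<lambda>_. 0) a"] by (simp add: mon_def)
  \<comment> \<open>A coefficient in x and s is split by its monomials in s: these act as scalars,
    the polynomials in x through \<open>dsub_to_fract\<close>.\<close>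
  have mul: "(\<lambda>s. to_fract (peval (\<lambda>v. mconst (s $ v)) c) * G s) \<in> dspan F (\<lambda>_. ?f)"
    if "G \<in> dspan F (\<lambda>_. ?f)" for c G
  proof -
    have "to_fract (peval (\<lambda>v. mconst (s $ v)) c) * G s = (\<Sum>m\<in>Poly_Mapping.keys c.
        cst (meval (Poly_Mapping.single m 1) s) * (to_fract (Poly_Mapping.lookup c m) * G s))" for s
    proof -
      have 1: "to_fract (sum g A) = (\<Sum>x\<in>A. to_fract (g x))" for g :: "_ \<Rightarrow> 'n xpoly" and A :: "('p \<Rightarrow>\<^sub>0 nat) set"
        by (induction A rule: infinite_finite_induct) simp_all
      have 2: "to_fract (prod g A) = (\<Prod>x\<in>A. to_fract (g x))" for g :: "_ \<Rightarrow> 'n xpoly" and A :: "'p set"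
        by (induction A rule: infinite_finite_induct) simp_all
      have 3: "to_fract (x ^ k) = to_fract x ^ k" for x :: "'n xpoly" and k
        by (induction k) simp_all
      show ?thesis
        by (simp add: peval_def meval_eq_peval peval_single 1 2 3 cst_prod cst_power)
          (simp add: cst_def sum_distrib_left sum_distrib_right mult_ac)
    qed
    then show ?thesis
      by (simp only:) (intro csub_sum csub_scale dsub_to_fract[OF d] dsub_csub[OF d] that)
  qed
  show "(\<lambda>s. cst (meval b s)) \<in> dspan F (\<lambda>_. ?f)"
    unfolding eq by (intro csub_sum dsub_csub[OF d] mul pow)
next
  assume "(\<lambda>s. cst (meval b s)) \<in> dspan F (\<lambda>_. ?f)"
  then obtain A c where "finite A"
    and eq: "(\<lambda>s. cst (meval b s)) = (\<lambda>s. \<Sum>m\<in>A. cst (meval (c m) s) * mon F s m ?f)"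
    unfolding dspan_def by (rule cspanE)
  \<comment> \<open>Elements of the Weyl algebra are represented in normal order, so a single
    monomial with a coefficient in s is a one-term operator.\<close>
  have summand: "\<exists>P :: ('n, 'p) weyl. \<forall>s. ev s (weyl_act F P (mconst ?f)) = cst (meval (c m) s) * mon F s m ?f" for m
  proof -
    define \<beta> where "\<beta> = Abs_poly_mapping (\<lambda>i. m (Inr i))"
    have \<beta>: "Poly_Mapping.lookup \<beta> = (\<lambda>i. m (Inr i))"
      unfolding \<beta>_def by simp
    define d :: "('p, 'n xpoly) mpoly" where
      "d = Poly_Mapping.map mconst (c m) * mconst (\<Prod>i\<in>UNIV. mvar i ^ m (Inl i))"
    have 2: "to_fract (prod g A) = (\<Prod>x\<in>A. to_fract (g x))" for g :: "_ \<Rightarrow> 'n xpoly" and A :: "'n set"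
      by (induction A rule: infinite_finite_induct) simp_all
    have 3: "to_fract (x ^ k) = to_fract x ^ k" for x :: "'n xpoly" and k
      by (induction k) simp_all
    have "peval (\<lambda>v. mconst (s $ v)) (Poly_Mapping.map mconst (c m)) = (mconst (meval (c m) s) :: 'n xpoly)" for s
      unfolding meval_eq_peval by (rule peval_map) (simp_all add: mconst_add mconst_mult)
    then have "to_fract (peval (\<lambda>v. mconst (s $ v)) d) = cst (meval (c m) s) * xpow (\<lambda>i. m (Inl i))" for s
      unfolding d_def by (simp add: peval_mult cst_def xpow_def xvar_def 2 3)
    then have "ev s (weyl_act F (Poly_Mapping.single \<beta> d) (mconst ?f)) = cst (meval (c m) s) * mon F s m ?f" for s
      by (subst ev_weyl_act[of "{\<beta>}"]) (auto simp: \<beta> mon_def mult.assoc)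
    then show ?thesis
      by blast
  qed
  have "\<exists>P :: ('n, 'p) weyl. \<forall>s. ev s (weyl_act F P (mconst ?f)) = (\<Sum>m\<in>A. cst (meval (c m) s) * mon F s m ?f)"
    using \<open>finite A\<close>
  proof (induction A rule: finite_induct)
    case empty
    then show ?case
      by (intro exI[of _ 0]) (simp add: weyl_act_def)
  next
    case (insert m A)
    then obtain P :: "('n, 'p) weyl"
      where "\<And>s. ev s (weyl_act F P (mconst ?f)) = (\<Sum>m\<in>A. cst (meval (c m) s) * mon F s m ?f)"
      by blast
    moreover obtain Q :: "('n, 'p) weyl"
      where "\<And>s. ev s (weyl_act F Q (mconst ?f)) = cst (meval (c m) s) * mon F s m ?f"
      using summand by blast
    ultimately show ?case
      using insert.hyps by (intro exI[of _ "Q + P"]) (simp add: ev_weyl_act_add)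
  qed
  then obtain P :: "('n, 'p) weyl"
    where "\<And>s. ev s (weyl_act F P (mconst ?f)) = cst (meval b s)"
    unfolding eq[THEN fun_cong] by blast
  then have "Poly_Mapping.map (\<lambda>c. to_fract (mconst c)) b = weyl_act F P (mconst ?f)"
    by (intro ev_eqI) (simp add: ev_cst)
  then show "b \<in> bs_ideal F"
    unfolding bs_ideal_def by blast
qed

section \<open>Substitutions\<close>

lemma meval_translate: "\<exists>b'. \<forall>s. meval b' s = meval b (s + \<delta>)"
proof (induction b rule: mpoly_induct)
  case (const c)
  show ?case by (intro exI[of _ "mconst c"]) simp
next
  case (var v)
  show ?case by (intro exI[of _ "mvar v + mconst (\<delta> $ v)"]) simp
next
  case (add p q)
  then obtain p' q' where "\<And>s. meval p' s = meval p (s + \<delta>)" "\<And>s. meval q' s = meval q (s + \<delta>)"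
    by blast
  then show ?case by (intro exI[of _ "p' + q'"]) simp
next
  case (mult p q)
  then obtain p' q' where "\<And>s. meval p' s = meval p (s + \<delta>)" "\<And>s. meval q' s = meval q (s + \<delta>)"
    by blast
  then show ?case by (intro exI[of _ "p' * q'"]) simp
qed

lemma meval_line: "\<exists>q. \<forall>t. poly q t = meval b (\<chi> j. s $ j + t * \<delta> $ j)"
proof (induction b rule: mpoly_induct)
  case (const c)
  show ?case by (intro exI[of _ "[:c:]"]) simp
next
  case (var v)
  show ?case by (intro exI[of _ "[:s $ v, \<delta> $ v:]"]) simp
next
  case (add p q)
  then obtain p' q' where "\<And>t. poly p' t = meval p (\<chi> j. s $ j + t * \<delta> $ j)"
      "\<And>t. poly q' t = meval q (\<chi> j. s $ j + t * \<delta> $ j)"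
    by blast
  then show ?case by (intro exI[of _ "p' + q'"]) simp
next
  case (mult p q)
  then obtain p' q' where "\<And>t. poly p' t = meval p (\<chi> j. s $ j + t * \<delta> $ j)"
      "\<And>t. poly q' t = meval q (\<chi> j. s $ j + t * \<delta> $ j)"
    by blast
  then show ?case by (intro exI[of _ "p' * q'"]) simp
qed

text \<open>The \<open>h j\<close> are polynomials in \<open>s\<close>, which makes the first-order
  formula exact: a polynomial vanishing at \<beta> lies in the maximal ideal of \<beta>.\<close>

lemma meval_taylor: "\<exists>h. \<forall>s. meval b s = meval b \<beta> + (\<Sum>j\<in>UNIV. (s $ j - \<beta> $ j) * meval (h j) s)"
proof (induction b rule: mpoly_induct)
  case (const c)
  show ?case by (intro exI[of _ "\<lambda>_. 0"]) simp
next
  case (var v)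
  have "(\<Sum>j\<in>UNIV. (s $ j - \<beta> $ j) * meval (if j = v then 1 else 0) s) = s $ v - \<beta> $ v" for s
  proof -
    have "(\<Sum>j\<in>UNIV. (s $ j - \<beta> $ j) * meval (if j = v then 1 else 0) s) =
        (\<Sum>j\<in>UNIV. if j = v then s $ j - \<beta> $ j else 0)"
      by (intro sum.cong) auto
    then show ?thesis by simp
  qed
  then show ?case by (intro exI[of _ "\<lambda>j. if j = v then 1 else 0"]) simp
next
  case (add p q)
  from add.IH(1) obtain h where h: "\<forall>s. meval p s = meval p \<beta> + (\<Sum>j\<in>UNIV. (s $ j - \<beta> $ j) * meval (h j) s)"
    by (rule exE)
  from add.IH(2) obtain k where k: "\<forall>s. meval q s = meval q \<beta> + (\<Sum>j\<in>UNIV. (s $ j - \<beta> $ j) * meval (k j) s)"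
    by (rule exE)
  have "meval (p + q) s = meval (p + q) \<beta> + (\<Sum>j\<in>UNIV. (s $ j - \<beta> $ j) * meval (h j + k j) s)" for s
    using h[rule_format, of s] k[rule_format, of s] by (simp add: distrib_left sum.distrib)
  then show ?case
    by (intro exI[of _ "\<lambda>j. h j + k j"] allI)
next
  case (mult p q)
  from mult.IH(1) obtain h where h: "\<forall>s. meval p s = meval p \<beta> + (\<Sum>j\<in>UNIV. (s $ j - \<beta> $ j) * meval (h j) s)"
    by (rule exE)
  from mult.IH(2) obtain k where k: "\<forall>s. meval q s = meval q \<beta> + (\<Sum>j\<in>UNIV. (s $ j - \<beta> $ j) * meval (k j) s)"
    by (rule exE)
  note hk = h[rule_format] k[rule_format]
  \<comment> \<open>From p q - p(\<beta>) q(\<beta>) = (p - p(\<beta>)) q + p(\<beta>) (q -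
    q(\<beta>)).\<close>
  have "meval (p * q) s = meval (p * q) \<beta> +
      (\<Sum>j\<in>UNIV. (s $ j - \<beta> $ j) * meval (h j * q + mconst (meval p \<beta>) * k j) s)" for s
  proof -
    let ?H = "\<Sum>j\<in>UNIV. (s $ j - \<beta> $ j) * meval (h j) s"
    let ?K = "\<Sum>j\<in>UNIV. (s $ j - \<beta> $ j) * meval (k j) s"
    have "(\<Sum>j\<in>UNIV. (s $ j - \<beta> $ j) * meval (h j * q + mconst (meval p \<beta>) * k j) s) =
        ?H * meval q s + meval p \<beta> * ?K"
      by (simp add: sum_distrib_left sum_distrib_right distrib_left sum.distrib mult_ac)
    then show ?thesis
      using hk[of s] by (simp add: algebra_simps)
  qed
  then show ?case
    by (intro exI[of _ "\<lambda>j. h j * q + mconst (meval p \<beta>) * k j"] allI)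
qed

section \<open>Sections with poles along the divisor\<close>

lemma to_fract_prod: "to_fract (prod g A) = (\<Prod>x\<in>A. to_fract (g x))"
  by (induction A rule: infinite_finite_induct) simp_all

lemma to_fract_power: "to_fract (x ^ k) = to_fract x ^ k"
  by (induction k) simp_all

lemma to_fract_of_nat: "to_fract (of_nat k) = of_nat k"
  by (induction k) simp_all

lemma to_fract_sum: "to_fract (sum g A) = (\<Sum>x\<in>A. to_fract (g x))"
  by (induction A rule: infinite_finite_induct) simp_all

lemma to_fract_expand:
  "to_fract g = (\<Sum>a\<in>Poly_Mapping.keys g. cst (Poly_Mapping.lookup g a) * xpow (Poly_Mapping.lookup a))"
  for g :: "'n::{finite,linorder} xpoly"
proof -
  have "to_fract (Poly_Mapping.single a z) = cst z * xpow (Poly_Mapping.lookup a)" for a :: "'n \<Rightarrow>\<^sub>0 nat" and z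
  proof -
    have "Poly_Mapping.single a z = mconst z * (\<Prod>i\<in>UNIV. mvar i ^ Poly_Mapping.lookup a i)"
    proof -
      have "mvar i ^ k = Poly_Mapping.single (Poly_Mapping.single i k) (1 :: complex)" for i :: 'n and k
        by (induction k) (simp_all add: mvar_def mult_single single_add[symmetric])
      moreover have "(\<Prod>i\<in>A. Poly_Mapping.single (m i) (1 :: complex)) = Poly_Mapping.single (\<Sum>i\<in>A. m i) 1"
        for A and m :: "'n \<Rightarrow> 'n \<Rightarrow>\<^sub>0 nat"
        by (induction A rule: infinite_finite_induct) (simp_all add: mult_single)
      moreover have "(\<Sum>i\<in>UNIV. Poly_Mapping.single i (Poly_Mapping.lookup a i)) = a"
        by (rule poly_mapping_eqI) (simp add: lookup_sum lookup_single when_def)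
      ultimately show ?thesis
        by (simp add: mconst_def mult_single)
    qed
    then show ?thesis
      by (simp add: cst_def xpow_def xvar_def to_fract_prod to_fract_power)
  qed
  then show ?thesis
    by (subst mpoly_as_sum) (simp only: to_fract_sum)
qed

locale poly_tuple =
  fixes F :: "'p::finite \<Rightarrow> 'n::{finite,linorder} xpoly"
  assumes prod_nonzero: "(\<Prod>j\<in>UNIV. F j) \<noteq> 0"
begin

definition f :: "'n xpoly" where
  "f = (\<Prod>j\<in>UNIV. F j)"

abbreviation ff :: "'n ratfun" where
  "ff \<equiv> to_fract f"

definition cofactor :: "'p \<Rightarrow> 'n xpoly" where
  "cofactor j = (\<Prod>l\<in>UNIV - {j}. F l)"

lemma ff_nonzero [simp]: "ff \<noteq> 0" "f \<noteq> 0"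
  using prod_nonzero by (simp_all add: f_def)

lemma F_nonzero [simp]: "F j \<noteq> 0"
  using prod_nonzero by auto

lemma F_cofactor: "F j * cofactor j = f"
  unfolding f_def cofactor_def by (simp add: prod.remove[of UNIV j])

lemma dlog_eq: "dlog F s i = (\<Sum>j\<in>UNIV. cst (s $ j) * (to_fract (pdiff i (F j) * cofactor j) / ff))"
proof -
  have "to_fract (pdiff i (F j)) / to_fract (F j) = to_fract (pdiff i (F j) * cofactor j) / ff" for j
  proof -
    have "ff = to_fract (F j) * to_fract (cofactor j)" "to_fract (cofactor j) \<noteq> 0"
      using F_cofactor[of j] ff_nonzero(2) by (auto simp flip: to_fract_mult)
    then show ?thesis
      by simp
  qed
  then show ?thesis
    unfolding dlog_def by simp
qed

lemma conn_pole:
  "conn F s i (to_fract g / ff ^ k) =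
    to_fract (pdiff i g * f - of_nat k * g * pdiff i f) / ff ^ Suc k +
    (\<Sum>j\<in>UNIV. cst (s $ j) * (to_fract (g * pdiff i (F j) * cofactor j) / ff ^ Suc k))"
proof -
  have "rdiff i (to_fract g / ff ^ k) = to_fract (pdiff i g * f - of_nat k * g * pdiff i f) / ff ^ Suc k"
  proof (cases k)
    case (Suc l)
    then have "rdiff i (ff ^ k) = of_nat k * ff ^ l * to_fract (pdiff i f)"
      by (simp only: rdiff_power rdiff_to_fract) simp
    then show ?thesis
      using Suc by (simp add: rdiff_divide rdiff_to_fract to_fract_of_nat field_simps)
  qed (simp add: rdiff_to_fract)
  moreover have "to_fract g / ff ^ k * dlog F s i =
      (\<Sum>j\<in>UNIV. cst (s $ j) * (to_fract (g * pdiff i (F j) * cofactor j) / ff ^ Suc k))"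
    unfolding dlog_eq sum_distrib_left by (intro sum.cong refl) (simp add: divide_simps)
  ultimately show ?thesis
    unfolding conn_def by simp
qed

text \<open>The functions of \<open>s\<close> defined by the elements of C[x, s, 1/f].\<close>

definition sections :: "('p, 'n) pfun set" where
  "sections = cspan (\<lambda>(g, k) s. to_fract g / ff ^ k) UNIV"

lemma csub_sections: "csub sections"
  unfolding sections_def by (rule csub_cspan)

lemma pole_sections: "(\<lambda>s. to_fract g / ff ^ k) \<in> sections"
  unfolding sections_def using cspan_base[of "(g, k)" UNIV "\<lambda>(g, k) s. to_fract g / ff ^ k"] by simp

lemma to_fract_sections: "(\<lambda>s. to_fract g) \<in> sections"
  using pole_sections[of g 0] by simp

lemma one_sections: "(\<lambda>s. 1) \<in> sections"
  using to_fract_sections[of 1] by simp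

lemma dsub_sections: "dsub F sections"
  unfolding dsub_def
proof (intro conjI allI ballI)
  show "csub sections" by (rule csub_sections)
  fix i G assume G: "G \<in> sections"
  show "(\<lambda>s. xvar i * G s) \<in> sections"
  proof (rule cspan_mult[OF csub_sections _ G[unfolded sections_def]])
    fix m :: "'n xpoly \<times> nat"
    show "(\<lambda>s. xvar i * (case m of (g, k) \<Rightarrow> \<lambda>s. to_fract g / ff ^ k) s) \<in> sections"
      using pole_sections[of "mvar i * fst m" "snd m"] by (simp add: xvar_def case_prod_beta)
  qed
  show "(\<lambda>s. conn F s i (G s)) \<in> sections"
  proof (rule cspan_conn[OF csub_sections _ G[unfolded sections_def]])
    fix m :: "'n xpoly \<times> nat"
    obtain g k where m: "m = (g, k)" by force
    have "(\<lambda>s. cst (s $ j) * (to_fract h / ff ^ Suc k)) \<in> sections" for j h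
      using csub_scale[OF csub_sections pole_sections[of h "Suc k"], of "mvar j"] by simp
    then show "(\<lambda>s. conn F s i ((case m of (g, k) \<Rightarrow> \<lambda>s. to_fract g / ff ^ k) s)) \<in> sections"
      unfolding m prod.case conn_pole
      by (intro csub_add[OF csub_sections] csub_sum[OF csub_sections] pole_sections)
  qed
qed

lemma dspan_subset_sections: "G \<in> sections \<Longrightarrow> dspan F G \<subseteq> sections"
  by (rule dspan_least[OF dsub_sections])

text \<open>\<open>k\<close> bounds the pole order of \<open>G\<close>, so that \<open>G\<close> is
  a multiple of f^-k over C[x, s]. It is fixed before \<open>b\<close>, because the denominators
  supplied by local generation depend on the pole order.\<close>

lemma sections_pole_bound:
  assumes "G \<in> sections"
  shows "\<exists>k. \<forall>Y b. dsub F Y \<longrightarrow> (\<lambda>s. cst (meval b s) / ff ^ k) \<in> Y \<longrightarrow> smul b G \<in> Y"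
proof -
  from assms obtain A c where A: "finite A"
    and G: "G = (\<lambda>s. \<Sum>m\<in>A. cst (meval (c m) s) * (case m of (g, k) \<Rightarrow> \<lambda>s. to_fract g / ff ^ k) s)"
    unfolding sections_def by (rule cspanE)
  define K where "K = (\<Sum>m\<in>A. snd m)"
  have "smul b G \<in> Y"
    if Y: "dsub F Y" and b: "(\<lambda>s. cst (meval b s) / ff ^ K) \<in> Y" for Y b
  proof -
    have "(\<lambda>s. cst (meval (c m) s) * (to_fract (fst m * f ^ (K - snd m)) * (cst (meval b s) / ff ^ K))) \<in> Y" for m
      by (intro csub_scale[OF dsub_csub[OF Y]] dsub_to_fract[OF Y] b)
    then have "(\<lambda>s. \<Sum>m\<in>A. cst (meval (c m) s) * (to_fract (fst m * f ^ (K - snd m)) * (cst (meval b s) / ff ^ K))) \<in> Y"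
      by (intro csub_sum[OF dsub_csub[OF Y]])
    moreover have "cst (meval b s) * G s =
        (\<Sum>m\<in>A. cst (meval (c m) s) * (to_fract (fst m * f ^ (K - snd m)) * (cst (meval b s) / ff ^ K)))" for s
      unfolding G sum_distrib_left
    proof (intro sum.cong refl)
      fix m assume "m \<in> A"
      then have "snd m \<le> K"
        unfolding K_def using A by (intro member_le_sum) auto
      then have "ff ^ K = ff ^ (K - snd m) * ff ^ snd m"
        by (simp flip: power_add)
      then show "cst (meval b s) * (cst (meval (c m) s) * (case m of (g, k) \<Rightarrow> \<lambda>s. to_fract g / ff ^ k) s) =
          cst (meval (c m) s) * (to_fract (fst m * f ^ (K - snd m)) * (cst (meval b s) / ff ^ K))"
        by (simp add: case_prod_beta to_fract_power)
    qed
    ultimately show ?thesis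
      by simp
  qed
  then show ?thesis
    by blast
qed

text \<open>Only the polynomial coefficients of a section depend on \<open>s\<close>, so expanding
  each of them suffices. Thus a section vanishing at \<beta> lies in the maximal ideal of \<beta>
  times the sections.\<close>

lemma sections_taylor:
  assumes "G \<in> sections"
  shows "\<exists>H. (\<forall>j. H j \<in> sections) \<and> (\<forall>s. G s = G \<beta> + (\<Sum>j\<in>UNIV. cst (s $ j - \<beta> $ j) * H j s))"
proof -
  from assms obtain A c where A: "finite A"
    and G: "G = (\<lambda>s. \<Sum>m\<in>A. cst (meval (c m) s) * (case m of (g, k) \<Rightarrow> \<lambda>s. to_fract g / ff ^ k) s)"
    unfolding sections_def by (rule cspanE)
  have "\<forall>m. \<exists>h. \<forall>s. meval (c m) s = meval (c m) \<beta> + (\<Sum>j\<in>UNIV. (s $ j - \<beta> $ j) * meval (h j) s)"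
    by (intro allI meval_taylor)
  then obtain h where h: "\<forall>m s. meval (c m) s = meval (c m) \<beta> + (\<Sum>j\<in>UNIV. (s $ j - \<beta> $ j) * meval (h m j) s)"
    unfolding choice_iff by (rule exE)
  define H where "H j = (\<lambda>s. \<Sum>m\<in>A. cst (meval (h m j) s) * (to_fract (fst m) / ff ^ snd m))" for j
  have "H j \<in> sections" for j
    unfolding H_def by (intro csub_sum[OF csub_sections] csub_scale[OF csub_sections] pole_sections)
  moreover have "G s = G \<beta> + (\<Sum>j\<in>UNIV. cst (s $ j - \<beta> $ j) * H j s)" for s
  proof -
    have e: "cst (meval (c m) s) = cst (meval (c m) \<beta>) + (\<Sum>j\<in>UNIV. cst (s $ j - \<beta> $ j) * cst (meval (h m j) s))" for m
      using arg_cong[OF h[rule_format, of m s], of cst] by (simp only: cst_add cst_sum cst_mult)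
    have "G s = (\<Sum>m\<in>A. (cst (meval (c m) \<beta>) + (\<Sum>j\<in>UNIV. cst (s $ j - \<beta> $ j) * cst (meval (h m j) s)))
        * (to_fract (fst m) / ff ^ snd m))"
      unfolding G case_prod_beta by (intro sum.cong refl arg_cong2[of _ _ _ _ "(*)"] e)
    also have "\<dots> = G \<beta> + (\<Sum>m\<in>A. \<Sum>j\<in>UNIV. cst (s $ j - \<beta> $ j) * (cst (meval (h m j) s) * (to_fract (fst m) / ff ^ snd m)))"
      unfolding G case_prod_beta by (simp only: distrib_right sum.distrib sum_distrib_right mult.assoc)
    also have "(\<Sum>m\<in>A. \<Sum>j\<in>UNIV. cst (s $ j - \<beta> $ j) * (cst (meval (h m j) s) * (to_fract (fst m) / ff ^ snd m))) =
        (\<Sum>j\<in>UNIV. cst (s $ j - \<beta> $ j) * H j s)"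
      unfolding H_def by (subst sum.swap) (simp add: sum_distrib_left)
    finally show ?thesis .
  qed
  ultimately show ?thesis
    by blast
qed

section \<open>Integral translations of the exponents\<close>

definition fpow :: "('p \<Rightarrow> nat) \<Rightarrow> 'n ratfun" where
  "fpow u = (\<Prod>j\<in>UNIV. to_fract (F j) ^ u j)"

definition natvec :: "('p \<Rightarrow> nat) \<Rightarrow> complex ^ 'p" where
  "natvec u = (\<chi> j. of_nat (u j))"

lemma fpow_nonzero [simp]: "fpow u \<noteq> 0"
  by (simp add: fpow_def)

lemma fpow_const: "fpow (\<lambda>_. k) = ff ^ k"
  by (simp add: fpow_def f_def to_fract_prod prod_power_distrib)

lemma fpow_to_fract: "fpow u = to_fract (\<Prod>j\<in>UNIV. F j ^ u j)"
  by (simp add: fpow_def to_fract_prod to_fract_power)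

lemma rdiff_fpow: "rdiff i (fpow u) = fpow u * dlog F (natvec u) i"
proof -
  have "rdiff i (\<Prod>j\<in>A. to_fract (F j) ^ u j) = (\<Prod>j\<in>A. to_fract (F j) ^ u j) *
      (\<Sum>j\<in>A. of_nat (u j) * (to_fract (pdiff i (F j)) / to_fract (F j)))" for A
  proof (induction A rule: infinite_finite_induct)
    case (insert j A)
    have "rdiff i (to_fract (F j) ^ u j) =
        to_fract (F j) ^ u j * (of_nat (u j) * (to_fract (pdiff i (F j)) / to_fract (F j)))"
    proof (cases "u j")
      case (Suc l)
      then have "rdiff i (to_fract (F j) ^ u j) = of_nat (u j) * to_fract (F j) ^ l * to_fract (pdiff i (F j))"
        by (simp only: rdiff_power rdiff_to_fract) simp
      then show ?thesis
        using Suc by simp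
    qed simp
    then show ?case
      using insert by (simp add: rdiff_mult algebra_simps)
  qed simp_all
  then show ?thesis
    by (simp add: fpow_def dlog_def natvec_def cst_of_nat)
qed

text \<open>F^s F^u = F^(s+u): multiplication by F^u is a gauge transformation between the exponents
  s + u and s.\<close>

lemma conn_fpow: "conn F s i (fpow u * g) = fpow u * conn F (s + natvec u) i g"
proof -
  have "dlog F (s + natvec u) i = dlog F s i + dlog F (natvec u) i"
    unfolding dlog_def by (simp add: cst_add distrib_right sum.distrib del: times_divide_eq_right)
  then show ?thesis
    by (simp add: conn_def rdiff_mult rdiff_fpow algebra_simps)
qed

lemma mon_fpow: "mon F s m (fpow u * g) = fpow u * mon F (s + natvec u) m g"
proof (induction m arbitrary: g rule: exponent_induct)
  case (inc v m)
  show ?case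
    by (cases v) (simp_all add: inc mult.left_commute conn_fpow flip: xvar_mon mon_conn)
qed simp

lemma mon_div_fpow: "mon F s m (g / fpow u) = mon F (s - natvec u) m g / fpow u"
  using mon_fpow[of "s - natvec u" m u "g / fpow u"] by (simp add: field_simps)

text \<open>Substitution of s - u for s in a relation. The coefficients are translated, and writing
  F^(s-u) in terms of F^s produces the division by \<open>fpow u\<close>.\<close>

lemma dspan_div_fpow:
  assumes "G \<in> dspan F H"
  shows "(\<lambda>s. G (s - natvec u) / fpow u) \<in> dspan F (\<lambda>s. H (s - natvec u) / fpow u)"
proof -
  from assms obtain A c where A: "finite A" and G: "G = (\<lambda>s. \<Sum>m\<in>A. cst (meval (c m) s) * mon F s m (H s))"
    unfolding dspan_def by (rule cspanE)
  have "\<forall>m. \<exists>b. \<forall>s. meval b s = meval (c m) (s + - natvec u)"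
    by (intro allI meval_translate)
  then obtain c' where c': "\<And>m s. meval (c' m) s = meval (c m) (s - natvec u)"
    unfolding choice_iff by auto
  have "(\<lambda>s. G (s - natvec u) / fpow u) =
      (\<lambda>s. \<Sum>m\<in>A. cst (meval (c' m) s) * mon F s m (H (s - natvec u) / fpow u))"
    unfolding G c' mon_div_fpow by (simp add: sum_divide_distrib)
  then show ?thesis
    unfolding dspan_def using cspanI[OF A subset_UNIV] by (simp only:)
qed

lemma dsub_preimage: "dsub F Y \<Longrightarrow> dsub F {G. smul b G \<in> Y}"
  unfolding dsub_def csub_def by (auto simp: distrib_left mult.left_commute conn_cst[symmetric])

text \<open>Every power of \<open>f\<^bsup>-1\<^esup>\<close> is generated by \<open>1\<close> near \<open>s\<^sub>0\<close>: apply the functional equations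
  translated by \<open>-1, -2, \<dots>\<close> successively.\<close>

definition locally_generated :: "complex ^ 'p \<Rightarrow> bool" where
  "locally_generated s\<^sub>0 \<longleftrightarrow>
     (\<forall>k. \<exists>b. meval b s\<^sub>0 \<noteq> 0 \<and> (\<lambda>s. cst (meval b s) / ff ^ k) \<in> dspan F (\<lambda>_. 1))"

lemma locally_generatedI:
  assumes "\<And>k. k > 0 \<Longrightarrow> \<exists>b\<in>bs_ideal F. meval b (s\<^sub>0 - natvec (\<lambda>_. k)) \<noteq> 0"
  shows "locally_generated s\<^sub>0"
  unfolding locally_generated_def
proof
  fix k
  show "\<exists>b. meval b s\<^sub>0 \<noteq> 0 \<and> (\<lambda>s. cst (meval b s) / ff ^ k) \<in> dspan F (\<lambda>_. 1)"
  proof (induction k)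
    case 0
    then show ?case
      using dspan_base[of "\<lambda>_. 1" F] by (intro exI[of _ 1]) simp
  next
    case (Suc k)
    then obtain b where b: "meval b s\<^sub>0 \<noteq> 0" "(\<lambda>s. cst (meval b s) / ff ^ k) \<in> dspan F (\<lambda>_. 1)"
      by blast
    obtain c where c: "c \<in> bs_ideal F" "meval c (s\<^sub>0 - natvec (\<lambda>_. Suc k)) \<noteq> 0"
      using assms[of "Suc k"] by auto
    obtain c' where c': "\<And>s. meval c' s = meval c (s + - natvec (\<lambda>_. Suc k))"
      using meval_translate by blast
    \<comment> \<open>The functional equation translated by -(k+1) expresses f^-(k+1) through f^-k,
      up to the factor \<open>c'\<close>, which is nonzero at \<open>s\<^sub>0\<close>.\<close>
    have "(\<lambda>s. cst (meval c (s - natvec (\<lambda>_. Suc k))) / fpow (\<lambda>_. Suc k)) \<in> dspan F (\<lambda>s. ff / fpow (\<lambda>_. Suc k))"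
      using dspan_div_fpow[OF c(1)[unfolded mem_bs_ideal_iff]] by (simp add: f_def)
    then have "(\<lambda>s. cst (meval c' s) / ff ^ Suc k) \<in> dspan F (\<lambda>s. 1 / ff ^ k)"
      by (simp add: c' fpow_const)
    moreover have "dspan F (\<lambda>s. 1 / ff ^ k) \<subseteq> {G. smul b G \<in> dspan F (\<lambda>_. 1)}"
      by (rule dspan_least[OF dsub_preimage[OF dsub_dspan]]) (use b in simp)
    ultimately have "(\<lambda>s. cst (meval (b * c') s) / ff ^ Suc k) \<in> dspan F (\<lambda>_. 1)"
      by (auto simp: cst_mult)
    then show ?case
      using b c by (intro exI[of _ "b * c'"]) (simp add: c')
  qed
qed

lemma locally_generated_section:
  assumes "locally_generated s\<^sub>0" "G \<in> sections"
  shows "\<exists>b. meval b s\<^sub>0 \<noteq> 0 \<and> smul b G \<in> dspan F (\<lambda>_. 1)"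
  using sections_pole_bound[OF assms(2)] assms(1) dsub_dspan unfolding locally_generated_def by blast

end

section \<open>Standard monomials\<close>

text \<open>A Groebner basis over \<open>\<complex>(s)\<close> of the annihilator of \<open>1\<close>; all that is kept of it is a
  polynomial \<open>c\<close> in \<open>s\<close> outside whose zero set the reduction to standard monomials works.\<close>

interpretation rat: vector_space "\<lambda>z (g :: 'n::linorder ratfun). cst z * g"
  by unfold_locales (simp_all add: cst_add cst_mult algebra_simps)

text \<open>This would loop with \<open>cst_mult\<close>.\<close>

declare rat.scale_scale [simp del]

text \<open>Localisation at \<open>c\<close> without fractions; for a sum the exponents of
  \<open>c\<close> are added.\<close>

lemma csub_saturation:
  assumes Y: "csub Y"
  shows "csub {G. \<exists>N. smul (c ^ N) G \<in> Y}"
  unfolding csub_def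
proof (intro conjI ballI allI)
  show "(\<lambda>_. 0) \<in> {G. \<exists>N. smul (c ^ N) G \<in> Y}"
    using csub_0[OF Y] by simp
next
  fix G H assume "G \<in> {G. \<exists>N. smul (c ^ N) G \<in> Y}"
    "H \<in> {G. \<exists>N. smul (c ^ N) G \<in> Y}"
  then obtain N M where NM: "smul (c ^ N) G \<in> Y" "smul (c ^ M) H \<in> Y"
    by blast
  have "(\<lambda>s. cst (meval (c ^ (N + M)) s) * (G s + H s)) \<in> Y"
    using csub_add[OF Y csub_scale[OF Y NM(1), of "c ^ M"] csub_scale[OF Y NM(2), of "c ^ N"]]
    by (simp add: power_add cst_mult algebra_simps)
  then show "(\<lambda>s. G s + H s) \<in> {G. \<exists>N. smul (c ^ N) G \<in> Y}"
    by blast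
next
  fix b G assume "G \<in> {G. \<exists>N. smul (c ^ N) G \<in> Y}"
  then obtain N where N: "smul (c ^ N) G \<in> Y"
    by blast
  then have "(\<lambda>s. cst (meval (c ^ N) s) * (cst (meval b s) * G s)) \<in> Y"
    using csub_scale[OF Y N, of b] by (simp add: mult.left_commute)
  then show "smul b G \<in> {G. \<exists>N. smul (c ^ N) G \<in> Y}"
    by blast
qed

context poly_tuple
begin

definition mono_fun :: "('n + 'n \<Rightarrow> nat) \<Rightarrow> ('p, 'n) pfun" where
  "mono_fun m = (\<lambda>s. mon F s m 1)"

definition below :: "('n + 'n \<Rightarrow> nat) \<Rightarrow> ('p, 'n) pfun set" where
  "below m = cspan mono_fun {m'. mlt m' m}"

definition leads :: "('p, complex) mpoly \<Rightarrow> ('n + 'n \<Rightarrow> nat) \<Rightarrow> bool" where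
  "leads c m \<longleftrightarrow> smul c (mono_fun m) \<in> below m"

definition Std :: "('n + 'n \<Rightarrow> nat) set" where
  "Std = {m. \<forall>c. leads c m \<longrightarrow> (\<forall>s. meval c s = 0)}"

abbreviation Std_le :: "nat \<Rightarrow> ('n + 'n \<Rightarrow> nat) set" where
  "Std_le k \<equiv> {m\<in>Std. deg m \<le> k}"

lemma csub_below: "csub (below m)"
  unfolding below_def by (rule csub_cspan)

lemma mono_fun_below: "mlt m' m \<Longrightarrow> mono_fun m' \<in> below m"
  unfolding below_def by (rule cspan_base) simp

lemma leads_mult:
  assumes "leads c m"
  shows "leads (d * c) m"
proof -
  have "(\<lambda>s. cst (meval d s) * (cst (meval c s) * mono_fun m s)) \<in> below m"
    using assms unfolding leads_def by (rule csub_scale[OF csub_below])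
  then show ?thesis
    unfolding leads_def meval_simps cst_mult mult.assoc .
qed

text \<open>Multiplying the operator from the left by a coordinate or a derivation shifts its
  leading monomial and keeps \<open>c\<close>, as s is central; commutators have smaller degree and
  fall below the new leading monomial.\<close>

lemma leads_inc: "leads c m \<Longrightarrow> leads c (inc v m)"
proof (cases v)
  case (Inl i)
  assume "leads c m"
  then have "(\<lambda>s. xvar i * (cst (meval c s) * mono_fun m s)) \<in> below (inc v m)"
    unfolding leads_def below_def[of m]
    by (rule cspan_mult[OF csub_below, rotated])
      (use mono_fun_below[OF mlt_inc, of _ m v] in \<open>simp add: mono_fun_def xvar_mon Inl\<close>)
  then show "leads c (inc v m)"
    by (simp add: leads_def mono_fun_def Inl mult.left_commute[of "xvar i"] xvar_mon)
next
  case (Inr i)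
  assume m: "leads c m"
  have dec: "mono_fun (dec (Inl i) m') \<in> below (inc v m)" if "deg m' \<le> deg m" for m'
    using that deg_dec_le[of "Inl i" m'] by (intro mono_fun_below mlt_deg) simp
  have w: "(\<lambda>s. conn F s i (mono_fun m' s)) \<in> below (inc v m)" if "mlt m' m" for m'
    using csub_add[OF csub_below mono_fun_below[OF mlt_inc[OF that, of v]]
        csub_cst[OF csub_below dec[OF mlt_deg_le[OF that]]]]
    by (simp add: mono_fun_def conn_mon Inr cst_of_nat[symmetric])
  have "(\<lambda>s. conn F s i (cst (meval c s) * mono_fun m s)) \<in> below (inc v m)"
    by (rule cspan_conn[OF csub_below _ m[unfolded leads_def below_def[of m]]]) (simp add: w)
  from csub_diff[OF csub_below this] have "(\<lambda>s. conn F s i (cst (meval c s) * mono_fun m s) - H s) \<in> below (inc v m)"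
    if "H \<in> below (inc v m)" for H
    using that .
  \<comment> \<open>The commutator produced by the leading monomial itself; subtracting it leaves
    \<open>c\<close> times the new monomial.\<close>
  moreover have "(\<lambda>s. cst (meval c s) * (cst (of_nat (m (Inl i))) * mono_fun (dec (Inl i) m) s)) \<in> below (inc v m)"
    by (intro csub_scale[OF csub_below] csub_cst[OF csub_below] dec) simp
  ultimately have "(\<lambda>s. conn F s i (cst (meval c s) * mono_fun m s) -
      cst (meval c s) * (cst (of_nat (m (Inl i))) * mono_fun (dec (Inl i) m) s)) \<in> below (inc v m)"
    by blast
  then show "leads c (inc v m)"
    by (simp add: leads_def mono_fun_def conn_cst conn_mon Inr cst_of_nat distrib_left)
qed

text \<open>By Dickson's lemma every nonstandard monomial is a multiple of one of finitely many,
  whose leading coefficients serve for all. The factors are listed separately because each is to be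
  made nonzero at a translated point.\<close>

lemma finite_leading_coefficients:
  obtains C where "finite C" "\<And>c. c \<in> C \<Longrightarrow> c \<noteq> 0" "\<And>m. m \<notin> Std \<Longrightarrow> leads (\<Prod>C) m"
proof -
  obtain S where S: "finite S" "S \<subseteq> - Std" "\<And>m. m \<notin> Std \<Longrightarrow> \<exists>m0\<in>S. m0 \<le> m"
    using dickson[of "- Std"] by auto
  have "\<forall>m. \<exists>c. m \<notin> Std \<longrightarrow> leads c m \<and> (\<exists>s. meval c s \<noteq> 0)"
    by (auto simp: Std_def)
  then obtain c where c: "\<And>m. m \<notin> Std \<Longrightarrow> leads (c m) m" "\<And>m. m \<notin> Std \<Longrightarrow> \<exists>s. meval (c m) s \<noteq> 0"
    unfolding choice_iff by blast
  have "leads (\<Prod>(c ` S)) m" if m: "m \<notin> Std" for m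
  proof -
    obtain m0 where m0: "m0 \<in> S" "m0 \<le> m"
      using S(3)[OF m] by blast
    have "leads (c m0) m"
      using m0(2) c(1)[of m0] S(2) m0(1) by (induction rule: exponent_le_induct) (auto intro: leads_inc)
    moreover have "\<Prod>(c ` S) = \<Prod>(c ` S - {c m0}) * c m0"
      using S(1) m0(1) by (subst prod.remove[of _ "c m0"]) auto
    ultimately show ?thesis
      using leads_mult by simp
  qed
  moreover have "d \<noteq> 0" if "d \<in> c ` S" for d
    using c(2) S(2) that by fastforce
  ultimately show ?thesis
    using S(1) that[of "c ` S"] by auto
qed

text \<open>The largest monomial whose coefficient is not identically zero would be the leading
  monomial of an annihilating operator, hence not standard.\<close>

lemma Std_independent:
  assumes "finite A" "A \<subseteq> Std" and 0: "\<And>s. (\<Sum>m\<in>A. cst (meval (b m) s) * mono_fun m s) = 0"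
    and "m \<in> A"
  shows "meval (b m) s = 0"
proof (rule ccontr)
  assume nz: "meval (b m) s \<noteq> 0"
  define B where "B = {m\<in>A. \<exists>s. meval (b m) s \<noteq> 0}"
  have "finite B" "B \<noteq> {}"
    using assms nz by (auto simp: B_def)
  from finite_mlt_maximal[OF this] obtain k where k: "k \<in> B" "\<forall>m'\<in>B. m' \<noteq> k \<longrightarrow> mlt m' k"
    by (rule bexE)
  have 1: "(\<Sum>m\<in>B. cst (meval (b m) s) * mono_fun m s) = 0" for s
    unfolding 0[of s, symmetric] using assms(1) by (intro sum.mono_neutral_left) (auto simp: B_def)
  have "cst (meval (b k) s) * mono_fun k s = (\<Sum>m\<in>B - {k}. cst (meval (- b m) s) * mono_fun m s)" for s
    using 1[of s] k(1) \<open>finite B\<close>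
    by (simp add: sum.remove[of B k] cst_uminus sum_negf eq_neg_iff_add_eq_0)
  moreover have "(\<lambda>s. \<Sum>m\<in>B - {k}. cst (meval (- b m) s) * mono_fun m s) \<in> below k"
    by (intro csub_sum[OF csub_below] csub_scale[OF csub_below] mono_fun_below k(2)[rule_format]) auto
  ultimately have "leads (b k) k"
    by (simp add: leads_def)
  then show False
    using k(1) assms(2) by (auto simp: B_def Std_def)
qed

end

locale reduced_tuple = poly_tuple F for F :: "'p::finite \<Rightarrow> 'n::{finite,linorder} xpoly" +
  fixes c :: "('p, complex) mpoly"
  assumes leads: "\<And>m. m \<notin> Std \<Longrightarrow> leads c m"
begin

text \<open>Division by the Groebner basis. Each replacement of a leading monomial costs a factor
  \<open>c\<close>, and as the order refines the degree, no monomial of larger degree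
  appears.\<close>

lemma Std_reduction:
  "\<exists>N. smul (c ^ N) (mono_fun m) \<in> cspan mono_fun (Std_le (deg m))"
proof (induction m rule: wfp_induct_rule[OF wfP_mlt])
  case (1 m)
  let ?Y = "cspan mono_fun (Std_le (deg m))"
  let ?Z = "{G. \<exists>N. smul (c ^ N) G \<in> ?Y}"
  show ?case
  proof (cases "m \<in> Std")
    case True
    then show ?thesis
      using cspan_base[of m "Std_le (deg m)" mono_fun] by (intro exI[of _ 0]) simp
  next
    case False
    have "mono_fun m' \<in> ?Z" if "mlt m' m" for m'
      using 1[OF that] cspan_mono[of "Std_le (deg m')" "Std_le (deg m)" mono_fun]
        mlt_deg_le[OF that] by fastforce
    then have "below m \<subseteq> ?Z"
      unfolding below_def by (intro cspan_least csub_saturation csub_cspan) auto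
    then obtain N where "(\<lambda>s. cst (meval (c ^ N) s) * (cst (meval c s) * mono_fun m s)) \<in> ?Y"
      using leads[OF False] unfolding leads_def by auto
    then have "smul (c ^ Suc N) (mono_fun m) \<in> ?Y"
      by (simp add: cst_mult mult_ac)
    then show ?thesis
      by blast
  qed
qed

text \<open>Where \<open>c\<close> does not vanish its powers can be inverted. This yields only
  spanning; independence at a point is settled in \<open>Std_independent_at\<close>.\<close>

lemma Std_span:
  assumes "meval c s \<noteq> 0"
  shows "mon F s m 1 \<in> rat.span ((\<lambda>m'. mon F s m' 1) ` (Std_le (deg m)))"
proof -
  obtain N where "smul (c ^ N) (mono_fun m) \<in> cspan mono_fun (Std_le (deg m))"
    using Std_reduction by blast
  then obtain A b where A: "A \<subseteq> Std_le (deg m)"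
    and eq: "smul (c ^ N) (mono_fun m) = (\<lambda>s. \<Sum>m\<in>A. cst (meval (b m) s) * mono_fun m s)"
    by (rule cspanE)
  have "cst (meval (c ^ N) s) * mon F s m 1 \<in> rat.span ((\<lambda>m'. mon F s m' 1) ` (Std_le (deg m)))"
    unfolding fun_cong[OF eq, unfolded mono_fun_def, of s] using A
    by (intro rat.span_sum rat.span_scale rat.span_base) auto
  from rat.span_scale[OF this, of "inverse (meval (c ^ N) s)"] show ?thesis
    using assms by (simp add: mult.assoc[symmetric] cst_mult[symmetric] meval_power)
qed

text \<open>Freeness at \<open>s\<^sub>0\<close>: a relation at \<open>s\<^sub>0\<close> is a section vanishing there, hence a combination of
  the \<open>s\<^sub>j - s\<^sub>0\<^sub>j\<close> with coefficients that can again be reduced to standard monomials.\<close>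

lemma Std_independent_at:
  assumes lg: "locally_generated s\<^sub>0" and c0: "meval c s\<^sub>0 \<noteq> 0"
    and A: "finite A" "A \<subseteq> Std" and rel: "(\<Sum>m\<in>A. cst (l m) * mon F s\<^sub>0 m 1) = 0" and m: "m \<in> A"
  shows "l m = 0"
proof -
  let ?Y = "cspan mono_fun Std"
  let ?Z = "{G. \<exists>N. smul (c ^ N) G \<in> ?Y}"
  define G where "G = (\<lambda>s. \<Sum>m\<in>A. cst (l m) * mono_fun m s)"
  have Y: "csub ?Y"
    by (rule csub_cspan)
  have "mono_fun k \<in> ?Z" for k
    using Std_reduction[of k] cspan_mono[of "Std_le (deg k)" Std mono_fun] by fastforce
  then have Z: "dspan F (\<lambda>_. 1) \<subseteq> ?Z"
    unfolding dspan_def by (intro cspan_least csub_saturation Y) (simp add: mono_fun_def)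
  have sec: "mono_fun k \<in> sections" for k
    unfolding mono_fun_def using dsub_mon[OF dsub_sections one_sections] .
  have "G \<in> sections"
    unfolding G_def by (intro csub_sum csub_cst csub_sections sec)
  from sections_taylor[OF this, of s\<^sub>0] obtain H where
    *: "(\<forall>j. H j \<in> sections) \<and> (\<forall>s. G s = G s\<^sub>0 + (\<Sum>j\<in>UNIV. cst (s $ j - s\<^sub>0 $ j) * H j s))"
    by (rule exE)
  note H = *[THEN conjunct1, rule_format] and GH = *[THEN conjunct2, rule_format]
  have G0: "G s\<^sub>0 = 0"
    using rel by (simp add: G_def mono_fun_def)
  have "\<exists>d. meval d s\<^sub>0 \<noteq> 0 \<and> smul d (H j) \<in> ?Y" for j
  proof -
    obtain b where b: "meval b s\<^sub>0 \<noteq> 0" "smul b (H j) \<in> dspan F (\<lambda>_. 1)"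
      using locally_generated_section[OF lg H] by blast
    then obtain N where "(\<lambda>s. cst (meval (c ^ N) s) * (cst (meval b s) * H j s)) \<in> ?Y"
      using Z by blast
    then have "smul (c ^ N * b) (H j) \<in> ?Y"
      by (simp only: meval_simps cst_mult mult.assoc)
    moreover have "meval (c ^ N * b) s\<^sub>0 \<noteq> 0"
      using b(1) c0 by (simp add: meval_power)
    ultimately show ?thesis
      by (intro exI[of _ "c ^ N * b"] conjI)
  qed
  then have "\<exists>d. \<forall>j. meval (d j) s\<^sub>0 \<noteq> 0 \<and> smul (d j) (H j) \<in> ?Y"
    by (intro choice allI)
  then obtain d where *: "\<forall>j. meval (d j) s\<^sub>0 \<noteq> 0 \<and> smul (d j) (H j) \<in> ?Y"
    by (rule exE)
  note d = *[rule_format, THEN conjunct1] *[rule_format, THEN conjunct2]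
  \<comment> \<open>A common denominator for all \<open>H j\<close>, still nonzero at
    \<open>s\<^sub>0\<close>.\<close>
  define D where "D = (\<Prod>j\<in>UNIV. d j)"
  have D0: "meval D s\<^sub>0 \<noteq> 0"
    unfolding D_def meval_prod using d(1) by simp
  have "smul D (H j) \<in> ?Y" for j
  proof -
    have "D = (\<Prod>i\<in>UNIV - {j}. d i) * d j"
      unfolding D_def by (simp add: prod.remove[of UNIV j] mult.commute)
    then show ?thesis
      using csub_scale[OF Y d(2)[of j], of "\<Prod>i\<in>UNIV - {j}. d i"] by (simp add: cst_mult mult.assoc)
  qed
  then have "\<forall>j. \<exists>p. smul D (H j) = (\<lambda>s. \<Sum>m\<in>fst p. cst (meval (snd p m) s) * mono_fun m s)
      \<and> finite (fst p) \<and> fst p \<subseteq> Std"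
    unfolding cspan_def by simp
  then have "\<exists>p. \<forall>j. smul D (H j) = (\<lambda>s. \<Sum>m\<in>fst (p j). cst (meval (snd (p j) m) s) * mono_fun m s)
      \<and> finite (fst (p j)) \<and> fst (p j) \<subseteq> Std"
    by (rule choice)
  then obtain p where *: "\<forall>j. smul D (H j) = (\<lambda>s. \<Sum>m\<in>fst (p j). cst (meval (snd (p j) m) s) * mono_fun m s)
      \<and> finite (fst (p j)) \<and> fst (p j) \<subseteq> Std"
    by (rule exE)
  define B b where "B j = fst (p j)" and "b j = snd (p j)" for j
  have B: "\<And>j. finite (B j)" "\<And>j. B j \<subseteq> Std"
    and Bb: "\<And>j. smul D (H j) = (\<lambda>s. \<Sum>m\<in>B j. cst (meval (b j m) s) * mono_fun m s)"
    unfolding B_def b_def using * by simp_all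
  define U where "U = A \<union> (\<Union>j. B j)"
  have U: "finite U" "U \<subseteq> Std" "A \<subseteq> U" "\<And>j. B j \<subseteq> U"
    using A B by (auto simp: U_def)
  define e where "e j m = (if m \<in> B j then (mvar j - mconst (s\<^sub>0 $ j)) * b j m else 0)" for j m
  \<comment> \<open>The coefficients of D G - sum_j (s_j - s0_j) D H_j = 0 in standard monomials.
    They vanish as functions of \<open>s\<close>; at \<open>s\<^sub>0\<close> the \<open>e j\<close>
    drop out and D(s0) \<open>l m\<close> remains.\<close>
  define a where "a m = (if m \<in> A then mconst (l m) * D else 0) - (\<Sum>j\<in>UNIV. e j m)" for m
  have "(\<Sum>m\<in>U. cst (meval (a m) s) * mono_fun m s) = 0" for s
  proof -
    have 1: "(\<Sum>m\<in>U. cst (meval (if m \<in> A then mconst (l m) * D else 0) s) * mono_fun m s) = cst (meval D s) * G s"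
    proof -
      have "(\<Sum>m\<in>A. cst (meval (mconst (l m) * D) s) * mono_fun m s) =
          (\<Sum>m\<in>U. cst (meval (if m \<in> A then mconst (l m) * D else 0) s) * mono_fun m s)"
        using U by (intro sum.mono_neutral_cong_left) auto
      then show ?thesis
        by (simp add: G_def sum_distrib_left cst_mult mult_ac)
    qed
    have 2: "(\<Sum>m\<in>U. cst (meval (e j m) s) * mono_fun m s) =
        cst (meval D s) * (cst (s $ j - s\<^sub>0 $ j) * H j s)" for j
    proof -
      have "(\<Sum>m\<in>U. cst (meval (e j m) s) * mono_fun m s) =
          (\<Sum>m\<in>B j. cst (s $ j - s\<^sub>0 $ j) * (cst (meval (b j m) s) * mono_fun m s))"
        using U by (intro sum.mono_neutral_cong_right) (auto simp: e_def cst_mult mult.assoc)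
      also have "\<dots> = cst (s $ j - s\<^sub>0 $ j) * (cst (meval D s) * H j s)"
        unfolding fun_cong[OF Bb] by (simp add: sum_distrib_left)
      finally show ?thesis
        by (simp add: mult.left_commute)
    qed
    have "(\<Sum>m\<in>U. cst (meval (a m) s) * mono_fun m s) =
        cst (meval D s) * G s - (\<Sum>j\<in>UNIV. cst (meval D s) * (cst (s $ j - s\<^sub>0 $ j) * H j s))"
      unfolding a_def meval_simps(7) cst_diff[of "meval _ _"] left_diff_distrib[of "cst (meval _ _)"] sum_subtractf 1
        meval_sum cst_sum sum_distrib_right
      by (subst sum.swap) (simp only: 2)
    also have "\<dots> = 0"
      using GH[of s] by (simp add: G0 sum_distrib_left)
    finally show ?thesis .
  qed
  then have "meval (a m) s\<^sub>0 = 0"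
    by (rule Std_independent[OF U(1,2)]) (use m U in auto)
  moreover have "meval (\<Sum>j\<in>UNIV. e j m) s\<^sub>0 = 0"
    unfolding meval_sum by (intro sum.neutral) (simp add: e_def)
  ultimately show ?thesis
    using D0 m by (simp add: a_def)
qed

end

section \<open>Passage to a closed point\<close>

text \<open>Gaussian elimination, one equation at a time. It serves both Dixmier's argument and
  Bernstein's inequality.\<close>

lemma homogeneous_system:
  fixes c :: "'m \<Rightarrow> 'e \<Rightarrow> complex"
  assumes "finite E" "finite M" "card E < card M"
  shows "\<exists>l. (\<exists>m\<in>M. l m \<noteq> 0) \<and> (\<forall>e\<in>E. (\<Sum>m\<in>M. l m * c m e) = 0)"
  using assms
proof (induction E arbitrary: M c rule: finite_induct)
  case empty
  then obtain m where "m \<in> M" by fastforce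
  then show ?case by (intro exI[of _ "\<lambda>_. 1"]) auto
next
  case (insert e E)
  show ?case
  proof (cases "\<forall>m\<in>M. c m e = 0")
    case True
    obtain l where "\<exists>m\<in>M. l m \<noteq> 0" "\<forall>e\<in>E. (\<Sum>m\<in>M. l m * c m e) = 0"
      using insert.IH[of M c] insert.prems insert.hyps by auto
    then show ?thesis
      using True by (intro exI[of _ l]) simp
  next
    case False
    then obtain m0 where m0: "m0 \<in> M" "c m0 e \<noteq> 0"
      by blast
    define M' where "M' = M - {m0}"
    have M': "finite M'" "m0 \<notin> M'" "M = insert m0 M'" "card E < card M'"
      using insert m0 by (auto simp: M'_def)
    obtain l where l: "\<exists>m\<in>M'. l m \<noteq> 0"
      "\<forall>e'\<in>E. (\<Sum>m\<in>M'. l m * (c m e' - c m e / c m0 e * c m0 e')) = 0"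
      using insert.IH[OF M'(1,4), of "\<lambda>m e'. c m e' - c m e / c m0 e * c m0 e'"] by blast
    define l' where "l' = l(m0 := - (\<Sum>m\<in>M'. l m * c m e / c m0 e))"
    have s: "(\<Sum>m\<in>M. l' m * c m x) = (\<Sum>m\<in>M'. l m * (c m x - c m e / c m0 e * c m0 x))" for x
    proof -
      have "(\<Sum>m\<in>M'. l' m * c m x) = (\<Sum>m\<in>M'. l m * c m x)"
        using M'(2) by (intro sum.cong) (auto simp: l'_def)
      then show ?thesis
        using M'(1,2) unfolding M'(3)
        by (simp add: l'_def right_diff_distrib sum_subtractf sum_distrib_right mult.assoc)
    qed
    have "(\<Sum>m\<in>M. l' m * c m e) = 0"
      unfolding s using m0 by simp
    moreover have "\<exists>m\<in>M. l' m \<noteq> 0"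
      using l(1) M'(2) unfolding M'(3) l'_def by auto
    ultimately show ?thesis
      using l(2) s by (intro exI[of _ l']) auto
  qed
qed

lemma meval_poly: "\<exists>r. \<forall>s. meval r s = poly q (s $ j)"
proof (induction q)
  case 0
  show ?case by (intro exI[of _ 0]) simp
next
  case (pCons a q)
  then obtain r where "\<forall>s. meval r s = poly q (s $ j)" by blast
  then show ?case by (intro exI[of _ "mconst a + mvar j * r"]) simp
qed

lemma dsub_Int: "dsub F X \<Longrightarrow> dsub F Y \<Longrightarrow> dsub F (X \<inter> Y)"
  unfolding dsub_def csub_def by blast

lemma dsub_chain_Union:
  assumes "C \<noteq> {}" "\<And>X. X \<in> C \<Longrightarrow> dsub F X" "\<And>X Y. X \<in> C \<Longrightarrow> Y \<in> C \<Longrightarrow> X \<subseteq> Y \<or> Y \<subseteq> X"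
  shows "dsub F (\<Union>C)"
  unfolding dsub_def csub_def
proof (intro conjI ballI allI)
  show "(\<lambda>_. 0) \<in> \<Union>C"
    using assms(1,2) csub_0[OF dsub_csub] by blast
next
  fix G H assume "G \<in> \<Union>C" "H \<in> \<Union>C"
  then obtain X where "X \<in> C" "G \<in> X" "H \<in> X"
    using assms(3) by blast
  then show "(\<lambda>s. G s + H s) \<in> \<Union>C"
    using csub_add[OF dsub_csub[OF assms(2)]] by blast
next
  fix b G assume "G \<in> \<Union>C"
  then show "smul b G \<in> \<Union>C"
    using csub_scale[OF dsub_csub[OF assms(2)]] by blast
next
  fix i G assume "G \<in> \<Union>C"
  then show "(\<lambda>s. xvar i * G s) \<in> \<Union>C"
    using dsub_xvar[OF assms(2)] by blast
next
  fix i G assume "G \<in> \<Union>C"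
  then show "(\<lambda>s. conn F s i (G s)) \<in> \<Union>C"
    using dsub_conn[OF assms(2)] by blast
qed

definition dsub_at :: "('p::finite \<Rightarrow> 'n::{finite,linorder} xpoly) \<Rightarrow> complex ^ 'p \<Rightarrow> 'n ratfun set \<Rightarrow> bool" where
  "dsub_at F \<beta> Y \<longleftrightarrow> rat.subspace Y \<and> (\<forall>i. \<forall>g\<in>Y. xvar i * g \<in> Y \<and> conn F \<beta> i g \<in> Y)"

context poly_tuple
begin

section \<open>Localised submodules and countable dimension\<close>

lemma dsub_saturation:
  assumes Y: "dsub F Y" and S: "1 \<in> S" "\<And>b c. b \<in> S \<Longrightarrow> c \<in> S \<Longrightarrow> b * c \<in> S"
  shows "dsub F {G \<in> sections. \<exists>b\<in>S. smul b G \<in> Y}" (is "dsub F ?Z")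
proof -
  note Y' = dsub_csub[OF Y]
  show ?thesis
    unfolding dsub_def csub_def
  proof (intro conjI ballI allI)
    show "(\<lambda>_. 0) \<in> ?Z"
      using csub_0[OF Y'] csub_0[OF csub_sections] S(1) by auto
  next
    fix G H assume "G \<in> ?Z" "H \<in> ?Z"
    then obtain b c where bc: "b \<in> S" "c \<in> S" "G \<in> sections" "H \<in> sections"
      and b: "smul b G \<in> Y" and c: "smul c H \<in> Y"
      by blast
    have "(\<lambda>s. cst (meval (b * c) s) * (G s + H s)) \<in> Y"
      using csub_add[OF Y' csub_scale[OF Y' b, of c] csub_scale[OF Y' c, of b]]
      by (simp add: cst_mult algebra_simps)
    then show "(\<lambda>s. G s + H s) \<in> ?Z"
      using bc S(2) csub_add[OF csub_sections] by blast
  next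
    fix a G assume "G \<in> ?Z"
    then obtain b where "b \<in> S" "G \<in> sections" and b: "smul b G \<in> Y"
      by blast
    then show "smul a G \<in> ?Z"
      using csub_scale[OF Y' b, of a] csub_scale[OF csub_sections] by (auto simp: mult.left_commute)
  next
    fix i G assume "G \<in> ?Z"
    then obtain b where "b \<in> S" "G \<in> sections" and b: "smul b G \<in> Y"
      by blast
    then show "(\<lambda>s. xvar i * G s) \<in> ?Z"
      using dsub_xvar[OF Y b, of i] dsub_xvar[OF dsub_sections] by (auto simp: mult.left_commute)
  next
    fix i G assume "G \<in> ?Z"
    then obtain b where "b \<in> S" "G \<in> sections" and b: "smul b G \<in> Y"
      by blast
    then show "(\<lambda>s. conn F s i (G s)) \<in> ?Z"
      using dsub_conn[OF Y b, of i] dsub_conn[OF dsub_sections] by (auto simp: conn_cst)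
  qed
qed

lemma dsub_add_multiple:
  assumes Y: "dsub F Y"
  shows "dsub F {(\<lambda>s. H s + cst (meval b s) * V s) | H V. H \<in> Y \<and> V \<in> sections}" (is "dsub F ?Z")
proof -
  note Y' = dsub_csub[OF Y]
  have I: "(\<lambda>s. H s + cst (meval b s) * V s) \<in> ?Z" if "H \<in> Y" "V \<in> sections" for H V
    using that by blast
  show ?thesis
    unfolding dsub_def csub_def
  proof (intro conjI ballI allI)
    show "(\<lambda>_. 0) \<in> ?Z"
      using I[OF csub_0[OF Y'] csub_0[OF csub_sections]] by simp
  next
    fix G G' assume "G \<in> ?Z" "G' \<in> ?Z"
    then obtain H V H' V' where *: "H \<in> Y" "V \<in> sections" "G = (\<lambda>s. H s + cst (meval b s) * V s)"
      "H' \<in> Y" "V' \<in> sections" "G' = (\<lambda>s. H' s + cst (meval b s) * V' s)"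
      by auto
    then show "(\<lambda>s. G s + G' s) \<in> ?Z"
      using I[OF csub_add[OF Y' *(1,4)] csub_add[OF csub_sections *(2,5)]] by (simp add: algebra_simps)
  next
    fix a G assume "G \<in> ?Z"
    then obtain H V where *: "H \<in> Y" "V \<in> sections" "G = (\<lambda>s. H s + cst (meval b s) * V s)"
      by auto
    then show "smul a G \<in> ?Z"
      using I[OF csub_scale[OF Y' *(1), of a] csub_scale[OF csub_sections *(2), of a]]
      by (simp add: algebra_simps)
  next
    fix i G assume "G \<in> ?Z"
    then obtain H V where *: "H \<in> Y" "V \<in> sections" "G = (\<lambda>s. H s + cst (meval b s) * V s)"
      by auto
    then show "(\<lambda>s. xvar i * G s) \<in> ?Z"
      using I[OF dsub_xvar[OF Y *(1), of i] dsub_xvar[OF dsub_sections *(2), of i]]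
      by (simp add: algebra_simps)
  next
    fix i G assume "G \<in> ?Z"
    then obtain H V where *: "H \<in> Y" "V \<in> sections" "G = (\<lambda>s. H s + cst (meval b s) * V s)"
      by auto
    then show "(\<lambda>s. conn F s i (G s)) \<in> ?Z"
      using I[OF dsub_conn[OF Y *(1), of i] dsub_conn[OF dsub_sections *(2), of i]]
      by (simp add: conn_add conn_cst)
  qed
qed

text \<open>A countable family spanning the sections over C. It is not linearly independent, as 1 is
  also a combination of fractions with denominator f.\<close>

definition section_basis :: "('p \<Rightarrow> nat) \<times> ('n \<Rightarrow> nat) \<times> nat \<Rightarrow> ('p, 'n) pfun" where
  "section_basis = (\<lambda>(t, a, k) s. cst (\<Prod>v\<in>UNIV. (s $ v) ^ t v) * (xpow a / ff ^ k))"

lemma sections_countable_dimension: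
  assumes "G \<in> sections"
  shows "\<exists>A l. finite A \<and> G = (\<lambda>s. \<Sum>t\<in>A. cst (l t) * section_basis t s)"
proof -
  define X where "X = {G. \<exists>A l. finite A \<and> G = (\<lambda>s. \<Sum>t\<in>A. cst (l t) * section_basis t s)}"
  have XI: "(\<lambda>s. \<Sum>t\<in>A. cst (l t) * section_basis t s) \<in> X" if "finite A" for A l
    unfolding X_def using that by (intro CollectI exI[of _ A] exI[of _ l] conjI refl)
  have add: "(\<lambda>s. G s + H s) \<in> X" if "G \<in> X" "H \<in> X" for G H
  proof -
    obtain A l where A: "finite A" "G = (\<lambda>s. \<Sum>t\<in>A. cst (l t) * section_basis t s)"
      using \<open>G \<in> X\<close> unfolding X_def by blast
    obtain B k where B: "finite B" "H = (\<lambda>s. \<Sum>t\<in>B. cst (k t) * section_basis t s)"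
      using \<open>H \<in> X\<close> unfolding X_def by blast
    define a b where "a t = (if t \<in> A then l t else 0)" and "b t = (if t \<in> B then k t else 0)" for t
    have "G s = (\<Sum>t\<in>A \<union> B. cst (a t) * section_basis t s)" for s
      unfolding A(2) using A(1) B(1) by (intro sum.mono_neutral_cong_left) (auto simp: a_def)
    moreover have "H s = (\<Sum>t\<in>A \<union> B. cst (b t) * section_basis t s)" for s
      unfolding B(2) using A(1) B(1) by (intro sum.mono_neutral_cong_left) (auto simp: b_def)
    ultimately have "(\<lambda>s. G s + H s) = (\<lambda>s. \<Sum>t\<in>A \<union> B. cst (a t + b t) * section_basis t s)"
      by (simp add: cst_add distrib_right sum.distrib)
    then show ?thesis
      using XI[of "A \<union> B" "\<lambda>t. a t + b t"] A(1) B(1) by simp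
  qed
  have 0: "(\<lambda>_. 0) \<in> X"
    using XI[of "{}"] by simp
  have sumX: "(\<lambda>s. \<Sum>i\<in>A. g i s) \<in> X" if "\<And>i. i \<in> A \<Longrightarrow> g i \<in> X" for A and g :: "'i \<Rightarrow> _"
    using that by (induction A rule: infinite_finite_induct) (auto intro: 0 add)
  have base: "(\<lambda>s. cst z * section_basis t s) \<in> X" for z t
    using XI[of "{t}" "\<lambda>_. z"] by simp
  have "(\<lambda>s. cst (meval b s) * (to_fract g / ff ^ k)) \<in> X" for b g k
  proof -
    have "(\<lambda>s. cst (meval b s) * (to_fract g / ff ^ k)) =
        (\<lambda>s. \<Sum>t\<in>Poly_Mapping.keys b. \<Sum>a\<in>Poly_Mapping.keys g.
          cst (Poly_Mapping.lookup b t * Poly_Mapping.lookup g a) *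
          section_basis (Poly_Mapping.lookup t, Poly_Mapping.lookup a, k) s)"
      unfolding to_fract_expand meval_def cst_sum sum_divide_distrib sum_product section_basis_def
      by (simp add: cst_mult mult_ac)
    then show ?thesis
      by (simp only:) (intro sumX base)
  qed
  moreover obtain A c where G: "G = (\<lambda>s. \<Sum>m\<in>A. cst (meval (c m) s) * (case m of (g, k) \<Rightarrow> \<lambda>s. to_fract g / ff ^ k) s)"
    using assms unfolding sections_def by (rule cspanE)
  ultimately have "G \<in> X"
    unfolding G case_prod_beta by (intro sumX)
  then show ?thesis
    unfolding X_def by simp
qed

text \<open>Presents the sections as a union of countably many finite-dimensional complex spaces. Of
  any uncountable family of sections, infinitely many members then lie in one of these.\<close>

lemma sections_finite_pieces:
  obtains e :: "nat \<Rightarrow> ('p, 'n) pfun" where "\<And>G. G \<in> sections \<Longrightarrow> \<exists>n l. G = (\<lambda>s. \<Sum>i<n. cst (l i) * e i s)"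
proof
  fix G assume "G \<in> sections"
  then obtain A l where A: "finite A" "G = (\<lambda>s. \<Sum>t\<in>A. cst (l t) * section_basis t s)"
    using sections_countable_dimension by blast
  \<comment> \<open>Larger than all codes of members of \<open>A\<close>; the added 0 covers empty
    \<open>A\<close>.\<close>
  define n where "n = Suc (Max (to_nat ` A \<union> {0}))"
  have n: "to_nat t < n" if "t \<in> A" for t
    unfolding n_def using A(1) that by (intro le_imp_less_Suc Max_ge) auto
  define k where "k i = (if i \<in> to_nat ` A then l (from_nat i) else 0)" for i
  have "(\<Sum>t\<in>A. cst (l t) * section_basis t s) = (\<Sum>i<n. cst (k i) * section_basis (from_nat i) s)" for s
  proof -
    have "(\<Sum>t\<in>A. cst (l t) * section_basis t s) = (\<Sum>i\<in>to_nat ` A. cst (l (from_nat i)) * section_basis (from_nat i) s)"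
      by (subst sum.reindex) simp_all
    also have "\<dots> = (\<Sum>i<n. cst (k i) * section_basis (from_nat i) s)"
      using n by (intro sum.mono_neutral_cong_left) (auto simp: k_def)
    finally show ?thesis .
  qed
  then show "\<exists>n l. G = (\<lambda>s. \<Sum>i<n. cst (l i) * section_basis (from_nat i) s)"
    unfolding A(2) by auto
qed

end

lemma dsub_at_eval:
  assumes H: "dsub F H"
  shows "dsub_at F \<beta> ((\<lambda>G. G \<beta>) ` H)"
  unfolding dsub_at_def
proof (intro conjI allI ballI)
  show "rat.subspace ((\<lambda>G. G \<beta>) ` H)"
  proof (rule rat.subspaceI)
    show "0 \<in> (\<lambda>G. G \<beta>) ` H"
      using csub_0[OF dsub_csub[OF H]] by (rule image_eqI[rotated]) simp
  next
    fix x y assume "x \<in> (\<lambda>G. G \<beta>) ` H" "y \<in> (\<lambda>G. G \<beta>) ` H"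
    then obtain G G' where G: "G \<in> H" "x = G \<beta>" "G' \<in> H" "y = G' \<beta>"
      by blast
    show "x + y \<in> (\<lambda>G. G \<beta>) ` H"
      by (rule image_eqI[OF _ csub_add[OF dsub_csub[OF H] G(1,3)]]) (simp add: G)
  next
    fix w x assume "x \<in> (\<lambda>G. G \<beta>) ` H"
    then obtain G where G: "G \<in> H" "x = G \<beta>"
      by blast
    show "cst w * x \<in> (\<lambda>G. G \<beta>) ` H"
      by (rule image_eqI[OF _ csub_cst[OF dsub_csub[OF H] G(1), of w]]) (simp add: G)
  qed
next
  fix i x assume "x \<in> (\<lambda>G. G \<beta>) ` H"
  then obtain G where G: "G \<in> H" "x = G \<beta>"
    by blast
  show "xvar i * x \<in> (\<lambda>G. G \<beta>) ` H"
    by (rule image_eqI[OF _ dsub_xvar[OF H G(1), of i]]) (simp add: G)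
  show "conn F \<beta> i x \<in> (\<lambda>G. G \<beta>) ` H"
    by (rule image_eqI[OF _ dsub_conn[OF H G(1), of i]]) (simp add: G)
qed

context poly_tuple
begin

text \<open>Zorn's lemma in the localisation at \<open>S\<close>, whose submodules are represented
  by their saturated preimages. Properness means that 1 is missing; maximality says that a larger
  submodule contains 1 after localisation.\<close>

lemma maximal_saturated_dsub:
  assumes S: "1 \<in> S" "\<And>b c. b \<in> S \<Longrightarrow> c \<in> S \<Longrightarrow> b * c \<in> S"
    and P: "P \<in> sections" "\<And>b. b \<in> S \<Longrightarrow> smul b (\<lambda>_. 1) \<notin> dspan F P"
  shows "\<exists>H. (dsub F H \<and> H \<subseteq> sections \<and> P \<in> H \<and> (\<lambda>_. 1) \<notin> H) \<and>
    (\<forall>b\<in>S. \<forall>G\<in>sections. smul b G \<in> H \<longrightarrow> G \<in> H) \<and>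
    (\<forall>X. dsub F X \<longrightarrow> H \<subseteq> X \<longrightarrow> X \<subseteq> sections \<longrightarrow> X \<noteq> H \<longrightarrow> (\<exists>b\<in>S. smul b (\<lambda>_. 1) \<in> X))"
proof -
  define sat where "sat X = {G \<in> sections. \<exists>b\<in>S. smul b G \<in> X}" for X
  have sat_dsub: "dsub F (sat X)" if "dsub F X" for X
    unfolding sat_def by (rule dsub_saturation[OF that S])
  have sat_sections: "sat X \<subseteq> sections" for X
    by (auto simp: sat_def)
  have sat_super: "X \<subseteq> sat X" if "X \<subseteq> sections" for X
  proof
    fix G assume "G \<in> X"
    then show "G \<in> sat X"
      unfolding sat_def using that S(1) by (intro CollectI conjI bexI[of _ 1]) auto
  qed
  have sat_closed: "G \<in> sat X" if "b \<in> S" "G \<in> sections" "smul b G \<in> sat X" for b G X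
  proof -
    from that(3) obtain c where c: "c \<in> S" "smul c (smul b G) \<in> X"
      unfolding sat_def by blast
    then have "smul (c * b) G \<in> X"
      by (simp add: cst_mult mult.assoc)
    then show ?thesis
      unfolding sat_def using that(2) S(2)[OF c(1) that(1)] by (intro CollectI conjI bexI[of _ "c * b"])
  qed
  have sat_one: "(\<lambda>_. 1) \<in> sat X \<longleftrightarrow> (\<exists>b\<in>S. smul b (\<lambda>_. 1) \<in> X)" for X
    using one_sections by (simp add: sat_def)
  define \<A> where "\<A> = {X. dsub F X \<and> X \<subseteq> sections \<and> P \<in> X \<and> (\<lambda>_. 1) \<notin> X \<and>
    (\<forall>b\<in>S. \<forall>G\<in>sections. smul b G \<in> X \<longrightarrow> G \<in> X)}"
  have satA: "sat X \<in> \<A>" if "dsub F X" "P \<in> X" "X \<subseteq> sections" "(\<lambda>_. 1) \<notin> sat X" for X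
    unfolding \<A>_def using that sat_dsub sat_sections sat_super[of X] sat_closed by blast
  have "sat (dspan F P) \<in> \<A>"
    using P(2) by (intro satA dsub_dspan dspan_base dspan_subset_sections[OF P(1)]) (auto simp: sat_one)
  moreover have "\<Union>C \<in> \<A>" if "C \<noteq> {}" "subset.chain \<A> C" for C
  proof -
    have C: "C \<subseteq> \<A>" "\<And>X Y. X \<in> C \<Longrightarrow> Y \<in> C \<Longrightarrow> X \<subseteq> Y \<or> Y \<subseteq> X"
      using that(2) by (auto simp: subset_chain_def)
    have "dsub F (\<Union>C)"
      by (rule dsub_chain_Union[OF that(1)]) (use C in \<open>auto simp: \<A>_def\<close>)
    then show ?thesis
      unfolding \<A>_def using C(1)[unfolded \<A>_def] that(1) by blast
  qed
  ultimately obtain H where H: "H \<in> \<A>" "\<forall>X\<in>\<A>. H \<subseteq> X \<longrightarrow> X = H"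
    using subset_Zorn_nonempty[of \<A>] by blast
  have H': "dsub F H" "H \<subseteq> sections" "P \<in> H" "(\<lambda>_. 1) \<notin> H"
    "\<And>b G. b \<in> S \<Longrightarrow> G \<in> sections \<Longrightarrow> smul b G \<in> H \<Longrightarrow> G \<in> H"
    using H(1) unfolding \<A>_def by simp_all
  have max: "\<exists>b\<in>S. smul b (\<lambda>_. 1) \<in> X" if "dsub F X" "H \<subseteq> X" "X \<subseteq> sections" "X \<noteq> H" for X
  proof (rule ccontr)
    assume "\<not> ?thesis"
    then have "sat X \<in> \<A>"
      using that H'(3) by (intro satA) (auto simp: sat_one)
    moreover have "X \<subseteq> sat X"
      by (rule sat_super[OF that(3)])
    ultimately show False
      using H(2) that(2,4) by blast
  qed
  show ?thesis
    by (intro exI[of _ H] conjI ballI allI impI) (fact H' | rule H'(5) max; assumption)+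
qed

text \<open>Dixmier's argument: on a quotient of countable dimension without proper quotients, each
  \<open>s\<^sub>j\<close> acts as a scalar, because \<open>\<complex>\<close> is uncountable.\<close>

lemma coordinate_scalar:
  assumes S: "1 \<in> S" "\<And>b c. b \<in> S \<Longrightarrow> c \<in> S \<Longrightarrow> b * c \<in> S" "countable S"
    and Sgen: "\<And>k. \<exists>b\<in>S. (\<lambda>s. cst (meval b s) / ff ^ k) \<in> dspan F (\<lambda>_. 1)"
    and H: "dsub F H" "H \<subseteq> sections" "(\<lambda>_. 1) \<notin> H"
      "\<And>b G. b \<in> S \<Longrightarrow> G \<in> sections \<Longrightarrow> smul b G \<in> H \<Longrightarrow> G \<in> H"
      "\<And>X. dsub F X \<Longrightarrow> H \<subseteq> X \<Longrightarrow> X \<subseteq> sections \<Longrightarrow> X \<noteq> H \<Longrightarrow> \<exists>b\<in>S. smul b (\<lambda>_. 1) \<in> X"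
  shows "\<exists>z. \<forall>G\<in>sections. smul (mvar j - mconst z) G \<in> H"
proof (rule ccontr)
  assume contr: "\<not> ?thesis"
  note cH = dsub_csub[OF H(1)]
  define lin where "lin z = mvar j - mconst z" for z :: complex
  \<comment> \<open>s_j - z is injective modulo \<open>H\<close>: otherwise its kernel contains 1
    after localisation, and as 1 generates the localised sections, s_j - z would be zero on the
    quotient.\<close>
  have inj: "G \<in> H" if "G \<in> sections" "smul (lin z) G \<in> H" for z G
  proof -
    define K where "K = sections \<inter> {G. smul (lin z) G \<in> H}"
    have K: "dsub F K"
      unfolding K_def by (intro dsub_Int dsub_sections dsub_preimage H(1))
    have "H \<subseteq> K"
      unfolding K_def using H(2) csub_scale[OF cH] by blast
    moreover have "K \<subseteq> sections"
      by (simp add: K_def)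
    moreover have "\<not> (\<exists>b\<in>S. smul b (\<lambda>_. 1) \<in> K)"
    proof
      assume "\<exists>b\<in>S. smul b (\<lambda>_. 1) \<in> K"
      then obtain b where b: "b \<in> S" "smul (lin z) (smul b (\<lambda>_. 1)) \<in> H"
        unfolding K_def by blast
      have "smul (lin z) V \<in> H" if V: "V \<in> sections" for V
      proof -
        obtain k where k: "\<forall>Y b. dsub F Y \<longrightarrow> (\<lambda>s. cst (meval b s) / ff ^ k) \<in> Y \<longrightarrow> smul b V \<in> Y"
          using sections_pole_bound[OF V] by (rule exE)
        obtain c where c: "c \<in> S" "(\<lambda>s. cst (meval c s) / ff ^ k) \<in> dspan F (\<lambda>_. 1)"
          using Sgen[of k] by (rule bexE)
        define Y where "Y = {G. smul (lin z * b) G \<in> H}"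
        have Y: "dsub F Y"
          unfolding Y_def by (rule dsub_preimage[OF H(1)])
        have "dspan F (\<lambda>_. 1) \<subseteq> Y"
          by (rule dspan_least[OF Y]) (use b(2) in \<open>simp add: Y_def cst_mult\<close>)
        then have "smul c V \<in> Y"
          using c(2) k Y by (auto simp only: subset_iff)
        then have "smul (b * c) (smul (lin z) V) \<in> H"
          unfolding Y_def by (simp add: cst_mult mult_ac)
        then show ?thesis
          by (rule H(4)[OF S(2)[OF b(1) c(1)] csub_scale[OF csub_sections V]])
      qed
      then show False
        using contr unfolding lin_def by blast
    qed
    ultimately have "K = H"
      using H(5)[OF K] by blast
    then show ?thesis
      using that unfolding K_def by blast
  qed
  have inj_poly: "G \<in> H" if "q \<noteq> 0" "G \<in> sections" "(\<lambda>s. cst (poly q (s $ j)) * G s) \<in> H" for q G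
    using that
  proof (induction "degree q" arbitrary: q rule: less_induct)
    case less
    show ?case
    proof (cases "degree q = 0")
      case True
      then obtain a where q: "q = [:a:]"
        by (rule degree_eq_zeroE)
      then have "(\<lambda>s. cst (inverse a) * (cst a * G s)) \<in> H"
        using csub_cst[OF cH less.prems(3), of "inverse a"] by simp
      then show ?thesis
        using less.prems(1) q by (simp add: mult.assoc[symmetric] cst_mult[symmetric])
    next
      case False
      then obtain z where "poly q z = 0"
        using fundamental_theorem_of_algebra[of q] by (auto simp: constant_degree)
      then obtain r where q: "q = [:-z, 1:] * r"
        unfolding poly_eq_0_iff_dvd by (rule dvdE)
      have r0: "r \<noteq> 0"
        using less.prems(1) unfolding q by auto
      then have "degree q = degree [:-z, 1:] + degree r"
        unfolding q by (intro degree_mult_eq) auto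
      then have r: "r \<noteq> 0" "degree r < degree q"
        using r0 by auto
      obtain b where b: "\<And>s. meval b s = poly r (s $ j)"
        using meval_poly by blast
      have "smul (lin z) (smul b G) \<in> H"
      proof -
        have "poly q x = (x - z) * poly r x" for x
          unfolding q by (simp add: algebra_simps)
        then show ?thesis
          using less.prems(3) by (simp add: b lin_def cst_mult mult.assoc)
      qed
      then have "smul b G \<in> H"
        by (rule inj[rotated]) (rule csub_scale[OF csub_sections less.prems(2)])
      then show ?thesis
        by (intro less.hyps[OF r(2,1) less.prems(2)]) (simp add: b)
    qed
  qed
  \<comment> \<open>The image of s_j - z is nonzero modulo \<open>H\<close>, so by maximality it
    contains 1 after localisation. \<open>snd q\<close> inverts s_j - z up to the denominator
    \<open>fst q\<close>.\<close>
  have "\<forall>z. \<exists>q. fst q \<in> S \<and> snd q \<in> sections \<and> (\<lambda>s. cst (meval (fst q) s) - cst (meval (lin z) s) * snd q s) \<in> H"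
  proof
    fix z
    define I where "I = {(\<lambda>s. G s + cst (meval (lin z) s) * V s) | G V. G \<in> H \<and> V \<in> sections}"
    have I: "dsub F I"
      unfolding I_def by (rule dsub_add_multiple[OF H(1)])
    have II: "(\<lambda>s. G s + cst (meval (lin z) s) * V s) \<in> I" if "G \<in> H" "V \<in> sections" for G V
      unfolding I_def using that by blast
    have "H \<subseteq> I"
      using II[OF _ csub_0[OF csub_sections]] by auto
    moreover have "I \<subseteq> sections"
      unfolding I_def using H(2) by (auto intro!: csub_add[OF csub_sections] csub_scale[OF csub_sections])
    moreover have "I \<noteq> H"
    proof
      assume "I = H"
      then have "smul (lin z) V \<in> H" if "V \<in> sections" for V
        using II[OF csub_0[OF cH] that] by simp
      then show False
        using contr unfolding lin_def by blast
    qed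
    ultimately have "\<exists>b\<in>S. smul b (\<lambda>_. 1) \<in> I"
      by (rule H(5)[OF I])
    then obtain b G V where "b \<in> S" "V \<in> sections" "G \<in> H"
      and eq: "smul b (\<lambda>_. 1) = (\<lambda>s. G s + cst (meval (lin z) s) * V s)"
      unfolding I_def by blast
    moreover have "cst (meval b s) - cst (meval (lin z) s) * V s = G s" for s
      using fun_cong[OF eq, of s] by simp
    ultimately show "\<exists>q. fst q \<in> S \<and> snd q \<in> sections \<and> (\<lambda>s. cst (meval (fst q) s) - cst (meval (lin z) s) * snd q s) \<in> H"
      by (intro exI[of _ "(b, V)"]) simp
  qed
  then obtain q where "\<forall>z. fst (q z) \<in> S \<and> snd (q z) \<in> sections \<and>
      (\<lambda>s. cst (meval (fst (q z)) s) - cst (meval (lin z) s) * snd (q z) s) \<in> H"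
    by (rule choice[THEN exE])
  then have q: "\<And>z. fst (q z) \<in> S" "\<And>z. snd (q z) \<in> sections"
    "\<And>z. (\<lambda>s. cst (meval (fst (q z)) s) - cst (meval (lin z) s) * snd (q z) s) \<in> H"
    by simp_all
  obtain e :: "nat \<Rightarrow> ('p, 'n) pfun" where
    e: "\<And>G. G \<in> sections \<Longrightarrow> \<exists>n l. G = (\<lambda>s. \<Sum>i<n. cst (l i) * e i s)"
    using sections_finite_pieces by blast
  have "\<forall>z. \<exists>p. snd (q z) = (\<lambda>s. \<Sum>i<fst p. cst (snd p i) * e i s)"
  proof
    fix z
    obtain n l where "snd (q z) = (\<lambda>s. \<Sum>i<n. cst (l i) * e i s)"
      using e[OF q(2)] by blast
    then show "\<exists>p. snd (q z) = (\<lambda>s. \<Sum>i<fst p. cst (snd p i) * e i s)"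
      by (intro exI[of _ "(n, l)"]) simp
  qed
  then obtain p where p: "\<forall>z. snd (q z) = (\<lambda>s. \<Sum>i<fst (p z). cst (snd (p z) i) * e i s)"
    by (rule choice[THEN exE])
  \<comment> \<open>Denominators and piece numbers form a countable set while \<open>z\<close>
    ranges over C, so infinitely many \<open>z\<close> share both.\<close>
  define key where "key z = (fst (q z), fst (p z))" for z
  have "\<exists>b n. infinite {z. key z = (b, n)}"
  proof (rule ccontr)
    assume "\<not> ?thesis"
    then have fin: "finite {z. key z = x}" for x
      by (cases x) simp
    have "countable (S \<times> (UNIV :: nat set))"
      using S(3) by simp
    then have "countable (\<Union>x\<in>S \<times> UNIV. {z. key z = x})"
      using fin by (intro countable_UN) (simp_all add: countable_finite)
    moreover have "(\<Union>x\<in>S \<times> UNIV. {z. key z = x}) = UNIV"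
      using q(1) by (auto simp: key_def)
    ultimately have "countable (UNIV :: complex set)"
      by simp
    then have "countable (range complex_of_real)"
      by (rule countable_subset[rotated]) simp
    then have "countable (UNIV :: real set)"
      by (rule countable_image_inj_on) (simp add: inj_on_def)
    then show False
      using uncountable_UNIV_real by simp
  qed
  then obtain b n where "infinite {z. key z = (b, n)}"
    by blast
  then obtain Z where Z: "finite Z" "card Z = Suc n" "Z \<subseteq> {z. key z = (b, n)}"
    using infinite_arbitrarily_large by blast
  have Zb: "fst (q z) = b" "fst (p z) = n" if "z \<in> Z" for z
    using Z(3) that by (auto simp: key_def)
  have "b \<in> S"
  proof -
    obtain z where "z \<in> Z" using Z(2) by fastforce
    then show ?thesis using q(1)[of z] Zb by simp
  qed
  obtain a where a: "\<exists>z\<in>Z. a z \<noteq> 0" "\<forall>i\<in>{..<n}. (\<Sum>z\<in>Z. a z * snd (p z) i) = 0"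
    using homogeneous_system[of "{..<n}" Z "\<lambda>z. snd (p z)"] Z by auto
  have V0: "(\<Sum>z\<in>Z. cst (a z) * snd (q z) s) = 0" for s
  proof -
    have "(\<Sum>z\<in>Z. cst (a z) * snd (q z) s) = (\<Sum>z\<in>Z. \<Sum>i<n. cst (a z * snd (p z) i) * e i s)"
      by (intro sum.cong refl) (simp add: p[rule_format] Zb sum_distrib_left cst_mult mult.assoc)
    also have "\<dots> = (\<Sum>i<n. cst (\<Sum>z\<in>Z. a z * snd (p z) i) * e i s)"
      by (subst sum.swap) (simp add: cst_sum sum_distrib_right)
    also have "\<dots> = 0"
      using a(2) by (intro sum.neutral) simp
    finally show ?thesis .
  qed
  \<comment> \<open>The relation reads sum a_z / (s_j - z) = 0 modulo \<open>H\<close>, up to the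
    denominator \<open>b\<close>; \<open>Q\<close> is its numerator. At a \<open>z0\<close> with
    nonzero \<open>a z0\<close> only one summand of \<open>Q\<close> survives.\<close>
  define Q where "Q = (\<Sum>z\<in>Z. smult (a z) (\<Prod>y\<in>Z - {z}. [:-y, 1:]))"
  have "Q \<noteq> 0"
  proof -
    obtain z0 where z0: "z0 \<in> Z" "a z0 \<noteq> 0"
      using a(1) by blast
    have "poly Q z0 = (\<Sum>z\<in>Z. a z * (\<Prod>y\<in>Z - {z}. z0 - y))"
      unfolding Q_def by (simp add: poly_sum poly_prod)
    also have "\<dots> = (\<Sum>z\<in>Z. if z = z0 then a z0 * (\<Prod>y\<in>Z - {z0}. z0 - y) else 0)"
    proof (intro sum.cong refl)
      fix z assume "z \<in> Z"
      have "(\<Prod>y\<in>Z - {z}. z0 - y) = 0" if "z \<noteq> z0"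
        using z0(1) that Z(1) by (intro prod_zero) auto
      then show "a z * (\<Prod>y\<in>Z - {z}. z0 - y) = (if z = z0 then a z0 * (\<Prod>y\<in>Z - {z0}. z0 - y) else 0)"
        by auto
    qed
    also have "\<dots> = a z0 * (\<Prod>y\<in>Z - {z0}. z0 - y)"
      using Z(1) z0(1) by simp
    also have "\<dots> \<noteq> 0"
      using z0(2) Z(1) by auto
    finally show ?thesis
      by auto
  qed
  moreover have "(\<lambda>s. cst (poly Q (s $ j)) * cst (meval b s)) \<in> H"
  proof -
    define Pz where "Pz z = (\<Prod>y\<in>Z - {z}. lin y)" for z
    define Hz where "Hz z = (\<lambda>s. cst (meval b s) - cst (meval (lin z) s) * snd (q z) s)" for z
    have Hz: "Hz z \<in> H" if "z \<in> Z" for z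
      using q(3)[of z] Zb(1)[OF that] by (simp add: Hz_def)
    have all: "meval (Pz z) s * meval (lin z) s = meval (\<Prod>y\<in>Z. lin y) s" if "z \<in> Z" for z s
      unfolding Pz_def using Z(1) that by (simp add: prod.remove[of Z z] mult.commute)
    have "cst (poly Q (s $ j)) * cst (meval b s) = (\<Sum>z\<in>Z. cst (a z) * smul (Pz z) (Hz z) s)" for s
    proof -
      have "(\<Sum>z\<in>Z. cst (a z) * smul (Pz z) (Hz z) s) =
          (\<Sum>z\<in>Z. cst (a z * meval (Pz z) s) * cst (meval b s)) -
          (\<Sum>z\<in>Z. cst (meval (Pz z) s * meval (lin z) s) * (cst (a z) * snd (q z) s))"
        by (simp add: Hz_def sum_subtractf[symmetric] cst_mult algebra_simps)
      also have "(\<Sum>z\<in>Z. cst (meval (Pz z) s * meval (lin z) s) * (cst (a z) * snd (q z) s)) =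
          cst (meval (\<Prod>y\<in>Z. lin y) s) * (\<Sum>z\<in>Z. cst (a z) * snd (q z) s)"
        unfolding sum_distrib_left by (intro sum.cong refl) (simp only: all)
      also have "(\<Sum>z\<in>Z. cst (a z * meval (Pz z) s) * cst (meval b s)) = cst (poly Q (s $ j)) * cst (meval b s)"
        unfolding Q_def Pz_def poly_sum cst_sum sum_distrib_right meval_prod lin_def by (simp add: poly_prod)
      finally show ?thesis
        by (simp add: V0)
    qed
    then show ?thesis
      by (simp only:) (intro csub_sum[OF cH] csub_cst[OF cH] csub_scale[OF cH] Hz)
  qed
  moreover have "(\<lambda>s. cst (meval b s)) \<in> sections"
    using csub_scale[OF csub_sections one_sections, of b] by simp
  ultimately have "(\<lambda>s. cst (meval b s)) \<in> H"
    using inj_poly[of Q "\<lambda>s. cst (meval b s)"] by blast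
  then have "(\<lambda>_. 1) \<in> H"
    using H(4)[OF \<open>b \<in> S\<close> one_sections] by simp
  then show False
    using H(3) by simp
qed

text \<open>A simple quotient of the localised sections is supported at one point \<beta> by
  Dixmier's argument. The polynomials in \<open>B\<close> are inverted before the quotient is taken,
  so none of them can vanish at \<beta>.\<close>

lemma closed_point:
  assumes lg: "locally_generated s\<^sub>0" and P: "P \<in> sections"
    and none: "\<And>b. meval b s\<^sub>0 \<noteq> 0 \<Longrightarrow> smul b (\<lambda>_. 1) \<notin> dspan F P"
    and B: "countable B" "\<And>b. b \<in> B \<Longrightarrow> meval b s\<^sub>0 \<noteq> 0"
  obtains \<beta> Y where "\<And>b. b \<in> B \<Longrightarrow> meval b \<beta> \<noteq> 0" "dsub_at F \<beta> Y" "P \<beta> \<in> Y" "1 \<notin> Y"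
proof -
  have "\<exists>d. \<forall>k. meval (d k) s\<^sub>0 \<noteq> 0 \<and> (\<lambda>s. cst (meval (d k) s) / ff ^ k) \<in> dspan F (\<lambda>_. 1)"
    using lg unfolding locally_generated_def by (rule choice)
  then obtain d where d: "\<forall>k. meval (d k) s\<^sub>0 \<noteq> 0 \<and> (\<lambda>s. cst (meval (d k) s) / ff ^ k) \<in> dspan F (\<lambda>_. 1)"
    by (rule exE)
  \<comment> \<open>The monoid generated by the polynomials to be avoided and by the denominators
    \<open>d k\<close> of local generation: countable, with all members nonzero at
    \<open>s\<^sub>0\<close>.\<close>
  define S where "S = prod_list ` lists (B \<union> range d)"
  have gen: "b \<in> S" if "b \<in> B \<union> range d" for b
    unfolding S_def using that by (intro image_eqI[of _ _ "[b]"]) auto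
  have S1: "1 \<in> S"
    unfolding S_def by (intro image_eqI[of _ _ "[]"]) auto
  have S2: "b * c \<in> S" if bc: "b \<in> S" "c \<in> S" for b c
  proof -
    obtain xs ys where "xs \<in> lists (B \<union> range d)" "ys \<in> lists (B \<union> range d)" "b = prod_list xs" "c = prod_list ys"
      using bc unfolding S_def by blast
    then show ?thesis
      unfolding S_def by (intro image_eqI[of _ _ "xs @ ys"]) auto
  qed
  have S3: "countable S"
    unfolding S_def using B(1) by (intro countable_image countable_lists) auto
  have "meval (prod_list xs) s\<^sub>0 \<noteq> 0" if "xs \<in> lists (B \<union> range d)" for xs
    using that by (induction xs) (use B(2) d in auto)
  then have S4: "smul b (\<lambda>_. 1) \<notin> dspan F P" if "b \<in> S" for b
    using that unfolding S_def by (intro none) auto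
  have Sgen: "\<exists>b\<in>S. (\<lambda>s. cst (meval b s) / ff ^ k) \<in> dspan F (\<lambda>_. 1)" for k
    using gen[of "d k"] d by (intro bexI[of _ "d k"]) auto
  from maximal_saturated_dsub[OF S1 S2 P S4] obtain H where
    *: "(dsub F H \<and> H \<subseteq> sections \<and> P \<in> H \<and> (\<lambda>_. 1) \<notin> H) \<and>
      (\<forall>b\<in>S. \<forall>G\<in>sections. smul b G \<in> H \<longrightarrow> G \<in> H) \<and>
      (\<forall>X. dsub F X \<longrightarrow> H \<subseteq> X \<longrightarrow> X \<subseteq> sections \<longrightarrow> X \<noteq> H \<longrightarrow> (\<exists>b\<in>S. smul b (\<lambda>_. 1) \<in> X))"
    by (rule exE)
  have H: "dsub F H" "H \<subseteq> sections" "P \<in> H" "(\<lambda>_. 1) \<notin> H"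
    using *[THEN conjunct1] by blast+
  note H = H *[THEN conjunct2, THEN conjunct1, rule_format] *[THEN conjunct2, THEN conjunct2, rule_format]
  note cH = dsub_csub[OF H(1)]
  have "\<forall>j. \<exists>z. \<forall>G\<in>sections. smul (mvar j - mconst z) G \<in> H"
    by (intro allI coordinate_scalar[OF S1 S2 S3 Sgen H(1,2,4,5,6)])
  then have "\<exists>z. \<forall>j. \<forall>G\<in>sections. smul (mvar j - mconst (z j)) G \<in> H"
    by (rule choice)
  then obtain z where z: "\<And>j G. G \<in> sections \<Longrightarrow> smul (mvar j - mconst (z j)) G \<in> H"
    by blast
  define \<beta> where "\<beta> = (\<chi> j. z j)"
  have \<beta>: "(\<lambda>s. cst (s $ j - \<beta> $ j) * G s) \<in> H" if "G \<in> sections" for G j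
    using z[OF that, of j] by (simp add: \<beta>_def)
  show ?thesis
  proof (rule that)
    fix b assume b: "b \<in> B"
    show "meval b \<beta> \<noteq> 0"
    proof
      assume 0: "meval b \<beta> = 0"
      \<comment> \<open>A member of \<open>B\<close> vanishing at \<beta> would map 1 into
        \<open>H\<close>, and by saturation 1 itself would lie in \<open>H\<close>.\<close>
      obtain h where h: "\<forall>s. meval b s = meval b \<beta> + (\<Sum>j\<in>UNIV. (s $ j - \<beta> $ j) * meval (h j) s)"
        using meval_taylor by (rule exE)
      have "smul b (\<lambda>_. 1 :: 'n ratfun) s = (\<Sum>j\<in>UNIV. cst (s $ j - \<beta> $ j) * smul (h j) (\<lambda>_. 1) s)" for s
        using h[rule_format, of s] 0 by (simp add: cst_sum cst_mult)
      then have "smul b (\<lambda>_. 1) \<in> H"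
        by (simp only:) (intro csub_sum[OF cH] \<beta> csub_scale[OF csub_sections] one_sections)
      then show False
        using H(4,5) gen[of b] b one_sections by blast
    qed
  next
    show "dsub_at F \<beta> ((\<lambda>G. G \<beta>) ` H)"
      by (rule dsub_at_eval[OF H(1)])
  next
    show "P \<beta> \<in> (\<lambda>G. G \<beta>) ` H"
      using H(3) by blast
  next
    show "1 \<notin> (\<lambda>G. G \<beta>) ` H"
    proof
      assume "1 \<in> (\<lambda>G. G \<beta>) ` H"
      then obtain G where G: "G \<in> H" "G \<beta> = 1"
        by auto
      \<comment> \<open>G - 1 lies in the maximal ideal of \<beta> times the sections, hence in
        \<open>H\<close>, and with \<open>G\<close> also 1.\<close>
      from sections_taylor[of G \<beta>] obtain K where
        *: "(\<forall>j. K j \<in> sections) \<and> (\<forall>s. G s = G \<beta> + (\<Sum>j\<in>UNIV. cst (s $ j - \<beta> $ j) * K j s))"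
        using G(1) H(2) by blast
      have "(\<lambda>s. G s - (\<Sum>j\<in>UNIV. cst (s $ j - \<beta> $ j) * K j s)) \<in> H"
        using * by (intro csub_diff[OF cH] csub_sum[OF cH] \<beta> G(1)) auto
      moreover have "G s - (\<Sum>j\<in>UNIV. cst (s $ j - \<beta> $ j) * K j s) = 1" for s
        using *[THEN conjunct2, rule_format, of s] G(2) by simp
      ultimately show False
        using H(4) by simp
    qed
  qed
qed

end

section \<open>Semicontinuity of linear independence\<close>

interpretation rat_complex: vector_space_pair "\<lambda>z (g :: 'n::linorder ratfun). cst z * g" "(*) :: complex \<Rightarrow> complex \<Rightarrow> complex"
  by unfold_locales (simp_all add: algebra_simps)

text \<open>Families rather than sets: the index set stays fixed while \<open>s\<close> varies, and
  coinciding members count as a relation.\<close>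

definition indep_family :: "'i set \<Rightarrow> ('i \<Rightarrow> 'n::linorder ratfun) \<Rightarrow> bool" where
  "indep_family I x \<longleftrightarrow> (\<forall>l. (\<Sum>i\<in>I. cst (l i) * x i) = 0 \<longrightarrow> (\<forall>i\<in>I. l i = 0))"

lemma indep_familyD: "indep_family I x \<Longrightarrow> (\<Sum>i\<in>I. cst (l i) * x i) = 0 \<Longrightarrow> i \<in> I \<Longrightarrow> l i = 0"
  by (simp add: indep_family_def)

lemma indep_family_inj:
  assumes "finite I" "indep_family I x"
  shows "inj_on x I"
proof (rule inj_onI, rule ccontr)
  fix i j assume ij: "i \<in> I" "j \<in> I" "x i = x j" "i \<noteq> j"
  define l :: "'a \<Rightarrow> complex" where "l k = (if k = i then 1 else if k = j then - 1 else 0)" for k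
  have "(\<Sum>k\<in>I. cst (l k) * x k) = (\<Sum>k\<in>{i, j}. cst (l k) * x k)"
    using assms(1) ij by (intro sum.mono_neutral_right) (auto simp: l_def)
  also have "\<dots> = 0"
    using ij by (simp add: l_def cst_uminus)
  finally show False
    using indep_familyD[OF assms(2), of l i] ij by (simp add: l_def)
qed

lemma indep_family_independent:
  assumes "finite I" "indep_family I x"
  shows "rat.independent (x ` I)" "card (x ` I) = card I"
proof -
  have inj: "inj_on x I"
    by (rule indep_family_inj[OF assms])
  show "rat.independent (x ` I)"
  proof (rule rat.independent_if_scalars_zero)
    fix l y assume 0: "(\<Sum>y\<in>x ` I. cst (l y) * y) = 0" and "y \<in> x ` I"
    have "(\<Sum>i\<in>I. cst (l (x i)) * x i) = 0"
      using 0 by (simp add: sum.reindex[OF inj])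
    then show "l y = 0"
      using indep_familyD[OF assms(2), of "\<lambda>i. l (x i)"] \<open>y \<in> x ` I\<close> by blast
  qed (use assms(1) in simp)
  show "card (x ` I) = card I"
    by (rule card_image[OF inj])
qed

context poly_tuple
begin

lemma section_functional:
  assumes "Vector_Spaces.linear (\<lambda>z (g :: 'n ratfun). cst z * g) (*) h" "G \<in> sections"
  shows "\<exists>b. \<forall>s. meval b s = h (G s)"
proof -
  interpret h: Vector_Spaces.linear "\<lambda>z (g :: 'n ratfun). cst z * g" "(*)" h
    by (rule assms(1))
  obtain A c where G: "G = (\<lambda>s. \<Sum>m\<in>A. cst (meval (c m) s) * (case m of (g, k) \<Rightarrow> \<lambda>s. to_fract g / ff ^ k) s)"
    using assms(2) unfolding sections_def by (rule cspanE)
  have "meval (\<Sum>m\<in>A. c m * mconst (h (to_fract (fst m) / ff ^ snd m))) s = h (G s)" for s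
    unfolding G h.sum case_prod_beta h.scale by (simp add: meval_sum)
  then show ?thesis
    by blast
qed

text \<open>In place of a nonvanishing minor, \<open>b\<close> is built up by fraction-free
  elimination; a linear functional normalised on one member supplies each pivot.\<close>

lemma independence_open:
  assumes "finite I" "\<And>i. i \<in> I \<Longrightarrow> w i \<in> sections" "indep_family I (\<lambda>i. w i s\<^sub>0)"
  shows "\<exists>b. meval b s\<^sub>0 \<noteq> 0 \<and> (\<forall>s. meval b s \<noteq> 0 \<longrightarrow> indep_family I (\<lambda>i. w i s))"
  using assms
proof (induction I arbitrary: w rule: finite_induct)
  case empty
  then show ?case by (intro exI[of _ 1]) (simp add: indep_family_def)
next
  case (insert i I)
  have "w i s\<^sub>0 \<noteq> 0"
  proof
    assume 0: "w i s\<^sub>0 = 0"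
    have "(\<Sum>k\<in>insert i I. cst (if k = i then 1 else 0) * w k s\<^sub>0) = 0"
      using 0 by (intro sum.neutral) auto
    then show False
      using indep_familyD[OF insert.prems(2), of "\<lambda>k. if k = i then 1 else 0" i] by simp
  qed
  then have "rat.independent {w i s\<^sub>0}"
    by (simp add: rat.dependent_single)
  then obtain h where h: "Vector_Spaces.linear (\<lambda>z (g :: 'n ratfun). cst z * g) (*) h" "h (w i s\<^sub>0) = 1"
    using rat_complex.linear_independent_extend[of "{w i s\<^sub>0}" "\<lambda>_. 1"] by auto
  interpret h: Vector_Spaces.linear "\<lambda>z (g :: 'n ratfun). cst z * g" "(*)" h
    by (rule h(1))
  obtain p where p: "\<And>s. meval p s = h (w i s)"
    using section_functional[OF h(1), of "w i"] insert.prems(1) by auto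
  have "\<forall>k. \<exists>q. k \<in> I \<longrightarrow> (\<forall>s. meval q s = h (w k s))"
    using section_functional[OF h(1)] insert.prems(1) by auto
  then obtain q where q: "\<And>k s. k \<in> I \<Longrightarrow> meval (q k) s = h (w k s)"
    unfolding choice_iff by auto
  \<comment> \<open>Elimination of \<open>w i\<close>: \<open>h\<close> vanishes on every
    \<open>w' k s\<close>.\<close>
  define w' where "w' k = (\<lambda>s. cst (meval p s) * w k s - cst (meval (q k) s) * w i s)" for k
  have comb: "(\<Sum>k\<in>I. cst (l k) * w' k s) =
      cst (meval p s) * (\<Sum>k\<in>I. cst (l k) * w k s) - cst (\<Sum>k\<in>I. l k * meval (q k) s) * w i s" for l s
    by (simp add: w'_def right_diff_distrib sum_subtractf sum_distrib_left sum_distrib_right cst_sum cst_mult mult_ac)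
  have "indep_family I (\<lambda>k. w' k s\<^sub>0)"
    unfolding indep_family_def
  proof (intro allI impI ballI)
    fix l k assume 0: "(\<Sum>k\<in>I. cst (l k) * w' k s\<^sub>0) = 0" and k: "k \<in> I"
    define l' where "l' j = (if j = i then - (\<Sum>k\<in>I. l k * meval (q k) s\<^sub>0) else l j * meval p s\<^sub>0)" for j
    have "(\<Sum>j\<in>I. cst (l' j) * w j s\<^sub>0) = (\<Sum>j\<in>I. cst (meval p s\<^sub>0) * (cst (l j) * w j s\<^sub>0))"
      using insert.hyps(2) by (intro sum.cong refl) (auto simp: l'_def cst_mult mult_ac)
    then have "(\<Sum>j\<in>insert i I. cst (l' j) * w j s\<^sub>0) = 0"
      using 0 insert.hyps unfolding comb
      by (simp add: sum_distrib_left[symmetric]) (simp add: l'_def cst_uminus)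
    then have "l' k = 0"
      using indep_familyD[OF insert.prems(2)] k by blast
    then show "l k = 0"
      using k insert.hyps(2) by (auto simp: l'_def p h(2) split: if_splits)
  qed
  moreover have "w' k \<in> sections" if "k \<in> I" for k
    unfolding w'_def using insert.prems(1) that by (intro csub_diff csub_scale csub_sections) auto
  ultimately obtain b where b: "meval b s\<^sub>0 \<noteq> 0" "\<And>s. meval b s \<noteq> 0 \<Longrightarrow> indep_family I (\<lambda>i. w' i s)"
    using insert.IH[of w'] by blast
  have "indep_family (insert i I) (\<lambda>i. w i s)" if nz: "meval (p * b) s \<noteq> 0" for s
    unfolding indep_family_def
  proof (intro allI impI)
    fix l assume 0: "(\<Sum>k\<in>insert i I. cst (l k) * w k s) = 0"
    then have s: "(\<Sum>k\<in>I. cst (l k) * w k s) = - (cst (l i) * w i s)"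
      using insert.hyps by (simp add: eq_neg_iff_add_eq_0 add.commute)
    have "h (\<Sum>k\<in>insert i I. cst (l k) * w k s) = (\<Sum>k\<in>insert i I. l k * h (w k s))"
      unfolding h.sum h.scale ..
    then have "l i * meval p s + (\<Sum>k\<in>I. l k * meval (q k) s) = 0"
      using 0 insert.hyps h.zero by (simp add: p q)
    then have "(\<Sum>k\<in>I. l k * meval (q k) s) = - (l i * meval p s)"
      by (simp add: eq_neg_iff_add_eq_0 add.commute)
    then have "(\<Sum>k\<in>I. cst (l k) * w' k s) = 0"
      unfolding comb s by (simp add: cst_uminus cst_mult)
    then have l0: "l k = 0" if "k \<in> I" for k
      using indep_familyD[OF b(2)] nz that by auto
    then have "cst (l i) * w i s = 0"
      using s by simp
    moreover have "w i s \<noteq> 0"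
      using nz h.zero by (auto simp: p)
    ultimately show "\<forall>k\<in>insert i I. l k = 0"
      using l0 by simp
  qed
  then show ?case
    using b(1) by (intro exI[of _ "p * b"]) (simp add: p h(2))
qed

end

section \<open>Bernstein's inequality\<close>

text \<open>D_{<=k} g for the Bernstein filtration, in which coordinates and derivations both have
  degree one.\<close>

definition Vfilt ::
    "('p::finite \<Rightarrow> 'n::{finite,linorder} xpoly) \<Rightarrow> complex ^ 'p \<Rightarrow> nat \<Rightarrow> 'n ratfun \<Rightarrow> 'n ratfun set" where
  "Vfilt F \<beta> k g = rat.span ((\<lambda>m. mon F \<beta> m g) ` {m. deg m \<le> k})"

lemma Vfilt_mon: "deg m \<le> k \<Longrightarrow> mon F \<beta> m g \<in> Vfilt F \<beta> k g"
  unfolding Vfilt_def by (intro rat.span_base) auto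

lemma Vfilt_base: "g \<in> Vfilt F \<beta> k g"
  using Vfilt_mon[of "\<lambda>_. 0" k F \<beta> g] by simp

lemma Vfilt_mono: "j \<le> k \<Longrightarrow> Vfilt F \<beta> j g \<subseteq> Vfilt F \<beta> k g"
  unfolding Vfilt_def by (intro rat.span_mono image_mono) auto

lemma subspace_Vfilt: "rat.subspace (Vfilt F \<beta> k g)"
  unfolding Vfilt_def by (rule rat.subspace_span)

lemma Vfilt_induct:
  assumes "rat.subspace {v. T v \<in> X}" "\<And>m. deg m \<le> k \<Longrightarrow> T (mon F \<beta> m g) \<in> X" "v \<in> Vfilt F \<beta> k g"
  shows "T v \<in> X"
  using rat.span_minimal[OF _ assms(1), of "(\<lambda>m. mon F \<beta> m g) ` {m. deg m \<le> k}"] assms(2,3)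
  unfolding Vfilt_def by auto

lemma Vfilt_xvar: "v \<in> Vfilt F \<beta> k g \<Longrightarrow> xvar i * v \<in> Vfilt F \<beta> (Suc k) g"
proof (rule Vfilt_induct[of "\<lambda>v. xvar i * v"])
  show "rat.subspace {v. xvar i * v \<in> Vfilt F \<beta> (Suc k) g}"
    using subspace_Vfilt[of F \<beta> "Suc k" g]
    by (auto simp: rat.subspace_def distrib_left mult.left_commute[of "xvar i"])
qed (simp_all add: xvar_mon Vfilt_mon)

lemma Vfilt_conn:
  fixes F :: "'p::finite \<Rightarrow> 'n::{finite,linorder} xpoly"
  shows "v \<in> Vfilt F \<beta> k g \<Longrightarrow> conn F \<beta> i v \<in> Vfilt F \<beta> (Suc k) g"
proof (rule Vfilt_induct[of "conn F \<beta> i"])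
  show "rat.subspace {v. conn F \<beta> i v \<in> Vfilt F \<beta> (Suc k) g}"
    using subspace_Vfilt[of F \<beta> "Suc k" g]
    by (auto simp: rat.subspace_def conn_add conn_cst)
next
  fix m :: "'n + 'n \<Rightarrow> nat" assume "deg m \<le> k"
  then have "mon F \<beta> (inc (Inr i) m) g + cst (of_nat (m (Inl i))) * mon F \<beta> (dec (Inl i) m) g \<in> Vfilt F \<beta> (Suc k) g"
    using deg_dec_le[of "Inl i" m]
    by (intro rat.subspace_add[OF subspace_Vfilt] rat.subspace_scale[OF subspace_Vfilt] Vfilt_mon) auto
  then show "conn F \<beta> i (mon F \<beta> m g) \<in> Vfilt F \<beta> (Suc k) g"
    by (simp add: conn_mon cst_of_nat)
qed

lemma Vfilt_mon_closed: "v \<in> Vfilt F \<beta> k g \<Longrightarrow> mon F \<beta> m v \<in> Vfilt F \<beta> (deg m + k) g"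
proof (induction m arbitrary: v k rule: exponent_induct)
  case (inc u m)
  show ?case
  proof (cases u)
    case (Inl i)
    then show ?thesis
      using Vfilt_xvar[OF inc.IH[OF inc.prems], of i] by (simp add: xvar_mon)
  next
    case (Inr i)
    then show ?thesis
      using inc.IH[OF Vfilt_conn[OF inc.prems, of i]] by (simp add: mon_conn)
  qed
qed simp

lemma dsub_at_mon: "dsub_at F \<beta> Y \<Longrightarrow> v \<in> Y \<Longrightarrow> mon F \<beta> m v \<in> Y"
proof (induction m arbitrary: v rule: exponent_induct)
  case (inc u m)
  show ?case
  proof (cases u)
    case (Inl i)
    then show ?thesis
      using inc by (simp add: xvar_mon[symmetric] dsub_at_def)
  next
    case (Inr i)
    then show ?thesis
      using inc by (simp add: mon_conn[symmetric] dsub_at_def)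
  qed
qed simp

lemma sum_shift_exponent:
  fixes h :: "('v::finite \<Rightarrow> nat) \<Rightarrow> 'b::comm_monoid_add"
  assumes "\<And>m. m v = 0 \<Longrightarrow> h m = 0"
  shows "(\<Sum>m\<in>{m. deg m \<le> Suc k}. h m) = (\<Sum>m\<in>{m. deg m \<le> k}. h (inc v m))"
proof -
  have "(\<Sum>m\<in>{m. deg m \<le> k}. h (inc v m)) = (\<Sum>m\<in>inc v ` {m. deg m \<le> k}. h m)"
    by (subst sum.reindex) (auto intro!: inj_onI dest: arg_cong[of _ _ "dec v"])
  also have "\<dots> = (\<Sum>m\<in>{m. deg m \<le> Suc k}. h m)"
  proof (rule sum.mono_neutral_left[OF finite_deg_le])
    show "\<forall>m\<in>{m. deg m \<le> Suc k} - inc v ` {m. deg m \<le> k}. h m = 0"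
    proof
      fix m assume m: "m \<in> {m. deg m \<le> Suc k} - inc v ` {m. deg m \<le> k}"
      have "m v = 0"
      proof (rule ccontr)
        assume "m v \<noteq> 0"
        then have "m = inc v (dec v m)" "deg (dec v m) \<le> k"
          using m deg_dec[of m v] by (auto simp: inc_dec)
        then show False
          using m by blast
      qed
      then show "h m = 0"
        by (rule assms)
    qed
  qed auto
  finally show ?thesis ..
qed

text \<open>Commuting an operator with a coordinate or a derivation lowers its degree bound by one
  and keeps the property of mapping a filtration piece into \<open>Y\<close>, now for the next
  smaller piece. In the end a nonzero constant is left, applied to 1.\<close>

lemma bernstein_faithful:
  fixes F :: "'p::finite \<Rightarrow> 'n::{finite,linorder} xpoly"
  assumes Y: "dsub_at F \<beta> Y" and "deg m0 \<le> k" "l m0 \<noteq> 0"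
    and "\<And>v. v \<in> Vfilt F \<beta> k 1 \<Longrightarrow> (\<Sum>m\<in>{m. deg m \<le> k}. cst (l m) * mon F \<beta> m v) \<in> Y"
  shows "1 \<in> Y"
  using assms(2-)
proof (induction k arbitrary: l m0)
  have sub: "rat.subspace Y"
    using Y by (simp add: dsub_at_def)
  have final: "1 \<in> Y" if "cst a * 1 \<in> Y" "a \<noteq> 0" for a
    using rat.subspace_scale[OF sub that(1), of "inverse a"] that(2) by (simp add: cst_mult[symmetric])
  {
    case 0
    have "{m :: 'n + 'n \<Rightarrow> nat. deg m \<le> 0} = {\<lambda>_. 0}" "m0 = (\<lambda>_. 0)"
      using 0(1) by (auto simp: deg_eq_0_iff)
    then show ?case
      using 0(2) 0(3)[OF Vfilt_base] by (intro final[of "l m0"]) simp_all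
  next
    case (Suc k)
    show ?case
    proof (cases "\<exists>m. deg m \<le> Suc k \<and> l m \<noteq> 0 \<and> m \<noteq> (\<lambda>_. 0)")
      case False
      then have l0: "l m = 0" if "deg m \<le> Suc k" "m \<noteq> (\<lambda>_. 0)" for m
        using that by blast
      then have "m0 = (\<lambda>_. 0)"
        using Suc.prems(1,2) by blast
      have "(\<Sum>m\<in>{m. deg m \<le> Suc k}. cst (l m) * mon F \<beta> m 1) = (\<Sum>m\<in>{\<lambda>_. 0}. cst (l m) * mon F \<beta> m 1)"
        using l0 by (intro sum.mono_neutral_right finite_deg_le) auto
      then show ?thesis
        using Suc.prems(3)[OF Vfilt_base] Suc.prems(2) \<open>m0 = (\<lambda>_. 0)\<close> by (intro final[of "l m0"]) simp_all
    next
      case True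
      then obtain m u where m: "deg m \<le> Suc k" "l m \<noteq> 0" "m u \<noteq> 0"
        by (auto simp: fun_eq_iff)
      let ?P = "\<lambda>v. \<Sum>m\<in>{m. deg m \<le> Suc k}. cst (l m) * mon F \<beta> m v"
      \<comment> \<open>Coefficients of the commutator with the variable dual to \<open>u\<close>:
        the derivative by \<open>u\<close> of the polynomial with coefficients
        \<open>l\<close>.\<close>
      define l' where "l' m = l (inc u m) * of_nat (Suc (m u))" for m
      have Q: "(\<Sum>m\<in>{m. deg m \<le> k}. cst (l' m) * mon F \<beta> m v) =
          (\<Sum>m\<in>{m. deg m \<le> Suc k}. cst (l m) * (of_nat (m u) * mon F \<beta> (dec u m) v))" for v
        by (subst sum_shift_exponent[of u]) (simp_all add: l'_def cst_mult cst_of_nat cst_add mult_ac)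
      have P: "?P v \<in> Y" if "v \<in> Vfilt F \<beta> (Suc k) 1" for v
        by (rule Suc.prems(3)[OF that])
      have "(\<Sum>m\<in>{m. deg m \<le> k}. cst (l' m) * mon F \<beta> m v) \<in> Y" if v: "v \<in> Vfilt F \<beta> k 1" for v
      proof (cases u)
        case (Inl i)
        have "(\<Sum>m\<in>{m. deg m \<le> k}. cst (l' m) * mon F \<beta> m v) = conn F \<beta> i (?P v) - ?P (conn F \<beta> i v)"
          unfolding Q Inl conn_sum conn_cst conn_mon mon_conn
          by (simp add: sum_subtractf[symmetric] algebra_simps)
        moreover have "?P v \<in> Y" "?P (conn F \<beta> i v) \<in> Y"
          using v Vfilt_mono[of k "Suc k" F \<beta> 1] by (auto intro!: P Vfilt_conn)
        ultimately show ?thesis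
          using Y by (simp add: dsub_at_def rat.subspace_diff)
      next
        case (Inr i)
        have "(\<Sum>m\<in>{m. deg m \<le> k}. cst (l' m) * mon F \<beta> m v) = ?P (xvar i * v) - xvar i * ?P v"
          unfolding Q Inr sum_distrib_left mult.left_commute[of "xvar i"] xvar_mon mon_xvar
          by (simp add: sum_subtractf[symmetric] algebra_simps)
        moreover have "?P v \<in> Y" "?P (xvar i * v) \<in> Y"
          using v Vfilt_mono[of k "Suc k" F \<beta> 1] by (auto intro!: P Vfilt_xvar)
        ultimately show ?thesis
          using Y by (simp add: dsub_at_def rat.subspace_diff)
      qed
      moreover have "deg (dec u m) \<le> k" "l' (dec u m) \<noteq> 0"
        using m deg_dec[of m u] by (simp_all add: l'_def inc_dec)
          (metis of_nat_Suc of_nat_eq_0_iff nat.distinct(1))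
      ultimately show ?thesis
        using Suc.IH by blast
    qed
  }
qed

text \<open>Otherwise some nonzero combination of the monomials of degree \<open>\<le> k\<close> maps \<open>V\<^sub>k\<close> into \<open>Y\<close>,
  against \<open>bernstein_faithful\<close>.\<close>

lemma bernstein_inequality:
  fixes F :: "'p::finite \<Rightarrow> 'n::{finite,linorder} xpoly"
  assumes Y: "dsub_at F \<beta> Y" "1 \<notin> Y"
    and A: "finite A" "Vfilt F \<beta> k 1 \<subseteq> rat.span (A \<union> Y)" "A \<subseteq> Vfilt F \<beta> k 1"
    and B: "finite B" "Vfilt F \<beta> (2 * k) 1 \<subseteq> rat.span (B \<union> Y)"
  shows "card {m :: 'n + 'n \<Rightarrow> nat. deg m \<le> k} \<le> card A * card B"
proof (rule ccontr)
  assume less: "\<not> ?thesis"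
  let ?M = "{m :: 'n + 'n \<Rightarrow> nat. deg m \<le> k}"
  have sub: "rat.subspace Y"
    using Y(1) by (simp add: dsub_at_def)
  have modY: "\<exists>c. x - (\<Sum>b\<in>B. cst (c b) * b) \<in> Y" if "x \<in> rat.span (B \<union> Y)" for x
  proof -
    have sY: "rat.span Y = Y"
      using sub by simp
    have "x \<in> {y + z | y z. y \<in> rat.span B \<and> z \<in> Y}"
      using that unfolding rat.span_Un sY .
    then obtain y z where "x = y + z" "y \<in> rat.span B" "z \<in> Y"
      by blast
    moreover obtain c where "y = (\<Sum>b\<in>B. cst (c b) * b)"
      using \<open>y \<in> rat.span B\<close> unfolding rat.span_finite[OF B(1)] by auto
    ultimately show ?thesis
      by (intro exI[of _ c]) simp
  qed
  \<comment> \<open>Coordinates, modulo \<open>Y\<close> and in terms of \<open>B\<close>, of each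
    monomial of degree at most \<open>k\<close> applied to each element of \<open>A\<close>.\<close>
  have "\<forall>q. \<exists>c. fst q \<in> ?M \<and> snd q \<in> A \<longrightarrow> mon F \<beta> (fst q) (snd q) - (\<Sum>b\<in>B. cst (c b) * b) \<in> Y"
  proof
    fix q
    show "\<exists>c. fst q \<in> ?M \<and> snd q \<in> A \<longrightarrow> mon F \<beta> (fst q) (snd q) - (\<Sum>b\<in>B. cst (c b) * b) \<in> Y"
    proof (cases "fst q \<in> ?M \<and> snd q \<in> A")
      case True
      then have "mon F \<beta> (fst q) (snd q) \<in> Vfilt F \<beta> (2 * k) 1"
        using Vfilt_mon_closed[of "snd q" F \<beta> k 1 "fst q"] A(3)
          Vfilt_mono[of "deg (fst q) + k" "2 * k" F \<beta> 1] by auto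
      then show ?thesis
        using modY B(2) by blast
    qed blast
  qed
  then obtain c where c: "\<forall>q. fst q \<in> ?M \<and> snd q \<in> A \<longrightarrow>
      mon F \<beta> (fst q) (snd q) - (\<Sum>b\<in>B. cst (c q b) * b) \<in> Y"
    by (rule choice[THEN exE])
  \<comment> \<open>There are more unknowns, one per monomial, than equations, one per pair in
    \<open>A \<times> B\<close>.\<close>
  obtain l where l: "\<exists>m\<in>?M. l m \<noteq> 0" "\<forall>e\<in>A \<times> B. (\<Sum>m\<in>?M. l m * c (m, fst e) (snd e)) = 0"
    using homogeneous_system[of "A \<times> B" ?M "\<lambda>m e. c (m, fst e) (snd e)"] A(1) B(1) finite_deg_le less
    by (auto simp: card_cartesian_product)
  define P where "P v = (\<Sum>m\<in>?M. cst (l m) * mon F \<beta> m v)" for v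
  have PY: "P v \<in> Y" if "v \<in> Y" for v
    unfolding P_def using dsub_at_mon[OF Y(1) that]
    by (intro rat.subspace_sum[OF sub] rat.subspace_scale[OF sub])
  have PA: "P a \<in> Y" if a: "a \<in> A" for a
  proof -
    have "P a = (\<Sum>m\<in>?M. cst (l m) * (mon F \<beta> m a - (\<Sum>b\<in>B. cst (c (m, a) b) * b)))
        + (\<Sum>b\<in>B. cst (\<Sum>m\<in>?M. l m * c (m, a) b) * b)"
    proof -
      have "(\<Sum>b\<in>B. cst (\<Sum>m\<in>?M. l m * c (m, a) b) * b) = (\<Sum>m\<in>?M. cst (l m) * (\<Sum>b\<in>B. cst (c (m, a) b) * b))"
        unfolding cst_sum sum_distrib_right sum_distrib_left by (subst sum.swap) (simp add: cst_mult mult.assoc)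
      then show ?thesis
        by (simp add: P_def right_diff_distrib sum_subtractf)
    qed
    also have "(\<Sum>b\<in>B. cst (\<Sum>m\<in>?M. l m * c (m, a) b) * b) = 0"
      using l(2) a by (intro sum.neutral) auto
    finally have "P a = (\<Sum>m\<in>?M. cst (l m) * (mon F \<beta> m a - (\<Sum>b\<in>B. cst (c (m, a) b) * b)))"
      by simp
    moreover have "mon F \<beta> m a - (\<Sum>b\<in>B. cst (c (m, a) b) * b) \<in> Y" if "m \<in> ?M" for m
      using c[rule_format, of "(m, a)"] a that by simp
    ultimately show ?thesis
      by (simp only:) (intro rat.subspace_sum[OF sub] rat.subspace_scale[OF sub])
  qed
  have "rat.subspace {v. P v \<in> Y}"
    using sub unfolding rat.subspace_def P_def
    by (simp add: mon_add mon_cst distrib_left sum.distrib mult.left_commute[of "cst (l _)"] sum_distrib_left[symmetric])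
      (use mon_cst[of F \<beta> _ 0 0] in simp)
  then have "rat.span (A \<union> Y) \<subseteq> {v. P v \<in> Y}"
    using PA PY by (intro rat.span_minimal) auto
  then have "P v \<in> Y" if "v \<in> Vfilt F \<beta> k 1" for v
    using A(2) that by blast
  then have "1 \<in> Y"
    using l(1) unfolding P_def by (blast intro: bernstein_faithful[OF Y(1)])
  then show False
    using Y(2) by simp
qed

section \<open>Growth of the number of standard monomials\<close>

text \<open>As \<open>e \<le> E\<close>, the intervals from E j - e to E j do not overlap, so the
  increments add up to at most the total growth.\<close>

lemma sum_telescope_le:
  fixes s :: "nat \<Rightarrow> nat"
  assumes "mono s" "e \<le> E"
  shows "(\<Sum>j=1..J. s (E * j) - s (E * j - e)) \<le> s (E * J)"
proof (induction J)
  case (Suc J)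
  have "s (E * J) \<le> s (E * Suc J - e)"
    using assms(2) by (intro monoD[OF assms(1)]) simp
  moreover have "s (E * Suc J - e) \<le> s (E * Suc J)"
    by (intro monoD[OF assms(1)]) simp
  ultimately show ?case
    using Suc by simp
qed simp

text \<open>A product is at most the square of the sum, so j^n is bounded by the sum of the two
  increments. Summed over j up to J, the left side is of order J^(n+1), while telescoping bounds the
  right side by a multiple of J^n.\<close>

lemma growth_contradiction:
  fixes s :: "nat \<Rightarrow> nat"
  assumes s: "mono s" and e: "e \<le> E"
    and lower: "\<And>j. j > 0 \<Longrightarrow> j ^ (2 * n) \<le> (s (E * j) - s (E * j - e)) * (s (2 * (E * j)) - s (2 * (E * j) - e))"
    and upper: "\<And>k. s k \<le> (k * D + 1) ^ n"
  shows False
proof -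
  let ?q = "\<lambda>E j. s (E * j) - s (E * j - e)"
  have q: "j ^ n \<le> ?q E j + ?q (2 * E) j" if "j > 0" for j
  proof -
    have "(j ^ n) ^ 2 \<le> ?q E j * ?q (2 * E) j"
      using lower[OF that] by (simp add: power_mult[symmetric] mult_ac)
    also have "\<dots> \<le> (?q E j + ?q (2 * E) j) ^ 2"
      by (simp add: power2_eq_square algebra_simps)
    finally show ?thesis
      by (rule power2_le_imp_le) simp
  qed
  have sum: "(\<Sum>j=1..J. j ^ n) \<le> 2 * (2 * E * J * D + 1) ^ n" for J
  proof -
    have "(\<Sum>j=1..J. j ^ n) \<le> (\<Sum>j=1..J. ?q E j + ?q (2 * E) j)"
      using q by (intro sum_mono) auto
    also have "\<dots> \<le> s (E * J) + s (2 * E * J)"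
      unfolding sum.distrib using e by (intro add_mono sum_telescope_le s) auto
    also have "\<dots> \<le> s (2 * E * J) + s (2 * E * J)"
      by (intro add_mono monoD[OF s]) auto
    also have "\<dots> \<le> 2 * (2 * E * J * D + 1) ^ n"
      using upper[of "2 * E * J"] by simp
    finally show ?thesis .
  qed
  \<comment> \<open>Chosen so that the bound at J = 2 M is at most C M^n; the M summands with M < j
    <= 2 M alone contribute M M^n, and M = C + 1.\<close>
  define C where "C = 2 * (2 * (2 * E * D + 1)) ^ n"
  define M where "M = Suc C"
  have "M * M ^ n = (\<Sum>j\<in>{M<..2 * M}. M ^ n)"
    by simp
  also have "\<dots> \<le> (\<Sum>j\<in>{M<..2 * M}. j ^ n)"
    by (intro sum_mono power_mono) auto
  also have "\<dots> \<le> (\<Sum>j=1..2 * M. j ^ n)"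
    by (intro sum_mono2) auto
  also have "\<dots> \<le> 2 * (2 * E * (2 * M) * D + 1) ^ n"
    by (rule sum)
  also have "\<dots> \<le> 2 * ((2 * (2 * E * D + 1)) * M) ^ n"
    by (intro mult_left_mono power_mono) (auto simp: M_def algebra_simps)
  also have "\<dots> = C * M ^ n"
    by (simp only: C_def power_mult_distrib mult.assoc)
  finally have "M * M ^ n \<le> C * M ^ n" .
  then show False
    by (simp add: M_def)
qed

section \<open>Upper bound for the dimension of the filtration pieces\<close>

definition exp_bounded :: "nat \<Rightarrow> 'n xpoly \<Rightarrow> bool" where
  "exp_bounded D g \<longleftrightarrow> (\<forall>m\<in>Poly_Mapping.keys g. \<forall>i. Poly_Mapping.lookup m i \<le> D)"

lemma exp_bounded_mono: "exp_bounded D g \<Longrightarrow> D \<le> D' \<Longrightarrow> exp_bounded D' g"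
  unfolding exp_bounded_def by (meson order_trans)

lemma exp_bounded_add: "exp_bounded D g \<Longrightarrow> exp_bounded D h \<Longrightarrow> exp_bounded D (g + h)"
  unfolding exp_bounded_def using Poly_Mapping.keys_add[of g h] by blast

lemma exp_bounded_0: "exp_bounded D 0"
  by (simp add: exp_bounded_def)

lemma exp_bounded_sum: "(\<And>i. i \<in> A \<Longrightarrow> exp_bounded D (g i)) \<Longrightarrow> exp_bounded D (sum g A)"
  by (induction A rule: infinite_finite_induct) (auto intro: exp_bounded_add exp_bounded_0)

lemma exp_bounded_mult: "exp_bounded D g \<Longrightarrow> exp_bounded D' h \<Longrightarrow> exp_bounded (D + D') (g * h)"
  unfolding exp_bounded_def using keys_mult[of g h] by (fastforce simp: lookup_add intro: add_mono)

lemma exp_bounded_mconst: "exp_bounded D (mconst z)"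
  by (simp add: exp_bounded_def mconst_def)

lemma exp_bounded_mvar: "exp_bounded 1 (mvar i)"
  by (auto simp: exp_bounded_def mvar_def lookup_single when_def)

lemma exp_bounded_uminus: "exp_bounded D g \<Longrightarrow> exp_bounded D (- g)"
  by (simp add: exp_bounded_def in_keys_iff)

lemma exp_bounded_diff: "exp_bounded D g \<Longrightarrow> exp_bounded D h \<Longrightarrow> exp_bounded D (g - h)"
  using exp_bounded_add[of D g "- h"] exp_bounded_uminus[of D h] by simp

lemma exp_bounded_pdiff:
  assumes "exp_bounded D g"
  shows "exp_bounded D (pdiff i g)"
  unfolding pdiff_def
proof (rule exp_bounded_sum)
  fix m assume m: "m \<in> Poly_Mapping.keys g"
  have "Poly_Mapping.lookup (m - Poly_Mapping.single i 1) k \<le> D" for k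
    using assms m unfolding exp_bounded_def lookup_minus by (meson diff_le_self order_trans)
  then show "exp_bounded D (Poly_Mapping.single (m - Poly_Mapping.single i 1)
      (of_nat (Poly_Mapping.lookup m i) * Poly_Mapping.lookup g m))"
    by (auto simp: exp_bounded_def split: if_splits)
qed

lemma exp_bounded_exists: "\<exists>D. exp_bounded D (g :: 'n::finite xpoly)"
proof -
  have "finite (\<Union>m\<in>Poly_Mapping.keys g. range (Poly_Mapping.lookup m))"
    by auto
  then obtain D where "\<forall>x\<in>(\<Union>m\<in>Poly_Mapping.keys g. range (Poly_Mapping.lookup m)). x \<le> D"
    unfolding finite_nat_set_iff_bounded_le by blast
  then show ?thesis
    by (intro exI[of _ D]) (auto simp: exp_bounded_def)
qed

context poly_tuple
begin

text \<open>The bound is uniform in \<open>s\<close>, because s enters \<open>conn_pole\<close> only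
  through constant factors.\<close>

definition pole_bound :: "nat \<Rightarrow> bool" where
  "pole_bound D \<longleftrightarrow> (\<forall>k m s. deg m \<le> k \<longrightarrow> (\<exists>g. exp_bounded (k * D) g \<and> mon F s m 1 = to_fract g / ff ^ k))"

lemma pole_bound_exists: "\<exists>D. pole_bound D"
proof -
  have "\<exists>D. exp_bounded D f \<and> (\<forall>i j. exp_bounded D (pdiff i (F j) * cofactor j))"
  proof -
    obtain D0 where D0: "exp_bounded D0 f"
      using exp_bounded_exists by blast
    have "\<forall>p. \<exists>D. exp_bounded D (pdiff (fst p) (F (snd p)) * cofactor (snd p))"
      using exp_bounded_exists by blast
    then obtain D1 where D1: "\<And>i j. exp_bounded (D1 (i, j)) (pdiff i (F j) * cofactor j)"
      unfolding choice_iff by fastforce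
    have le: "D1 p \<le> D0 + (\<Sum>p\<in>UNIV. D1 p)" for p
      using member_le_sum[of p UNIV D1] by simp
    have "exp_bounded (D0 + (\<Sum>p\<in>UNIV. D1 p)) f"
      by (rule exp_bounded_mono[OF D0]) simp
    then show ?thesis
      using exp_bounded_mono[OF D1 le] by (intro exI[of _ "D0 + (\<Sum>p\<in>UNIV. D1 p)"] conjI allI)
  qed
  then obtain D where D: "exp_bounded D f" "\<And>i j. exp_bounded D (pdiff i (F j) * cofactor j)"
    by blast
  \<comment> \<open>One step multiplies the numerator by polynomials with exponents at most
    \<open>D\<close>, and possibly by a coordinate; hence \<open>Suc D\<close>.\<close>
  define W where "W k = {to_fract g / ff ^ k | g. exp_bounded (k * Suc D) g}" for k
  have W: "to_fract g / ff ^ k \<in> W k" if "exp_bounded (k * Suc D) g" for g k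
    unfolding W_def using that by blast
  have W_mul: "to_fract g / ff ^ k \<in> W (Suc k)" if "exp_bounded (k * Suc D) g" for g k
  proof -
    have "to_fract g / ff ^ k = to_fract (g * f) / ff ^ Suc k"
      by simp
    then show ?thesis
      using W[OF exp_bounded_mono[OF exp_bounded_mult[OF that D(1)]], of "Suc k"] by simp
  qed
  have W_step: "W k \<subseteq> W (Suc k)" for k
  proof
    fix x assume "x \<in> W k"
    then obtain g where "x = to_fract g / ff ^ k" "exp_bounded (k * Suc D) g"
      unfolding W_def by blast
    then show "x \<in> W (Suc k)"
      by (simp only: W_mul)
  qed
  have W_mono: "W j \<subseteq> W k" if "j \<le> k" for j k
    by (rule lift_Suc_mono_le[of W, OF W_step that])
  have W_add: "x + y \<in> W k" if xy: "x \<in> W k" "y \<in> W k" for x y k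
  proof -
    obtain g h where "x = to_fract g / ff ^ k" "y = to_fract h / ff ^ k" "exp_bounded (k * Suc D) g" "exp_bounded (k * Suc D) h"
      using xy unfolding W_def by blast
    then show ?thesis
      using W[OF exp_bounded_add, of k g h] by (simp add: add_divide_distrib)
  qed
  have W_cst: "cst z * x \<in> W k" if x: "x \<in> W k" for x z k
  proof -
    obtain g where g: "x = to_fract g / ff ^ k" "exp_bounded (k * Suc D) g"
      using x unfolding W_def by blast
    have "exp_bounded (k * Suc D) (mconst z * g)"
      using exp_bounded_mult[OF exp_bounded_mconst[of 0 z] g(2)] by simp
    from W[OF this] show ?thesis
      by (simp add: g(1) cst_def)
  qed
  have W_sum: "(\<Sum>j\<in>A. g j) \<in> W k" if "\<And>j. j \<in> A \<Longrightarrow> g j \<in> W k" for A k and g :: "'p \<Rightarrow> _"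
    using that W[OF exp_bounded_0, of k] by (induction A rule: infinite_finite_induct) (auto intro: W_add)
  have W_xvar: "xvar i * x \<in> W (Suc k)" if x: "x \<in> W k" for x i k
  proof -
    obtain g where g: "x = to_fract g / ff ^ k" "exp_bounded (k * Suc D) g"
      using x unfolding W_def by blast
    have "xvar i * x = to_fract (mvar i * (g * f)) / ff ^ Suc k"
      by (simp add: g xvar_def)
    then show ?thesis
      using W[OF exp_bounded_mono[OF exp_bounded_mult[OF exp_bounded_mvar[of i] exp_bounded_mult[OF g(2) D(1)]]], of "Suc k"] by simp
  qed
  have W_conn: "conn F s i x \<in> W (Suc k)" if x: "x \<in> W k" for x i k s
  proof -
    obtain g where g: "x = to_fract g / ff ^ k" "exp_bounded (k * Suc D) g"
      using x unfolding W_def by blast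
    have "exp_bounded (k * Suc D + D) (pdiff i g * f)"
      by (intro exp_bounded_mult exp_bounded_pdiff g D)
    moreover have "exp_bounded (0 + (k * Suc D) + D) (mconst (of_nat k) * g * pdiff i f)"
      by (intro exp_bounded_mult exp_bounded_pdiff exp_bounded_mconst g D)
    moreover have "mconst (of_nat k) = (of_nat k :: 'n xpoly)"
      by (simp add: mconst_def)
    ultimately have 1: "exp_bounded (Suc k * Suc D) (pdiff i g * f - of_nat k * g * pdiff i f)"
      by (intro exp_bounded_mono[OF exp_bounded_diff]) auto
    have 2: "exp_bounded (Suc k * Suc D) (g * pdiff i (F j) * cofactor j)" for j
      unfolding mult.assoc by (rule exp_bounded_mono[OF exp_bounded_mult[OF g(2) D(2)]]) simp
    show ?thesis
      unfolding g(1) conn_pole by (intro W_add W_sum W_cst W 1 2)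
  qed
  have mon_W: "mon F s m x \<in> W (deg m + k)" if "x \<in> W k" for s m x k
    using that
  proof (induction m arbitrary: x k rule: exponent_induct)
    case (inc u m)
    show ?case
    proof (cases u)
      case (Inl i)
      then show ?thesis
        using W_xvar[OF inc.IH[OF inc.prems], of i] by (simp add: xvar_mon)
    next
      case (Inr i)
      then show ?thesis
        using inc.IH[OF W_conn[OF inc.prems, of s i]] by (simp add: mon_conn)
    qed
  qed simp
  have "1 \<in> W 0"
    using W[of 0 1] exp_bounded_mconst[of 0 1] by simp
  then have "mon F s m 1 \<in> W k" if "deg m \<le> k" for s m k
    using mon_W[of 1 0 s m] W_mono[OF that] by auto
  then have "pole_bound (Suc D)"
    unfolding pole_bound_def W_def by blast
  then show ?thesis
    by blast
qed

text \<open>Over the common denominator f^k the numerators lie in a box of (k D + 1)^n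
  monomials.\<close>

lemma Vfilt_dimension:
  assumes D: "pole_bound D" and I: "finite I" "indep_family I x" "\<And>i. i \<in> I \<Longrightarrow> \<exists>m. deg m \<le> k \<and> x i = mon F s m 1"
  shows "card I \<le> (k * D + 1) ^ CARD('n)"
proof -
  define B where "B = {a :: 'n \<Rightarrow> nat. \<forall>i. a i \<le> k * D}"
  have B: "B = PiE UNIV (\<lambda>_. {..k * D})"
    by (auto simp: B_def PiE_def)
  have "card B = (k * D + 1) ^ CARD('n)" "finite B"
    unfolding B by (simp_all add: card_PiE finite_PiE)
  moreover have "x ` I \<subseteq> rat.span ((\<lambda>a. xpow a / ff ^ k) ` B)"
  proof
    fix y assume "y \<in> x ` I"
    then obtain m where "deg m \<le> k" "y = mon F s m 1"
      using I(3) by blast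
    then obtain g where g: "exp_bounded (k * D) g" "y = to_fract g / ff ^ k"
      using D unfolding pole_bound_def by blast
    have "y = (\<Sum>a\<in>Poly_Mapping.keys g. cst (Poly_Mapping.lookup g a) * (xpow (Poly_Mapping.lookup a) / ff ^ k))"
      unfolding g(2) to_fract_expand sum_divide_distrib by simp
    moreover have "Poly_Mapping.lookup a \<in> B" if "a \<in> Poly_Mapping.keys g" for a
      using g(1) that by (simp add: B_def exp_bounded_def)
    ultimately show "y \<in> rat.span ((\<lambda>a. xpow a / ff ^ k) ` B)"
      by (simp only:) (intro rat.span_sum rat.span_scale rat.span_base imageI)
  qed
  ultimately have "card (x ` I) \<le> card ((\<lambda>a. xpow a / ff ^ k) ` B)"
    using rat.independent_span_bound[OF _ indep_family_independent(1)[OF I(1,2)]] by blast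
  also have "\<dots> \<le> card B"
    by (rule card_image_le) fact
  finally show ?thesis
    using indep_family_independent(2)[OF I(1,2)] \<open>card B = _\<close> by simp
qed

end

text \<open>The vectors that complete \<open>U\<close> to a basis of \<open>V\<close> span
  \<open>V\<close> modulo \<open>Y\<close>, because \<open>U\<close> itself lies in
  \<open>Y\<close>.\<close>

lemma complement_basis:
  assumes V: "rat.subspace V" "V \<subseteq> rat.span T" "finite T" and U: "U \<subseteq> V" "U \<subseteq> Y" "rat.independent U"
  obtains B where "finite B" "B \<subseteq> V" "V \<subseteq> rat.span (B \<union> Y)" "card B \<le> card T - card U"
proof -
  obtain B where B: "U \<subseteq> B" "B \<subseteq> V" "rat.independent B" "V \<subseteq> rat.span B"
    using rat.maximal_independent_subset_extend[OF U(1,3)] by blast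
  have fin: "finite B \<and> card B \<le> card T"
    using B V by (intro rat.independent_span_bound) auto
  have "rat.span B \<subseteq> rat.span (B - U \<union> Y)"
    using U(2) by (intro rat.span_mono) auto
  moreover have "card (B - U) \<le> card T - card U"
    using fin B(1) by (simp add: card_Diff_subset finite_subset diff_le_mono)
  ultimately show ?thesis
    using that[of "B - U"] fin B by auto
qed

context reduced_tuple
begin

section \<open>Dimension count for a proper submodule\<close>

definition std_count :: "nat \<Rightarrow> nat" where
  "std_count k = card (Std_le k)"

lemma finite_Std_le: "finite (Std_le k)"
  by (rule finite_subset[OF _ finite_deg_le[of k]]) auto

lemma mono_std_count: "mono std_count"
  unfolding std_count_def by (intro monoI card_mono finite_Std_le) auto

text \<open>\<open>u\<close> provides \<open>std_count (k - e)\<close> independent elements of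
  \<open>Y\<close> in the piece of degree \<open>k\<close>, which has dimension at most
  \<open>std_count k\<close>. The quotient pieces are bounded by increments of a function of order
  k^n, too small for Bernstein's inequality.\<close>

lemma proper_submodule_contradiction:
  assumes c: "meval c \<beta> \<noteq> 0" and Y: "dsub_at F \<beta> Y" "1 \<notin> Y"
    and u: "\<And>k. indep_family (Std_le k) u" "\<And>m. u m \<in> Y" "\<And>m. u m \<in> Vfilt F \<beta> (deg m + e) 1"
    and bound: "\<And>k. std_count k \<le> (k * D + 1) ^ CARD('n)"
  shows False
proof -
  have complement: "\<exists>B. finite B \<and> B \<subseteq> Vfilt F \<beta> k 1 \<and> Vfilt F \<beta> k 1 \<subseteq> rat.span (B \<union> Y) \<and>
      card B \<le> std_count k - std_count (k - e)" if "e \<le> k" for k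
  proof -
    let ?T = "(\<lambda>m. mon F \<beta> m 1) ` (Std_le k)"
    let ?U = "u ` (Std_le (k - e))"
    have "mon F \<beta> m 1 \<in> rat.span ?T" if "deg m \<le> k" for m
      using Std_span[OF c, of m] that
        rat.span_mono[of "(\<lambda>m'. mon F \<beta> m' 1) ` (Std_le (deg m))" ?T] by fastforce
    then have V: "Vfilt F \<beta> k 1 \<subseteq> rat.span ?T"
      unfolding Vfilt_def by (intro rat.span_minimal) auto
    have U: "?U \<subseteq> Vfilt F \<beta> k 1"
    proof safe
      fix m :: "'n + 'n \<Rightarrow> nat" assume "deg m \<le> k - e"
      then have "deg m + e \<le> k"
        using that by linarith
      then show "u m \<in> Vfilt F \<beta> k 1"
        using u(3)[of m] Vfilt_mono by blast
    qed
    have "finite ?T" "?U \<subseteq> Y"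
      using finite_Std_le u(2) by auto
    then obtain B where "finite B" "B \<subseteq> Vfilt F \<beta> k 1" "Vfilt F \<beta> k 1 \<subseteq> rat.span (B \<union> Y)" "card B \<le> card ?T - card ?U"
      using complement_basis[OF subspace_Vfilt V _ U _ indep_family_independent(1)[OF finite_Std_le u(1)]] by blast
    moreover have "card ?U = std_count (k - e)"
      unfolding std_count_def by (rule indep_family_independent(2)[OF finite_Std_le u(1)])
    moreover have "card ?T \<le> std_count k"
      unfolding std_count_def by (rule card_image_le[OF finite_Std_le])
    ultimately show ?thesis
      by (intro exI[of _ B]) auto
  qed
  have key: "card {m :: 'n + 'n \<Rightarrow> nat. deg m \<le> k} \<le>
      (std_count k - std_count (k - e)) * (std_count (2 * k) - std_count (2 * k - e))" if k: "e \<le> k" for k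
  proof -
    obtain A where A: "finite A" "A \<subseteq> Vfilt F \<beta> k 1" "Vfilt F \<beta> k 1 \<subseteq> rat.span (A \<union> Y)"
      "card A \<le> std_count k - std_count (k - e)"
      using complement[OF k] by blast
    obtain B where B: "finite B" "Vfilt F \<beta> (2 * k) 1 \<subseteq> rat.span (B \<union> Y)"
      "card B \<le> std_count (2 * k) - std_count (2 * k - e)"
      using complement[of "2 * k"] k by auto
    have "card {m :: 'n + 'n \<Rightarrow> nat. deg m \<le> k} \<le> card A * card B"
      by (rule bernstein_inequality[OF Y A(1,3,2) B(1,2)])
    also have "\<dots> \<le> (std_count k - std_count (k - e)) * (std_count (2 * k) - std_count (2 * k - e))"
      by (intro mult_mono A B) auto
    finally show ?thesis .
  qed
  \<comment> \<open>The factor 2n makes the cube bound \<open>card_deg_le\<close> apply in degree E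
    j; the factor \<open>Suc e\<close> makes E positive and at least \<open>e\<close>.\<close>
  define E where "E = CARD('n + 'n) * Suc e"
  have E: "e \<le> E"
  proof -
    have "1 \<le> CARD('n + 'n)"
      by (metis One_nat_def Suc_leI zero_less_card_finite)
    from mult_le_mono[OF this le_SucI[OF order_refl[of e]]] show ?thesis
      unfolding E_def by (simp only: mult_1)
  qed
  show False
  proof (rule growth_contradiction[OF mono_std_count E _ bound])
    fix j :: nat assume "j > 0"
    then have "e \<le> E * j"
      using E by (metis One_nat_def Suc_leI mult.right_neutral mult_le_mono2 order_trans)
    have "j ^ (2 * CARD('n)) \<le> Suc (Suc e * j) ^ CARD('n + 'n)"
    proof -
      have "j ^ (2 * CARD('n)) = j ^ CARD('n + 'n)"
        by (simp add: mult_2)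
      also have "\<dots> \<le> Suc (Suc e * j) ^ CARD('n + 'n)"
        by (intro power_mono) simp_all
      finally show ?thesis .
    qed
    also have "\<dots> \<le> card {m :: 'n + 'n \<Rightarrow> nat. deg m \<le> CARD('n + 'n) * (Suc e * j)}"
      by (rule card_deg_le)
    also have "CARD('n + 'n) * (Suc e * j) = E * j"
      by (simp add: E_def algebra_simps)
    finally show "j ^ (2 * CARD('n)) \<le>
        (std_count (E * j) - std_count (E * j - e)) * (std_count (2 * (E * j)) - std_count (2 * (E * j) - e))"
      using key[OF \<open>e \<le> E * j\<close>] by simp
  qed
qed

text \<open>Failure would give, through \<open>closed_point\<close>, a proper submodule at some
  \<beta> containing \<open>to_fract p\<close>. The relation at \<open>s\<^sub>0\<close> is carried
  to \<beta> with unchanged coefficients: \<open>y \<beta>\<close> lies in that submodule, and the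
  standard monomials applied to it are independent, as they are at \<open>s\<^sub>0\<close>, where y
  = 1.\<close>

lemma functional_equation_near:
  assumes lg: "locally_generated s\<^sub>0" and c: "meval c s\<^sub>0 \<noteq> 0"
    and A: "finite A" "1 = (\<Sum>m\<in>A. cst (l m) * mon F s\<^sub>0 m (to_fract p))"
  shows "\<exists>b. meval b s\<^sub>0 \<noteq> 0 \<and> smul b (\<lambda>_. 1) \<in> dspan F (\<lambda>_. to_fract p)"
proof (rule ccontr)
  assume "\<not> ?thesis"
  then have none: "smul b (\<lambda>_. 1) \<notin> dspan F (\<lambda>_. to_fract p)" if "meval b s\<^sub>0 \<noteq> 0" for b
    using that by blast
  define y where "y s = (\<Sum>m\<in>A. cst (l m) * mon F s m (to_fract p))" for s
  have y0: "y s\<^sub>0 = 1"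
    using A(2) by (simp add: y_def)
  have y: "y \<in> sections"
    unfolding y_def by (intro csub_sum csub_cst csub_sections dsub_mon[OF dsub_sections] to_fract_sections)
  define w where "w m = (\<lambda>s. mon F s m (y s))" for m
  have w: "w m \<in> sections" for m
    unfolding w_def by (rule dsub_mon[OF dsub_sections y])
  have std0: "indep_family (Std_le k) (\<lambda>m. mon F s\<^sub>0 m 1)" for k
    unfolding indep_family_def using Std_independent_at[OF lg c finite_Std_le, of k] by fastforce
  \<comment> \<open>One polynomial for each degree bound \<open>k\<close>; together with
    \<open>c\<close> they form the countable family that \<beta> avoids.\<close>
  have "\<exists>b. meval b s\<^sub>0 \<noteq> 0 \<and> (\<forall>s. meval b s \<noteq> 0 \<longrightarrow> indep_family (Std_le k) (\<lambda>m. w m s))" for k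
    by (rule independence_open[OF finite_Std_le w]) (use std0[of k] in \<open>simp add: w_def y0\<close>)
  then have "\<exists>b. \<forall>k. meval (b k) s\<^sub>0 \<noteq> 0 \<and> (\<forall>s. meval (b k) s \<noteq> 0 \<longrightarrow> indep_family (Std_le k) (\<lambda>m. w m s))"
    by (intro choice allI)
  then obtain b where b: "\<And>k. meval (b k) s\<^sub>0 \<noteq> 0"
    "\<And>k s. meval (b k) s \<noteq> 0 \<Longrightarrow> indep_family (Std_le k) (\<lambda>m. w m s)"
    by blast
  obtain \<beta> Y where \<beta>: "\<And>d. d \<in> insert c (range b) \<Longrightarrow> meval d \<beta> \<noteq> 0"
    and Y: "dsub_at F \<beta> Y" "to_fract p \<in> Y" "1 \<notin> Y"
    by (rule closed_point[OF lg to_fract_sections none, where B = "insert c (range b)"]) (use c b(1) in auto)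
  have sub: "rat.subspace Y"
    using Y(1) by (simp add: dsub_at_def)
  have "to_fract p \<in> Vfilt F \<beta> (\<Sum>a\<in>Poly_Mapping.keys p. deg (Poly_Mapping.lookup a)) 1"
    (is "_ \<in> Vfilt F \<beta> ?d 1")
  proof -
    have "xpow (Poly_Mapping.lookup a) \<in> Vfilt F \<beta> ?d 1" if "a \<in> Poly_Mapping.keys p" for a
    proof -
      have "xpow (Poly_Mapping.lookup a) = mon F \<beta> (case_sum (Poly_Mapping.lookup a) (\<lambda>_. 0)) 1"
        by (simp add: mon_def)
      moreover have "deg (case_sum (Poly_Mapping.lookup a) (\<lambda>_. 0) :: 'n + 'n \<Rightarrow> nat) = deg (Poly_Mapping.lookup a)"
        unfolding deg_def UNIV_sum by (subst sum.union_disjoint) (auto simp: sum.reindex)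
      moreover have "deg (Poly_Mapping.lookup a) \<le> ?d"
        using that by (intro member_le_sum) auto
      ultimately show ?thesis
        using Vfilt_mon by metis
    qed
    then show ?thesis
      unfolding to_fract_expand
      by (intro rat.subspace_sum[OF subspace_Vfilt] rat.subspace_scale[OF subspace_Vfilt])
  qed
  then have p: "mon F \<beta> m (to_fract p) \<in> Vfilt F \<beta> (deg m + ?d) 1" for m
    by (rule Vfilt_mon_closed)
  \<comment> \<open>A bound for the degree of the operator in the relation plus that of
    \<open>p\<close>; it does not depend on \<open>k\<close>.\<close>
  define e where "e = (\<Sum>m\<in>A. deg m) + ?d"
  have "mon F \<beta> m (to_fract p) \<in> Vfilt F \<beta> e 1" if "m \<in> A" for m
  proof -
    have "deg m + ?d \<le> e"
      unfolding e_def using A(1) that by (intro add_right_mono member_le_sum) auto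
    then show ?thesis
      using p[of m] Vfilt_mono by blast
  qed
  then have ye: "y \<beta> \<in> Vfilt F \<beta> e 1"
    unfolding y_def by (intro rat.subspace_sum[OF subspace_Vfilt] rat.subspace_scale[OF subspace_Vfilt])
  have yY: "y \<beta> \<in> Y"
    unfolding y_def by (intro rat.subspace_sum[OF sub] rat.subspace_scale[OF sub] dsub_at_mon[OF Y(1)] Y(2))
  obtain D where D: "pole_bound D"
    using pole_bound_exists by blast
  show False
  proof (rule proper_submodule_contradiction[OF _ Y(1,3), of "\<lambda>m. w m \<beta>" e D])
    show "meval c \<beta> \<noteq> 0"
      using \<beta> by simp
    show "indep_family (Std_le k) (\<lambda>m. w m \<beta>)" for k
      using b(2) \<beta> by simp
    show "w m \<beta> \<in> Y" for m
      unfolding w_def by (rule dsub_at_mon[OF Y(1) yY])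
    show "w m \<beta> \<in> Vfilt F \<beta> (deg m + e) 1" for m
      unfolding w_def by (rule Vfilt_mon_closed[OF ye])
    \<comment> \<open>The count is a dimension at \<open>s\<^sub>0\<close>, where standard monomials
      are independent.\<close>
    show "std_count k \<le> (k * D + 1) ^ CARD('n)" for k
      unfolding std_count_def by (rule Vfilt_dimension[OF D finite_Std_le std0]) auto
  qed
qed

end

section \<open>The Bernstein--Sato polynomial\<close>

lemma poly_ideal_generator:
  fixes I :: "complex poly set"
  assumes add: "\<And>p q. p \<in> I \<Longrightarrow> q \<in> I \<Longrightarrow> p + q \<in> I" and mult: "\<And>r p. p \<in> I \<Longrightarrow> r * p \<in> I"
    and nz: "p0 \<in> I" "p0 \<noteq> 0"
  shows "\<exists>!b. lead_coeff b = 1 \<and> I = {q. b dvd q}"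
proof (rule ex_ex1I)
  obtain g where g: "g \<in> I" "g \<noteq> 0" "\<And>h. h \<in> I \<Longrightarrow> h \<noteq> 0 \<Longrightarrow> degree g \<le> degree h"
    using ex_has_least_nat[of "\<lambda>p. p \<in> I \<and> p \<noteq> 0" p0 degree] nz by blast
  define b where "b = smult (inverse (lead_coeff g)) g"
  have b: "b \<in> I"
    using mult[OF g(1), of "[:inverse (lead_coeff g):]"] by (simp add: b_def)
  have "I = {q. b dvd q}"
  proof (intro equalityI subsetI CollectI)
    fix q assume q: "q \<in> I"
    have "q mod b = q + (- (q div b)) * b"
      by (simp add: minus_div_mult_eq_mod[symmetric])
    then have mod: "q mod b \<in> I"
      by (simp only:) (intro add[OF q mult[OF b]])
    have "q mod b = 0"
    proof (rule ccontr)
      assume nz: "q mod b \<noteq> 0"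
      have "b \<noteq> 0"
        using g(2) by (simp add: b_def)
      then have "degree (q mod b) < degree b"
        using degree_mod_less[of b q] nz by blast
      then show False
        using g(3)[OF mod nz] g(2) by (simp add: b_def)
    qed
    then show "b dvd q"
      by (simp add: dvd_eq_mod_eq_0)
  next
    fix q assume "q \<in> {q. b dvd q}"
    then obtain r where "q = r * b"
      by (auto simp: dvd_def mult.commute)
    then show "q \<in> I"
      using mult[OF b] by simp
  qed
  moreover have "lead_coeff b = 1"
    using g(2) by (simp add: b_def)
  ultimately show "\<exists>b. lead_coeff b = 1 \<and> I = {q. b dvd q}"
    by blast
next
  fix b b' assume *: "lead_coeff b = 1 \<and> I = {q. b dvd q}" "lead_coeff b' = 1 \<and> I = {q. b' dvd q}"
  have "{q. b dvd q} = {q. b' dvd q}"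
    by (rule trans[OF *(1)[THEN conjunct2, symmetric] *(2)[THEN conjunct2]])
  then have dvd: "b dvd q \<longleftrightarrow> b' dvd q" for q
    by (simp add: set_eq_iff)
  then have "b dvd b'" "b' dvd b"
    using dvd[of b] by simp_all
  then show "b = b'"
  proof -
    obtain r where r: "b' = b * r"
      using \<open>b dvd b'\<close> by (rule dvdE)
    have lead: "lead_coeff b = 1" "lead_coeff b' = 1"
      using * by simp_all
    then have nz: "b \<noteq> 0" "b' \<noteq> 0"
      by auto
    then have "r \<noteq> 0" "degree b' \<le> degree b"
      using r \<open>b' dvd b\<close> by (auto intro: dvd_imp_degree_le)
    then have "degree r = 0"
      using nz by (simp add: r degree_mult_eq)
    then obtain a where "r = [:a:]"
      by (rule degree_eq_zeroE)
    then show ?thesis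
      using r lead by (cases "a = 0") simp_all
  qed
qed

lemma meval_mpoly_of_poly: "meval (mpoly_of_poly q) s = poly q (s $ ())"
  unfolding mpoly_of_poly_def meval_sum
  by (simp add: meval_eq_peval peval_single poly_altdef UNIV_unit)

lemma nabla_funpow: "(nabla ^^ k) s = s + (\<chi> j. of_nat k)"
  by (induction k) (simp_all add: nabla_def vec_eq_iff)

lemma meval_nonzero_point:
  assumes "b \<noteq> 0"
  shows "\<exists>s. meval b s \<noteq> 0"
proof -
  have "inj (of_nat :: nat \<Rightarrow> complex)"
    by (simp add: inj_on_def)
  then obtain w where "peval (\<lambda>v. of_nat (w v)) b \<noteq> 0"
    using exists_nonzero_nat_point[of "{b}"] assms by auto
  then show ?thesis
    by (intro exI[of _ "\<chi> v. of_nat (w v)"]) (simp add: meval_eq_peval)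
qed

lemma poly_eventually_nonzero:
  fixes q :: "complex poly"
  assumes "q \<noteq> 0"
  shows "\<exists>m0. \<forall>m\<ge>m0. poly q (of_nat m) \<noteq> 0"
proof -
  have "finite ((of_nat :: nat \<Rightarrow> complex) -` {x. poly q x = 0})"
    by (rule finite_vimageI[OF poly_roots_finite[OF assms]]) (simp add: inj_on_def)
  then obtain m0 where "\<forall>m\<in>(of_nat :: nat \<Rightarrow> complex) -` {x. poly q x = 0}. m < m0"
    unfolding finite_nat_set_iff_bounded by blast
  then show ?thesis
    by (intro exI[of _ m0]) force
qed

context poly_tuple
begin

text \<open>The logarithmic derivative of a product is the sum of those of its factors, so f^c and
  F^(c,...,c) define the same connection. This is where the diagonal enters.\<close>

lemma dlog_diagonal: "dlog (\<lambda>_::unit. f) s i = dlog F (\<chi> j. s $ ()) i"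
proof -
  have "ff * (\<Sum>j\<in>UNIV. to_fract (pdiff i (F j)) / to_fract (F j)) = to_fract (pdiff i f)"
    using rdiff_fpow[of i "\<lambda>_. 1"] by (simp add: fpow_const rdiff_to_fract dlog_def natvec_def)
  then have "(\<Sum>j\<in>UNIV. to_fract (pdiff i (F j)) / to_fract (F j)) = to_fract (pdiff i f) / ff"
    by (simp add: field_simps)
  then show ?thesis
    unfolding dlog_def by (simp add: UNIV_unit sum_distrib_left[symmetric] del: times_divide_eq_right)
qed

lemma mon_diagonal: "mon (\<lambda>_::unit. f) s = mon F (\<chi> j. s $ ())"
proof -
  have "conn (\<lambda>_::unit. f) s = conn F (\<chi> j. s $ ())"
    by (intro ext) (simp add: conn_def dlog_diagonal)
  then show ?thesis
    by (intro ext) (simp add: mon_def conn_pow_def)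
qed

text \<open>\<open>bs_poly\<close> is a definite description, meaningful only if the ideal of (f) is
  nonzero. Restricting the equation of \<open>b\<close> to the diagonal gives a nonzero element of
  that ideal.\<close>

lemma bs_poly_spec:
  assumes b: "b \<in> bs_ideal F" "meval b (\<chi> j. z) \<noteq> 0"
  shows "mpoly_of_poly (bs_poly f) \<in> bs_ideal (\<lambda>_::unit. f)"
proof -
  let ?G = "\<lambda>_::unit. f"
  define I where "I = {q. mpoly_of_poly q \<in> bs_ideal ?G}"
  have I: "q \<in> I \<longleftrightarrow> (\<lambda>s. cst (poly q (s $ ()))) \<in> dspan ?G (\<lambda>_. ff)" for q
    by (simp add: I_def mem_bs_ideal_iff meval_mpoly_of_poly UNIV_unit)
  note cs = dsub_csub[OF dsub_dspan[of ?G "\<lambda>_. ff"]]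
  have add: "p + q \<in> I" if "p \<in> I" "q \<in> I" for p q
    using csub_add[OF cs that[unfolded I]] by (simp add: I cst_add)
  have mult: "r * p \<in> I" if "p \<in> I" for r p
    using csub_scale[OF cs that[unfolded I], of "mpoly_of_poly r"] by (simp add: I cst_mult meval_mpoly_of_poly)
  have restrict: "\<exists>q. \<forall>t. poly q t = meval a (\<chi> j. t)" for a :: "('p, complex) mpoly"
    using meval_line[of a "\<chi> j. 0" "\<chi> j. 1"] by simp
  obtain A d where A: "finite A"
    and bA: "(\<lambda>s. cst (meval b s)) = (\<lambda>s. \<Sum>m\<in>A. cst (meval (d m) s) * mon F s m ff)"
    using b(1) unfolding mem_bs_ideal_iff dspan_def f_def by (rule cspanE)
  obtain q where q: "\<And>t. poly q t = meval b (\<chi> j. t)"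
    using restrict[of b] by (rule exE) blast
  have "\<forall>m. \<exists>q. \<forall>t. poly q t = meval (d m) (\<chi> j. t)"
    by (intro allI restrict)
  then obtain r where r: "\<forall>m t. poly (r m) t = meval (d m) (\<chi> j. t)"
    unfolding choice_iff by (rule exE)
  have "(\<lambda>s. cst (poly q (s $ ()))) = (\<lambda>s. \<Sum>m\<in>A. cst (meval (mpoly_of_poly (r m)) s) * mon ?G s m ff)"
    unfolding q meval_mpoly_of_poly r[rule_format] fun_cong[OF bA] mon_diagonal ..
  then have "q \<in> I"
    unfolding I dspan_def using cspanI[OF A subset_UNIV] by (simp only:)
  moreover have "q \<noteq> 0"
    using b(2) q[of z] by auto
  ultimately have "\<exists>!b. lead_coeff b = 1 \<and> I = {q. b dvd q}"
    using add mult by (intro poly_ideal_generator) auto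
  from theI'[OF this] have "I = {q. bs_poly f dvd q}"
    unfolding bs_poly_def I_def by blast
  then have "bs_poly f \<in> I"
    by simp
  then show ?thesis
    unfolding I_def by simp
qed

lemma eval_dspan:
  assumes "x \<in> (\<lambda>G. G \<alpha>) ` dspan F (\<lambda>_. g)"
  obtains A l where "finite A" "x = (\<Sum>m\<in>A. cst (l m) * mon F \<alpha> m g)"
proof -
  obtain A b where "finite A" "x = (\<Sum>m\<in>A. cst (meval (b m) \<alpha>) * mon F \<alpha> m g)"
    using assms unfolding dspan_def cspan_def by blast
  then show ?thesis
    by (rule that)
qed

text \<open>The generator \<open>F\<^bsup>s\<^esup>\<close> is replaced by \<open>F\<^bsup>s-u\<^esup>\<close>, with \<open>u\<close> such that the leading
  coefficients of the Groebner basis do not vanish at \<open>\<alpha> - u\<close>.\<close>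

lemma functional_equation_at:
  assumes lg: "\<And>k. k > 0 \<Longrightarrow> \<exists>b\<in>bs_ideal F. meval b (\<alpha> - natvec (\<lambda>_. k)) \<noteq> 0"
    and one: "1 \<in> (\<lambda>G. G \<alpha>) ` dspan F (\<lambda>_. ff)"
  shows "\<exists>b\<in>bs_ideal F. meval b \<alpha> \<noteq> 0"
proof -
  obtain b1 where b1: "b1 \<in> bs_ideal F" "b1 \<noteq> 0"
    using lg[of 1] by fastforce
  obtain C where C: "finite C" "\<And>c. c \<in> C \<Longrightarrow> c \<noteq> 0" "\<And>m. m \<notin> Std \<Longrightarrow> leads (\<Prod>C) m"
    using finite_leading_coefficients by blast
  define T where "T = insert b1 C"
  have T: "finite T" "\<And>b. b \<in> T \<Longrightarrow> b \<noteq> 0"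
    using C b1 by (auto simp: T_def)
  have "\<forall>b. \<exists>b'. \<forall>s. meval b' s = meval b (s + \<alpha>)"
    by (intro allI meval_translate)
  then obtain t where t: "\<And>b s. meval (t b) s = meval b (s + \<alpha>)"
    unfolding choice_iff by blast
  have "t b \<noteq> 0" if bT: "b \<in> T" for b
  proof -
    obtain s where "meval b s \<noteq> 0"
      using meval_nonzero_point[OF T(2)[OF bT]] by blast
    then have "meval (t b) (s - \<alpha>) \<noteq> 0"
      by (simp add: t)
    then show ?thesis
      by auto
  qed
  then have "\<exists>w :: 'p \<Rightarrow> nat. \<forall>p\<in>t ` T. peval (\<lambda>v. of_nat (w v)) p \<noteq> 0"
    using T(1) by (intro exists_nonzero_nat_point) (auto simp: inj_on_def)
  then obtain w :: "'p \<Rightarrow> nat" where "\<forall>p\<in>t ` T. peval (\<lambda>v. of_nat (w v)) p \<noteq> 0"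
    by (rule exE)
  then have "meval (t b) (natvec w) \<noteq> 0" if "b \<in> T" for b
    using that by (simp add: meval_eq_peval natvec_def)
  then have w: "meval b (natvec w + \<alpha>) \<noteq> 0" if "b \<in> T" for b
    using that by (simp add: t)
  \<comment> \<open>The point \<alpha> + w lies on the wrong side: \<alpha> - u with natural
    \<open>u\<close> is required. Along the negative diagonal from \<alpha> + w each member of
    \<open>T\<close> is a nonzero polynomial in one variable, hence eventually nonzero.\<close>
  have "\<forall>b. \<exists>q. \<forall>x. poly q x = meval b (\<chi> j. (natvec w + \<alpha>) $ j + x * (\<chi> j. - 1) $ j)"
    by (intro allI meval_line)
  then obtain q where q: "\<forall>b x. poly (q b) x = meval b (\<chi> j. (natvec w + \<alpha>) $ j + x * (\<chi> j. - 1) $ j)"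
    unfolding choice_iff by (rule exE)
  have q': "poly (q b) (of_nat m) = meval b (natvec w + \<alpha> - natvec (\<lambda>_. m))" for b m
    unfolding q[rule_format] by (rule arg_cong[where f = "meval b"]) (simp add: vec_eq_iff natvec_def)
  have "q b \<noteq> 0" if "b \<in> T" for b
  proof
    assume "q b = 0"
    then have "meval b (natvec w + \<alpha> - natvec (\<lambda>_. 0)) = 0"
      using q'[of b 0] by simp
    moreover have "natvec (\<lambda>_. 0) = 0"
      by (simp add: natvec_def vec_eq_iff)
    ultimately show False
      using w[OF that] by simp
  qed
  then have "(\<Prod>b\<in>T. q b) \<noteq> 0"
    using T(1) by simp
  then obtain m0 where "\<And>m. m \<ge> m0 \<Longrightarrow> poly (\<Prod>b\<in>T. q b) (of_nat m) \<noteq> 0"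
    using poly_eventually_nonzero by blast
  then have m0: "meval b (natvec w + \<alpha> - natvec (\<lambda>_. m)) \<noteq> 0" if "m \<ge> m0" "b \<in> T" for m b
    using that T(1) by (simp add: poly_prod q'[symmetric])
  \<comment> \<open>\<open>M\<close> is at least \<open>m0\<close> and makes
    \<open>u = M - w\<close> natural. Hence \<open>b1\<close> is nonzero at all \<alpha> - u - k,
    and this one element of B_F yields local generation at the new point.\<close>
  define M where "M = m0 + (\<Sum>j\<in>UNIV. w j)"
  have M: "m0 \<le> M"
    by (simp add: M_def)
  define u where "u j = M - w j" for j
  have wM: "w j \<le> M" for j
    unfolding M_def using member_le_sum[of j UNIV w] by simp
  have u: "natvec w + \<alpha> - natvec (\<lambda>_. M + k) = \<alpha> - natvec u - natvec (\<lambda>_. k)" for k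
    using wM by (simp add: vec_eq_iff natvec_def u_def of_nat_diff)
  have u0: "natvec w + \<alpha> - natvec (\<lambda>_. M) = \<alpha> - natvec u"
    using u[of 0] by (simp add: natvec_def vec_eq_iff)
  define s\<^sub>0 where "s\<^sub>0 = \<alpha> - natvec u"
  interpret reduced_tuple F "\<Prod>C"
    by unfold_locales (rule C(3))
  have lg0: "locally_generated s\<^sub>0"
  proof (rule locally_generatedI)
    fix k :: nat
    show "\<exists>b\<in>bs_ideal F. meval b (s\<^sub>0 - natvec (\<lambda>_. k)) \<noteq> 0"
      using m0[of "M + k" b1] M b1(1) by (intro bexI[of _ b1]) (auto simp: u s\<^sub>0_def T_def)
  qed
  have c0: "meval (\<Prod>C) s\<^sub>0 \<noteq> 0"
    using m0[OF M] C(1) by (auto simp: meval_prod u0 s\<^sub>0_def T_def)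
  define X where "X = (\<lambda>G. G \<alpha>) ` dspan F (\<lambda>_. ff)"
  have X: "dsub_at F \<alpha> X"
    unfolding X_def by (rule dsub_at_eval[OF dsub_dspan])
  then have subX: "rat.subspace X"
    by (simp add: dsub_at_def)
  \<comment> \<open>The coefficient of F^(\<alpha>-u) over F^\<alpha>. Local generation at \<alpha>
    puts F^(\<alpha>-u) into D F^\<alpha>, and F^\<alpha> lies in D F^(\<alpha>+1).\<close>
  have "1 / fpow u \<in> X"
  proof -
    have "(\<lambda>_. 1 / fpow u) \<in> sections"
    proof -
      have "fpow (\<lambda>_. M) = fpow w * fpow u"
        unfolding fpow_def prod.distrib[symmetric] using wM by (intro prod.cong refl) (simp add: u_def power_add[symmetric])
      then have "1 / fpow u = to_fract (\<Prod>j\<in>UNIV. F j ^ w j) / ff ^ M"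
        by (simp add: fpow_const fpow_to_fract[symmetric])
      then show ?thesis
        by (simp only: pole_sections)
    qed
    then obtain b where b: "meval b \<alpha> \<noteq> 0" "smul b (\<lambda>_. 1 / fpow u) \<in> dspan F (\<lambda>_. 1)"
      using locally_generated_section[OF locally_generatedI[OF lg]] by blast
    from imageI[OF b(2), of "\<lambda>G. G \<alpha>"]
    have "cst (meval b \<alpha>) * (1 / fpow u) \<in> (\<lambda>G. G \<alpha>) ` dspan F (\<lambda>_. 1)" .
    then obtain A l where "cst (meval b \<alpha>) * (1 / fpow u) = (\<Sum>m\<in>A. cst (l m) * mon F \<alpha> m 1)"
      by (rule eval_dspan)
    moreover have "(\<Sum>m\<in>A. cst (l m) * mon F \<alpha> m 1) \<in> X"
      using one dsub_at_mon[OF X] unfolding X_def[symmetric]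
      by (intro rat.subspace_sum[OF subX] rat.subspace_scale[OF subX]) blast
    ultimately have "cst (meval b \<alpha>) * (1 / fpow u) \<in> X"
      by (simp only:)
    then have "cst (inverse (meval b \<alpha>)) * (cst (meval b \<alpha>) * (1 / fpow u)) \<in> X"
      by (rule rat.subspace_scale[OF subX])
    moreover have "cst (inverse (meval b \<alpha>)) * (cst (meval b \<alpha>) * x) = x" for x :: "'n ratfun"
      using b(1) by (simp add: mult.assoc[symmetric] cst_mult[symmetric])
    ultimately show ?thesis
      by (simp only:)
  qed
  then obtain A l where A: "finite A" "1 / fpow u = (\<Sum>m\<in>A. cst (l m) * mon F \<alpha> m ff)"
    unfolding X_def by (rule eval_dspan)
  \<comment> \<open>F^(\<alpha>+1) = p F^(\<alpha>-u).\<close>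
  define p where "p = (\<Prod>j\<in>UNIV. F j ^ u j) * f"
  have p: "to_fract p = fpow u * ff"
    by (simp add: p_def fpow_to_fract)
  have "mon F s\<^sub>0 m (to_fract p) = fpow u * mon F \<alpha> m ff" for m
    unfolding p mon_fpow by (simp add: s\<^sub>0_def)
  then have "(\<Sum>m\<in>A. cst (l m) * mon F s\<^sub>0 m (to_fract p)) = fpow u * (1 / fpow u)"
    unfolding A(2) by (simp add: sum_distrib_left mult.left_commute)
  then have "1 = (\<Sum>m\<in>A. cst (l m) * mon F s\<^sub>0 m (to_fract p))"
    by simp
  then obtain b where b: "meval b s\<^sub>0 \<noteq> 0" "smul b (\<lambda>_. 1) \<in> dspan F (\<lambda>_. to_fract p)"
    using functional_equation_near[OF lg0 c0 A(1)] by blast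
  \<comment> \<open>Translating back by \<open>u\<close> gives b(s-u) F^(s-u) in D[s] F^(s+1);
    multiplication by F^u restores F^s.\<close>
  have "(\<lambda>s. cst (meval b (s - natvec u)) * 1 / fpow u) \<in> dspan F (\<lambda>_. to_fract p / fpow u)"
    using dspan_div_fpow[OF b(2), of u] by simp
  then have "(\<lambda>s. cst (meval b (s - natvec u)) * 1 / fpow u) \<in> dspan F (\<lambda>_. ff)"
    by (simp add: p)
  from dsub_to_fract[OF dsub_dspan this, of "\<Prod>j\<in>UNIV. F j ^ u j"]
  have "(\<lambda>s. cst (meval b (s - natvec u))) \<in> dspan F (\<lambda>_. ff)"
    by (simp add: fpow_to_fract[symmetric])
  moreover obtain b' where b': "\<And>s. meval b' s = meval b (s + - natvec u)"
    using meval_translate by blast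
  ultimately have "b' \<in> bs_ideal F"
    unfolding mem_bs_ideal_iff by (simp add: f_def)
  then show ?thesis
    using b(1) by (intro bexI[of _ b']) (simp_all add: b' s\<^sub>0_def)
qed

end

theorem theoremF:
  fixes F :: "'p::finite \<Rightarrow> ('n::{finite,linorder}) xpoly"
  assumes "(\<Prod>j\<in>UNIV. F j) \<noteq> 0"
  shows "(zero_locus (bs_ideal F) \<inter> diagonal) -
           (\<Union>i\<in>{0<..}. (nabla ^^ i) ` zero_locus (bs_ideal F))
         \<subseteq> (\<lambda>c. \<chi> j. c) ` {c. poly (bs_poly (\<Prod>j\<in>UNIV. F j)) c = 0}"
proof
  interpret poly_tuple F
    by unfold_locales (rule assms)
  fix \<alpha> assume \<alpha>: "\<alpha> \<in> (zero_locus (bs_ideal F) \<inter> diagonal) -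
    (\<Union>i\<in>{0<..}. (nabla ^^ i) ` zero_locus (bs_ideal F))"
  define z where "z = \<alpha> $ undefined"
  have z: "\<alpha> = (\<chi> j. z)"
    using \<alpha> by (auto simp: diagonal_def vec_eq_iff z_def)
  have lg: "\<exists>b\<in>bs_ideal F. meval b (\<alpha> - natvec (\<lambda>_. k)) \<noteq> 0" if "k > 0" for k
  proof (rule ccontr)
    assume "\<not> ?thesis"
    then have "\<alpha> - natvec (\<lambda>_. k) \<in> zero_locus (bs_ideal F)"
      by (auto simp: zero_locus_def)
    moreover have "\<alpha> = (nabla ^^ k) (\<alpha> - natvec (\<lambda>_. k))"
      by (simp add: nabla_funpow natvec_def)
    ultimately have "\<alpha> \<in> (nabla ^^ k) ` zero_locus (bs_ideal F)"
      by blast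
    then show False
      using \<alpha> that by blast
  qed
  have "poly (bs_poly f) z = 0"
  proof (rule ccontr)
    assume nz: "poly (bs_poly f) z \<noteq> 0"
    obtain b where "b \<in> bs_ideal F" "meval b (\<chi> j. z - 1) \<noteq> 0"
      using lg[of 1] by (auto simp: z natvec_def minus_vec_def)
    then have "(\<lambda>s. cst (poly (bs_poly f) (s $ ()))) \<in> dspan (\<lambda>_::unit. f) (\<lambda>_. ff)"
      using bs_poly_spec by (simp add: mem_bs_ideal_iff meval_mpoly_of_poly UNIV_unit)
    then obtain A d where
      "(\<lambda>s. cst (poly (bs_poly f) (s $ ()))) = (\<lambda>s. \<Sum>m\<in>A. cst (meval (d m) s) * mon (\<lambda>_::unit. f) s m ff)"
      unfolding dspan_def by (rule cspanE)
    from fun_cong[OF this, of "\<chi> j. z"]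
    have eq: "cst (poly (bs_poly f) z) = (\<Sum>m\<in>A. cst (meval (d m) (\<chi> j. z)) * mon F \<alpha> m ff)"
      unfolding mon_diagonal by (simp add: z)
    define X where "X = (\<lambda>G. G \<alpha>) ` dspan F (\<lambda>_. ff)"
    have X: "dsub_at F \<alpha> X" "ff \<in> X"
      unfolding X_def using dsub_at_eval[OF dsub_dspan] dspan_base[of "\<lambda>_. ff" F] by auto
    then have subX: "rat.subspace X"
      by (simp add: dsub_at_def)
    have "cst (poly (bs_poly f) z) \<in> X"
      unfolding eq by (intro rat.subspace_sum[OF subX] rat.subspace_scale[OF subX] dsub_at_mon[OF X])
    from rat.subspace_scale[OF subX this, of "inverse (poly (bs_poly f) z)"]
    have "1 \<in> X"
      using nz by (simp add: cst_mult[symmetric])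
    then show False
      using functional_equation_at[OF lg] \<alpha> unfolding X_def by (auto simp: zero_locus_def)
  qed
  then show "\<alpha> \<in> (\<lambda>c. \<chi> j. c) ` {c. poly (bs_poly (\<Prod>j\<in>UNIV. F j)) c = 0}"
    unfolding z f_def by blast
qed

end
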